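(* Fix $h>0$ and let $p,q:\mathbb{R}\to\mathbb{C}$ be $1$-periodic functions with $p,q\in AC_{\rm loc}(\mathbb{R})$ and $p',q'\in L^\infty(\mathbb{R})$. Let $\sigma(\mathfrak{D})\subset\mathbb{C}$ be the $L^2(\mathbb{R})^2$-spectrum of the Dirac operator $\mathfrak{D}$ with potentials $p,q$ and semiclassical parameter $h$. If $z\in\sigma(\mathfrak{D})$, then $$|\operatorname{Re} z|\,|\operatorname{Im} z|\le\frac{h}{2}\left(\|p'\|_\infty+\|q'\|_\infty\right)+\frac14\|\overline{p}\,\overline{q}-pq\|_\infty.$$
   Context: The Dirac operator is the differential expression $\mathfrak{D}:= ih\sigma_3\partial_x + Q(x)$, $x\in\mathbb{R}$, where $i$ is the imaginary unit, $h>0$ is the semiclassical parameter, $\sigma_3=\begin{pmatrix}1&0\\0&-1\end{pmatrix}$ and $Q(x)=\begin{pmatrix}0&-iq(x)\\ ip(x)&0\end{pmatrix}$. It is realized as the densely and maximally defined closed operator $H\Psi=\mathfrak{D}\Psi$ in $L^2(\mathbb{R})^2=L^2(\mathbb{R};\mathbb{C}^2)$ with domain $\{\Psi\in L^2(\mathbb{R})^2:\Psi\in AC_{\rm loc}(\mathbb{R})^2,\ \mathfrak{D}\Psi\in L^2(\mathbb{R})^2\}$, where $AC_{\rm loc}(\mathbb{R})$ denotes the locally absolutely continuous complex-valued functions. $\sigma(\mathfrak{D})$ denotes the spectrum of this operator. $\|\cdot\|_\infty$ is the $L^\infty(\mathbb{R})$ (essential supremum) norm, and overbar denotes complex conjugation.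 *)

theory Defs
  imports "HOL-Analysis.Analysis" "HOL-Probability.Essential_Supremum"
begin

definition AC_on :: "real \<Rightarrow> real \<Rightarrow> (real \<Rightarrow> 'a::real_normed_vector) \<Rightarrow> bool" where
  "AC_on a b f \<longleftrightarrow>
     (\<forall>\<epsilon>>0. \<exists>\<delta>>0. \<forall>I :: (real \<times> real) set.
        finite I \<and> (\<forall>(s, t)\<in>I. a \<le> s \<and> s \<le> t \<and> t \<le> b) \<and>
        disjoint_family_on (\<lambda>(s, t). {s<..<t}) I \<and> (\<Sum>(s, t)\<in>I. t - s) < \<delta>
        \<longrightarrow> (\<Sum>(s, t)\<in>I. norm (f t - f s)) < \<epsilon>)"

definition AC_loc :: "(real \<Rightarrow> complex) set" where
  "AC_loc = {f. \<forall>a b. a \<le> b \<longrightarrow> AC_on a b f}"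

text \<open>
  Elements of \<open>L\<^sup>2\<close> and \<open>L\<^sup>\<infinity>\<close> are represented by functions, and equality of elements by equality
  almost everywhere. The measure is the completed Lebesgue measure, so that the values a function
  takes on a null set affect neither its measurability nor its norm.  In particular,
  \<^const>\<open>vector_derivative\<close> may be used as the almost everywhere defined derivative of a locally
  absolutely continuous function: at points of non-differentiability its value is irrelevant.
\<close>

definition L2 :: "(real \<Rightarrow> 'a::{real_normed_vector, second_countable_topology}) set" where
  "L2 = {f. f \<in> borel_measurable lebesgue \<and> integrable lebesgue (\<lambda>x. (norm (f x))\<^sup>2)}"

definition L2_norm :: "(real \<Rightarrow> 'a::{real_normed_vector, second_countable_topology}) \<Rightarrow> real" where
  "L2_norm f = sqrt (integral\<^sup>L lebesgue (\<lambda>x. (norm (f x))\<^sup>2))"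

definition Linf_norm :: "(real \<Rightarrow> complex) \<Rightarrow> ereal" where
  "Linf_norm f = esssup lebesgue (\<lambda>x. ereal (cmod (f x)))"

definition Linf :: "(real \<Rightarrow> complex) set" where
  "Linf = {f. f \<in> borel_measurable lebesgue \<and> Linf_norm f < \<infinity>}"

abbreviation ac_deriv :: "(real \<Rightarrow> 'a::real_normed_vector) \<Rightarrow> real \<Rightarrow> 'a" where
  "ac_deriv f \<equiv> (\<lambda>x. vector_derivative f (at x))"

text \<open>
  The complement of the resolvent set of an operator \<open>T\<close> in \<open>L\<^sup>2(\<real>)\<^sup>2\<close> with domain \<open>D\<close>: \<open>z\<close> belongs
  to the resolvent set iff \<open>T - z\<close> maps \<open>D\<close> one-to-one onto \<open>L\<^sup>2(\<real>)\<^sup>2\<close> with bounded inverse.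
\<close>

definition resolvent_set ::
  "(real \<Rightarrow> complex^2) set \<Rightarrow> ((real \<Rightarrow> complex^2) \<Rightarrow> (real \<Rightarrow> complex^2)) \<Rightarrow> complex set" where
  "resolvent_set D T = {z.
     (\<forall>\<Psi>\<in>D. \<forall>\<Phi>\<in>D. (AE x in lebesgue. T \<Psi> x - z *s \<Psi> x = T \<Phi> x - z *s \<Phi> x)
        \<longrightarrow> (AE x in lebesgue. \<Psi> x = \<Phi> x)) \<and>
     (\<forall>f\<in>L2. \<exists>\<Psi>\<in>D. AE x in lebesgue. T \<Psi> x - z *s \<Psi> x = f x) \<and>
     (\<exists>C. \<forall>\<Psi>\<in>D. L2_norm \<Psi> \<le> C * L2_norm (\<lambda>x. T \<Psi> x - z *s \<Psi> x))}"

definition op_spectrum ::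
  "(real \<Rightarrow> complex^2) set \<Rightarrow> ((real \<Rightarrow> complex^2) \<Rightarrow> (real \<Rightarrow> complex^2)) \<Rightarrow> complex set" where
  "op_spectrum D T = - resolvent_set D T"

definition sigma3 :: "complex^2^2" where
  "sigma3 = vector [vector [1, 0], vector [0, -1]]"

definition potential :: "(real \<Rightarrow> complex) \<Rightarrow> (real \<Rightarrow> complex) \<Rightarrow> real \<Rightarrow> complex^2^2" where
  "potential p q x = vector [vector [0, - \<i> * q x], vector [\<i> * p x, 0]]"

definition dirac ::
  "real \<Rightarrow> (real \<Rightarrow> complex) \<Rightarrow> (real \<Rightarrow> complex) \<Rightarrow> (real \<Rightarrow> complex^2) \<Rightarrow> real \<Rightarrow> complex^2" where
  "dirac h p q \<Psi> x =
     (\<i> * of_real h) *s (sigma3 *v ac_deriv \<Psi> x) + potential p q x *v \<Psi> x"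

text \<open>
  A class in \<open>L\<^sup>2\<close> has at most one locally absolutely continuous representative, by which the
  elements of the domain are given here.
\<close>

definition dirac_domain ::
  "real \<Rightarrow> (real \<Rightarrow> complex) \<Rightarrow> (real \<Rightarrow> complex) \<Rightarrow> (real \<Rightarrow> complex^2) set" where
  "dirac_domain h p q =
     {\<Psi>. \<Psi> \<in> L2 \<and> (\<forall>i. (\<lambda>x. \<Psi> x $ i) \<in> AC_loc) \<and> dirac h p q \<Psi> \<in> L2}"

definition dirac_spectrum ::
  "real \<Rightarrow> (real \<Rightarrow> complex) \<Rightarrow> (real \<Rightarrow> complex) \<Rightarrow> complex set" where
  "dirac_spectrum h p q = op_spectrum (dirac_domain h p q) (dirac h p q)"

end

theory Submission
  imports Defs
begin

text \<open>Since \<open>\<sigma>\<^sub>3\<close> anticommutes with \<open>Q\<close>, the square of the Dirac operator has no first-order term: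
  \<open>\<DD>\<^sup>2 = - h\<^sup>2 \<partial>\<^sup>2 + p q + i h \<sigma>\<^sub>3 Q'\<close>.  The imaginary part of \<open>\<langle>(\<DD>\<^sup>2 - z\<^sup>2) \<Psi>, \<Psi>\<rangle>\<close> does not see the
  kinetic term, and what is left of it is bounded by \<open>Im (p q)\<close> and the derivatives of the potentials,
  whereas \<open>Im z\<^sup>2 = 2 Re z Im z\<close>.  So if \<open>z\<close> violates the asserted inequality, then \<open>\<bar>Im z\<^sup>2\<bar>\<close> exceeds these
  terms by some \<open>c > 0\<close>, and the claim is that \<open>z\<close> belongs to the resolvent set.

  An element \<open>\<Psi>\<close> of the domain can be differentiated only once.  Therefore \<open>(\<DD> - z) \<Psi>\<close> is paired with
  \<open>(\<DD>\<^sup>* + cnj z) \<Psi>\<close> instead; the pairing agrees with the quadratic form above up to the derivative of an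
  integrable function, whose integral over the line vanishes (\<open>integral_derivative_eq_0\<close>).  As
  \<open>\<DD>\<^sup>* - \<DD>\<close> is bounded, the second factor is controlled by \<open>(\<DD> - z) \<Psi>\<close> and \<open>\<Psi>\<close>, and the result is an
  estimate \<open>\<parallel>\<Psi>\<parallel> \<le> C \<parallel>(\<DD> - z) \<Psi>\<parallel>\<close> (\<open>dirac_a_priori_estimate\<close>).

  A lower bound alone does not make the non-selfadjoint operator \<open>\<DD> - z\<close> surjective.  Surjectivity comes
  from the method of continuity: replacing \<open>p, q\<close> by \<open>t p, t q\<close> with \<open>0 \<le> t \<le> 1\<close> only shrinks the terms to
  be dominated, so \<open>C\<close> serves for all \<open>t\<close>.  For \<open>t = 0\<close> the system decouples into two scalar equations that
  are solved by an exponential kernel (\<open>exists_H1_solution_first_order\<close>), and surjectivity passes from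
  \<open>t\<close> to \<open>s\<close> by a contraction in \<open>L\<^sup>2\<close> when \<open>\<bar>s - t\<bar>\<close> is small
  (\<open>L2_contraction_fixed_point\<close>, \<open>surjective_step\<close>).

  All of this rests on the calculus of absolutely continuous functions: they are differentiable almost
  everywhere (\<open>AC_differentiable_AE\<close>), an integrable derivative recovers the function
  (\<open>AC_loc_integral_derivative\<close>), and indefinite integrals are absolutely continuous with the expected
  derivative.  All three are deduced from the Vitali covering theorem: a set of bad points is covered, up to small measure, by
  finitely many disjoint intervals with prescribed increments, and the increment over what remains
  is small by absolute continuity.\<close>

section \<open>Finite disjoint families of intervals\<close>

text \<open>Non-overlap is expressed by comparing endpoints, which is the form that linear arithmetic can use; it
  amounts to disjointness of the open intervals, as in \<^const>\<open>AC_on\<close>.\<close>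

definition interval_family :: "(real \<times> real) set \<Rightarrow> bool" where
  "interval_family I \<longleftrightarrow> finite I \<and> (\<forall>(s, t)\<in>I. s < t) \<and>
     (\<forall>(s, t)\<in>I. \<forall>(s', t')\<in>I. (s, t) \<noteq> (s', t') \<longrightarrow> t \<le> s' \<or> t' \<le> s)"

abbreviation increment :: "(real \<Rightarrow> 'a::real_normed_vector) \<Rightarrow> (real \<times> real) set \<Rightarrow> 'a" where
  "increment f I \<equiv> (\<Sum>(s, t)\<in>I. f t - f s)"

abbreviation variation :: "(real \<Rightarrow> 'a::real_normed_vector) \<Rightarrow> (real \<times> real) set \<Rightarrow> real" where
  "variation f I \<equiv> (\<Sum>(s, t)\<in>I. norm (f t - f s))"

lemma interval_familyI:
  assumes "finite I" "\<And>s t. (s, t) \<in> I \<Longrightarrow> s < t"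
    and "\<And>s t s' t'. (s, t) \<in> I \<Longrightarrow> (s', t') \<in> I \<Longrightarrow> (s, t) \<noteq> (s', t') \<Longrightarrow> t \<le> s' \<or> t' \<le> s"
  shows "interval_family I"
  using assms unfolding interval_family_def by fast

lemma interval_family_finite: "interval_family I \<Longrightarrow> finite I"
  by (simp add: interval_family_def)

lemma interval_family_less: "interval_family I \<Longrightarrow> (s, t) \<in> I \<Longrightarrow> s < t"
  unfolding interval_family_def by blast

lemma interval_family_apart:
  "interval_family I \<Longrightarrow> (s, t) \<in> I \<Longrightarrow> (s', t') \<in> I \<Longrightarrow> (s, t) \<noteq> (s', t') \<Longrightarrow> t \<le> s' \<or> t' \<le> s"
  unfolding interval_family_def by blast

lemma interval_family_subset: "interval_family I \<Longrightarrow> K \<subseteq> I \<Longrightarrow> interval_family K"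
  unfolding interval_family_def by (blast intro: finite_subset)

lemma interval_family_Un:
  assumes "interval_family I" "interval_family J"
    and "\<And>s t s' t'. (s, t) \<in> I \<Longrightarrow> (s', t') \<in> J \<Longrightarrow> t \<le> s' \<or> t' \<le> s"
  shows "interval_family (I \<union> J)" "I \<inter> J = {}"
proof -
  show "interval_family (I \<union> J)"
    using assms(3) interval_family_less[OF assms(1)] interval_family_less[OF assms(2)]
      interval_family_apart[OF assms(1)] interval_family_apart[OF assms(2)]
      interval_family_finite[OF assms(1)] interval_family_finite[OF assms(2)]
    by (intro interval_familyI) blast+
  have False if "(s, t) \<in> I" "(s, t) \<in> J" for s t
    using assms(3)[OF that] interval_family_less[OF assms(1) that(1)] by auto
  then show "I \<inter> J = {}" by auto
qed

definition total_length :: "(real \<times> real) set \<Rightarrow> real" where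
  "total_length I = (\<Sum>(s, t)\<in>I. t - s)"

text \<open>Both kinds of intervals are needed: open ones as open sets that contain further intervals, half-open ones because
  integrals are additive over them.\<close>

lemma interval_family_Union:
  assumes I: "interval_family I" and J: "\<And>s t. J (s, t) = {s<..<t} \<or> J (s, t) = {s<..t}"
  shows "disjoint_family_on J I" "\<Union>(J ` I) \<in> lmeasurable" "measure lebesgue (\<Union>(J ` I)) = total_length I"
proof -
  have Jm: "J i \<in> lmeasurable" for i
    by (rule fmeasurableI2[of "{fst i..snd i}"]) (use J[of "fst i" "snd i"] in auto)
  show disj: "disjoint_family_on J I" unfolding disjoint_family_on_def
  proof (intro ballI impI)
    fix m n assume mn: "m \<in> I" "n \<in> I" "m \<noteq> n"
    obtain s t s' t' where eq: "m = (s, t)" "n = (s', t')" by (metis surj_pair)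
    show "J m \<inter> J n = {}"
      using interval_family_apart[OF I, of s t s' t'] mn J[of s t] J[of s' t'] by (auto simp: eq)
  qed
  show "\<Union>(J ` I) \<in> lmeasurable" using interval_family_finite[OF I] Jm by (intro fmeasurable.finite_UN) auto
  have "measure lebesgue (\<Union>(J ` I)) = (\<Sum>i\<in>I. measure lebesgue (J i))"
    using fmeasurableD[OF Jm] fmeasurableD2[OF Jm] interval_family_finite[OF I]
    by (intro measure_finite_Union disj) (auto simp: infinity_ennreal_def simp del: emeasure_completion)
  also have "\<dots> = total_length I" unfolding total_length_def
  proof (rule sum.cong[OF refl])
    fix i assume i: "i \<in> I"
    show "measure lebesgue (J i) = (case i of (s, t) \<Rightarrow> t - s)"
      using interval_family_less[OF I, of "fst i" "snd i"] i J[of "fst i" "snd i"] by (auto simp: case_prod_unfold)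
  qed
  finally show "measure lebesgue (\<Union>(J ` I)) = total_length I" .
qed

text \<open>The covering theorem yields a countable disjoint family that exhausts \<open>E\<close> up to a null set; by continuity of
  the measure from below, finitely many of its members already have almost the full length.\<close>

lemma Vitali_covering_intervals:
  fixes E U :: "real set"
  assumes E: "E \<in> lmeasurable" and U: "open U" "E \<subseteq> U" and e: "e > 0"
    and fine: "\<And>x d. x \<in> E \<Longrightarrow> d > 0 \<Longrightarrow> \<exists>s t. s < t \<and> s \<le> x \<and> x \<le> t \<and> t - s < d \<and> P s t"
  obtains I where "interval_family I" "\<forall>(s, t)\<in>I. P s t \<and> {s..t} \<subseteq> U"
    "total_length I > measure lebesgue E - e"
proof -
  define K where "K = {(s, t). s < t \<and> {s..t} \<subseteq> U \<and> P s t}"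
  define m where "m = (\<lambda>(s, t). (s + t) / (2::real))"
  define r where "r = (\<lambda>(s, t). (t - s) / (2::real))"
  have cb: "cball (m i) (r i) = (case i of (s, t) \<Rightarrow> {s..t})" for i
    by (cases i) (auto simp: m_def r_def cball_eq_atLeastAtMost field_simps)
  have rpos: "0 < r i" if "i \<in> K" for i using that by (auto simp: K_def r_def)
  have cover: "\<exists>i. i \<in> K \<and> x \<in> cball (m i) (r i) \<and> r i < d" if x: "x \<in> E" and d: "0 < d" for x d
  proof -
    obtain k where k: "k > 0" "ball x k \<subseteq> U" using U x by (meson openE subsetD)
    obtain s t where st: "s < t" "s \<le> x" "x \<le> t" "t - s < min k d" "P s t"
      using fine[OF x, of "min k d"] k d by auto
    have "{s..t} \<subseteq> ball x k" using st by (auto simp: dist_real_def)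
    then have "(s, t) \<in> K" using k st by (auto simp: K_def)
    moreover have "x \<in> cball (m (s, t)) (r (s, t))" unfolding cb using st by simp
    ultimately show ?thesis using st by (intro exI[of _ "(s, t)"]) (simp add: r_def)
  qed
  obtain C where C: "countable C" "C \<subseteq> K"
     "pairwise (\<lambda>i j. disjnt (cball (m i) (r i)) (cball (m j) (r j))) C"
     "negligible (E - (\<Union>i\<in>C. cball (m i) (r i)))"
    using Vitali_covering_theorem_cballs[of K r E m] rpos cover by blast
  show ?thesis
  proof (cases "C = {}")
    case True
    then have "measure lebesgue E = 0" using C(4) by (simp add: negligible_imp_measure0)
    then show ?thesis using that[of "{}"] e by (auto simp: interval_family_def total_length_def)
  next
    case False
    define c where "c = from_nat_into C"
    have ran: "range c = C" using C(1) False by (simp add: c_def range_from_nat_into)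
    define A where "A n = E \<inter> (\<Union>i\<in>c ` {..<n}. case i of (s, t) \<Rightarrow> {s..t})" for n
    have meas: "A n \<in> lmeasurable" for n
      unfolding A_def by (intro fmeasurable_Int_fmeasurable E sets.finite_UN) (auto split: prod.split)
    have UA: "\<Union>(range A) = E - (E - (\<Union>i\<in>C. cball (m i) (r i)))"
    proof -
      have "(\<Union>n. E \<inter> (\<Union>i\<in>c ` {..<n}. B i)) = E - (E - (\<Union>i\<in>range c. B i))" for B :: "real \<times> real \<Rightarrow> real set"
        by (auto intro: lessI)
      then show ?thesis unfolding A_def cb ran by simp
    qed
    have mUA: "measure lebesgue (\<Union>(range A)) = measure lebesgue E"
      unfolding UA using C(4) E by (intro measure_Diff_null_set) (auto simp: negligible_iff_null_sets)
    have "(\<lambda>n. measure lebesgue (A n)) \<longlonglongrightarrow> measure lebesgue (\<Union>(range A))"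
    proof (rule Lim_measure_incseq)
      show "range A \<subseteq> sets lebesgue" using meas by auto
      show "incseq A" unfolding incseq_def A_def by fastforce
      have "\<Union>(range A) \<in> lmeasurable"
        unfolding UA by (rule fmeasurable_Diff[OF E negligible_imp_sets[OF C(4)]])
      then show "emeasure lebesgue (\<Union>(range A)) \<noteq> \<infinity>" by (metis fmeasurableD2 infinity_ennreal_def)
    qed
    then have "\<forall>\<^sub>F n in sequentially. measure lebesgue (A n) > measure lebesgue E - e"
      unfolding mUA using e by (intro order_tendstoD(1)[where y = "measure lebesgue E"]) auto
    then obtain n where n: "measure lebesgue (A n) > measure lebesgue E - e"
      by (meson eventually_sequentially order_refl)
    define I where "I = c ` {..<n}"
    have IC: "I \<subseteq> C" using ran by (auto simp: I_def)
    have lt: "\<And>s t. (s, t) \<in> I \<Longrightarrow> s < t \<and> {s..t} \<subseteq> U \<and> P s t"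
      using IC C(2) by (auto simp: K_def)
    have fam: "interval_family I"
    proof (rule interval_familyI)
      show "finite I" by (simp add: I_def)
      show "s < t" if "(s, t) \<in> I" for s t using lt that by blast
      fix s t s' t' assume st: "(s, t) \<in> I" "(s', t') \<in> I" "(s, t) \<noteq> (s', t')"
      then have "disjnt {s..t} {s'..t'}"
        using C(3)[unfolded pairwise_def cb, rule_format, of "(s, t)" "(s', t')"] IC by auto
      then show "t \<le> s' \<or> t' \<le> s" using lt[OF st(1)] lt[OF st(2)]
        by (metis atLeastAtMost_iff disjnt_iff linorder_le_cases less_imp_le)
    qed
    have "measure lebesgue (A n) \<le> measure lebesgue (\<Union>i\<in>I. (\<lambda>(s, t). {s..t}) i)"
      unfolding A_def I_def
      by (intro measure_mono_fmeasurable fmeasurable.finite_UN sets.Int sets.finite_UN)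
        (use E in \<open>auto split: prod.split\<close>)
    also have "\<dots> \<le> (\<Sum>i\<in>I. measure lebesgue ((\<lambda>(s, t). {s..t}) i))"
      by (intro measure_UNION_le) (auto simp: I_def split: prod.split)
    also have "\<dots> = total_length I"
      unfolding total_length_def using lt by (intro sum.cong) (auto simp: less_imp_le)
    finally show ?thesis using that[OF fam] lt n by force
  qed
qed

text \<open>The gaps that \<open>K\<close> leaves in \<open>[a, b]\<close>.  Their increments, for any \<open>f\<close>, make up the difference
  between the increment of \<open>f\<close> over \<open>[a, b]\<close> and its increments over \<open>K\<close>; the choice of the identity for \<open>f\<close>
  gives their total length.\<close>

lemma interval_family_gaps_single:
  assumes "interval_family K" "\<forall>(s, t)\<in>K. a \<le> s \<and> t \<le> b" "a \<le> b"
  shows "\<exists>G. interval_family G \<and> (\<forall>(s, t)\<in>G. a \<le> s \<and> t \<le> b) \<and>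
     (\<forall>f::real\<Rightarrow>real. f b - f a = increment f K + increment f G)"
  using assms
proof (induction "card K" arbitrary: K b)
  case 0
  then have K: "K = {}" by (auto simp: interval_family_def)
  show ?case
    using 0 by (intro exI[of _ "if a < b then {(a, b)} else {}"]) (auto simp: K interval_family_def)
next
  case (Suc n)
  have fin: "finite K" "K \<noteq> {}" using Suc by (auto simp: interval_family_def)
  then have "Max (fst ` K) \<in> fst ` K" by simp
  then obtain s t where st: "(s, t) \<in> K" and smax: "s = Max (fst ` K)" by force
  have max: "s' \<le> s" if "(s', t') \<in> K" for s' t'
    unfolding smax using fin that by (metis Max_ge finite_imageI fst_conv image_eqI)
  define K' where "K' = K - {(s, t)}"
  have lt: "\<And>s t. (s, t) \<in> K \<Longrightarrow> s < t" using Suc by (auto simp: interval_family_def)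
  have ab: "a \<le> s" "t \<le> b" "s < t" using st Suc.prems lt by auto
  have left: "a \<le> s' \<and> t' \<le> s" if "(s', t') \<in> K'" for s' t'
  proof -
    have K: "(s', t') \<in> K" "(s', t') \<noteq> (s, t)" using that by (auto simp: K'_def)
    then have "t' \<le> s \<or> t \<le> s'" using Suc.prems(1) st interval_family_apart by blast
    moreover have "s' \<le> s" using max K by blast
    moreover have "a \<le> s'" using Suc.prems(2) K by blast
    ultimately show ?thesis using lt[OF st] by auto
  qed
  have "n = card K'" using Suc.hyps(2) st fin by (simp add: K'_def)
  moreover have "interval_family K'" using Suc.prems by (auto intro: interval_family_subset simp: K'_def)
  ultimately obtain G where G: "interval_family G" "\<forall>(s', t')\<in>G. a \<le> s' \<and> t' \<le> s"
     "\<forall>f::real\<Rightarrow>real. f s - f a = increment f K' + increment f G"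
    using Suc.hyps(1)[of K' s] left ab by fastforce
  define G' where "G' = (if t < b then insert (t, b) G else G)"
  have notin: "(t, b) \<notin> G" if "t < b" using G(2) ab that by fastforce
  have finG: "finite G" using G by (auto simp: interval_family_def)
  have "interval_family G'"
  proof (cases "t < b")
    case True
    have "interval_family (G \<union> {(t, b)})"
      by (rule interval_family_Un(1)[OF G(1)]) (use G(2) ab True in \<open>force simp: interval_family_def\<close>)+
    then show ?thesis using True by (simp add: G'_def)
  qed (simp add: G'_def G(1))
  moreover have "\<forall>(s', t')\<in>G'. a \<le> s' \<and> t' \<le> b"
    unfolding G'_def using ab by (auto dest!: bspec[OF G(2)])
  moreover have "f b - f a = increment f K + increment f G'"
    for f :: "real \<Rightarrow> real"
  proof -
    have 1: "increment f K = (f t - f s) + increment f K'"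
      using sum.remove[OF fin(1) st, of "\<lambda>(s, t). f t - f s"] by (simp add: K'_def)
    have 2: "increment f G' = (f b - f t) + increment f G"
      using notin finG ab by (auto simp: G'_def)
    have 3: "f s - f a = increment f K' + increment f G" using G(3) by blast
    show ?thesis using 1 2 3 by argo
  qed
  ultimately show ?case by blast
qed

lemma interval_family_gaps:
  assumes "interval_family I" "interval_family K"
    "\<forall>(s, t)\<in>K. \<exists>(a, b)\<in>I. a \<le> s \<and> t \<le> b"
  shows "\<exists>G. interval_family G \<and> (\<forall>(s, t)\<in>G. \<exists>(a, b)\<in>I. a \<le> s \<and> t \<le> b) \<and>
     (\<forall>f::real\<Rightarrow>real. increment f I = increment f K + increment f G)"
proof -
  have "finite I" using assms by (simp add: interval_family_def)
  then show ?thesis using assms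
  proof (induction I arbitrary: K rule: finite_induct)
    case empty
    then have "K = {}" by auto
    then show ?case by (intro exI[of _ "{}"]) (auto simp: interval_family_def)
  next
    case (insert i I)
    obtain a b where i: "i = (a, b)" by force
    have fam: "interval_family I" using insert.prems(1) by (rule interval_family_subset) auto
    have ab: "a < b" using insert.prems(1) by (auto simp: i interval_family_def)
    have sep: "b \<le> s \<or> t \<le> a" if "(s, t) \<in> I" for s t
      using insert.prems(1) insert.hyps(2) that unfolding i interval_family_def by fastforce
    define K1 where "K1 = {(s, t)\<in>K. a \<le> s \<and> t \<le> b}"
    have "interval_family K1" using insert.prems(2) by (rule interval_family_subset) (auto simp: K1_def)
    then obtain G1 where G1: "interval_family G1" "\<forall>(s, t)\<in>G1. a \<le> s \<and> t \<le> b"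
       "\<And>f::real\<Rightarrow>real. f b - f a = increment f K1 + increment f G1"
      using interval_family_gaps_single[of K1 a b] ab by (auto simp: K1_def)
    have "interval_family (K - K1)" using insert.prems(2) by (rule interval_family_subset) auto
    moreover have "\<forall>(s, t)\<in>K - K1. \<exists>(a, b)\<in>I. a \<le> s \<and> t \<le> b"
      using insert.prems(3) by (auto simp: K1_def i)
    ultimately obtain G2 where G2: "interval_family G2"
       "\<forall>(s, t)\<in>G2. \<exists>(a, b)\<in>I. a \<le> s \<and> t \<le> b"
       "\<And>f::real\<Rightarrow>real. increment f I = increment f (K - K1) + increment f G2"
      using insert.IH[of "K - K1"] fam by blast
    have sep2: "b \<le> s \<or> t \<le> a" if "(s, t) \<in> G2" for s t
      using G2(2) that sep by fastforce
    have in1: "a \<le> s \<and> t \<le> b" if "(s, t) \<in> G1" for s t using that G1(2) by auto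
    have apart: "t \<le> s' \<or> t' \<le> s" if "(s, t) \<in> G1" "(s', t') \<in> G2" for s t s' t'
      using in1[OF that(1)] sep2[OF that(2)] by auto
    note un = interval_family_Un[OF G1(1) G2(1) apart]
    have fin: "finite G1" "finite G2" "finite K"
      using G1 G2 insert.prems interval_family_finite by auto
    have "interval_family (G1 \<union> G2)" by (rule un(1))
    moreover have "\<forall>(s, t)\<in>G1 \<union> G2. \<exists>(a, b)\<in>insert i I. a \<le> s \<and> t \<le> b"
      using G1(2) G2(2) by (fastforce simp: i)
    moreover have "increment f (insert i I)
        = increment f K + increment f (G1 \<union> G2)" for f :: "real \<Rightarrow> real"
    proof -
      have 1: "increment f (insert i I) = (f b - f a) + increment f I"
        using insert.hyps by (simp add: i)
      have 2: "increment f K = increment f (K - K1) + increment f K1"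
        by (rule sum.subset_diff) (use fin in \<open>auto simp: K1_def\<close>)
      have 3: "increment f (G1 \<union> G2)
          = increment f G1 + increment f G2"
        using fin un(2) by (intro sum.union_disjoint)
      show ?thesis unfolding 1 2 3 using G1(3)[of f] G2(3)[of f] by argo
    qed
    ultimately show ?case by blast
  qed
qed

text \<open>In \<^const>\<open>AC_on\<close> degenerate intervals are admitted; they contribute nothing, and families without them are
  easier to combine.\<close>

lemma AC_on_iff:
  "AC_on a b f \<longleftrightarrow> (\<forall>e>0. \<exists>d>0. \<forall>I. interval_family I \<and> (\<forall>(s, t)\<in>I. a \<le> s \<and> t \<le> b) \<and> total_length I < d
     \<longrightarrow> variation f I < e)"
proof -
  let ?A = "\<lambda>I. finite I \<and> (\<forall>(s, t)\<in>I. a \<le> s \<and> s \<le> t \<and> t \<le> b) \<and> disjoint_family_on (\<lambda>(s, t). {s<..<t}) I"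
  let ?B = "\<lambda>I. interval_family I \<and> (\<forall>(s, t)\<in>I. a \<le> s \<and> t \<le> b)"
  have BA: "?A I" if "?B I" for I
    using that interval_family_finite interval_family_Union(1)[of I "\<lambda>(s, t). {s<..<t}"] interval_family_less[of I]
    by (fastforce simp: less_imp_le)
  have AB: "\<exists>K. ?B K \<and> total_length K = total_length I \<and> variation f K = variation f I"
    if A: "?A I" for I
  proof (intro exI conjI)
    let ?K = "{i \<in> I. fst i < snd i}"
    have eq: "s < t \<or> t = s" if "(s, t) \<in> I" for s t using A that by force
    show "interval_family ?K"
    proof (rule interval_familyI)
      fix s t s' t' assume *: "(s, t) \<in> ?K" "(s', t') \<in> ?K" "(s, t) \<noteq> (s', t')"
      then have "{s<..<t} \<inter> {s'<..<t'} = {}" using A unfolding disjoint_family_on_def by fastforce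
      then have "(max s s' + min t t') / 2 \<notin> {s<..<t} \<inter> {s'<..<t'}" by blast
      then show "t \<le> s' \<or> t' \<le> s" using * by (auto simp: max_def min_def split: if_splits)
    qed (use A in auto)
    show "\<forall>(s, t)\<in>?K. a \<le> s \<and> t \<le> b" using A by auto
    show "total_length ?K = total_length I" "variation f ?K = variation f I"
      unfolding total_length_def using A by (auto intro!: sum.mono_neutral_left dest: eq)
  qed
  have "(\<forall>I. ?A I \<and> total_length I < d \<longrightarrow> variation f I < e)
      \<longleftrightarrow> (\<forall>I. ?B I \<and> total_length I < d \<longrightarrow> variation f I < e)" (is "?L \<longleftrightarrow> ?R") for d e
  proof
    show ?R if L: ?L using L[rule_format, OF conjI[OF BA]] by simp
    show ?L if R: ?R
    proof (intro allI impI)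
      fix I assume I: "?A I \<and> total_length I < d"
      then obtain K where "?B K" "total_length K = total_length I"
          "variation f K = variation f I"
        using AB[of I] by blast
      then show "variation f I < e" using R[rule_format, of K] I by simp
    qed
  qed
  note eq = this[unfolded conj_assoc total_length_def]
  show ?thesis unfolding AC_on_def total_length_def conj_assoc eq ..
qed

lemma AC_onE:
  assumes "AC_on a b f" "e > 0"
  obtains d where "d > 0" "\<And>I. interval_family I \<Longrightarrow> (\<And>s t. (s, t) \<in> I \<Longrightarrow> a \<le> s \<and> t \<le> b) \<Longrightarrow>
      total_length I < d \<Longrightarrow> variation f I < e"
proof -
  obtain d where d: "d > 0" "\<forall>I. interval_family I \<and> (\<forall>(s, t)\<in>I. a \<le> s \<and> t \<le> b) \<and> total_length I < d
     \<longrightarrow> variation f I < e"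
    using assms(1)[unfolded AC_on_iff, rule_format, OF assms(2)] by (elim exE conjE) (rule that)
  show ?thesis by (rule that[OF d(1)], rule d(2)[rule_format]) blast
qed

lemma AC_on_continuous_on:
  fixes f :: "real \<Rightarrow> 'a::real_normed_vector"
  assumes "AC_on a b f"
  shows "continuous_on {a..b} f"
  unfolding continuous_on_iff
proof (intro ballI allI impI)
  fix x e :: real assume x: "x \<in> {a..b}" and e: "e > 0"
  obtain d where d: "d > 0" "\<And>I. interval_family I \<Longrightarrow> (\<And>s t. (s, t) \<in> I \<Longrightarrow> a \<le> s \<and> t \<le> b) \<Longrightarrow>
      total_length I < d \<Longrightarrow> variation f I < e"
    using AC_onE[OF assms e] by metis
  have "dist (f y) (f x) < e" if y: "y \<in> {a..b}" "dist y x < d" for y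
  proof (cases "x = y")
    case False
    have "interval_family {(min x y, max x y)}" using False by (auto simp: interval_family_def)
    then have "(\<Sum>(s, t)\<in>{(min x y, max x y)}. norm (f t - f s)) < e"
      by (rule d(2)) (use x y in \<open>auto simp: total_length_def dist_real_def\<close>)
    then show ?thesis by (auto simp: dist_norm min_def max_def norm_minus_commute split: if_splits)
  qed (use e in simp)
  then show "\<exists>d>0. \<forall>x'\<in>{a..b}. dist x' x < d \<longrightarrow> dist (f x') (f x) < e" using d by blast
qed

section \<open>Slopes and null sets\<close>

text \<open>There are points \<open>y\<close> arbitrarily close to \<open>x\<close> at which the difference quotient exceeds \<open>v\<close>.  The quotient is
  multiplied by \<open>(y - x)\<^sup>2\<close>: this excludes \<open>y = x\<close> and turns the condition into an open one in \<open>x\<close> for fixed \<open>y\<close>.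
  Applied to \<open>- f\<close> and \<open>- u\<close> it says that quotients below \<open>u\<close> occur.\<close>

definition slope_above :: "(real \<Rightarrow> real) \<Rightarrow> real \<Rightarrow> real \<Rightarrow> bool" where
  "slope_above f v x \<longleftrightarrow> (\<forall>d>0. \<exists>y. \<bar>y - x\<bar> < d \<and> (f y - f x) * (y - x) > v * (y - x)\<^sup>2)"

lemma slope_above_mono: "slope_above f v x \<Longrightarrow> w \<le> v \<Longrightarrow> slope_above f w x"
  unfolding slope_above_def by (meson mult_right_mono order_le_less_trans zero_le_power2)

lemma slope_above_interval:
  assumes "slope_above f v x" "d > 0"
  shows "\<exists>s t. s < t \<and> s \<le> x \<and> x \<le> t \<and> t - s < d \<and> f t - f s > v * (t - s)"
proof -
  obtain y where y: "\<bar>y - x\<bar> < d" "(f y - f x) * (y - x) > v * (y - x)\<^sup>2"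
    using assms unfolding slope_above_def by blast
  consider "x < y" | "y < x" using y(2) by (cases x y rule: linorder_cases) auto
  then show ?thesis
  proof cases
    case 1
    have "v * (y - x) * (y - x) < (f y - f x) * (y - x)" using y(2) by (simp add: power2_eq_square)
    then have "v * (y - x) < f y - f x" using 1 by (simp add: mult_less_cancel_right)
    then show ?thesis using 1 y(1) by (intro exI[of _ x] exI[of _ y]) auto
  next
    case 2
    have "v * (x - y) * (x - y) < (f x - f y) * (x - y)" using y(2) by (simp add: power2_eq_square algebra_simps)
    then have "v * (x - y) < f x - f y" using 2 by (simp add: mult_less_cancel_right)
    then show ?thesis using 2 y(1) by (intro exI[of _ y] exI[of _ x]) auto
  qed
qed

text \<open>For fixed \<open>d\<close> the condition defines an open set, so the set is a countable intersection of open ones.\<close>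

lemma slope_above_borel:
  assumes "continuous_on UNIV f"
  shows "{x. slope_above f v x} \<in> sets borel"
proof -
  have eq: "{x. slope_above f v x} = (\<Inter>n. \<Union>y. {x. \<bar>y - x\<bar> < 1 / real (Suc n) \<and>
      v * (y - x)\<^sup>2 < (f y - f x) * (y - x)})" (is "?L = ?R")
  proof (intro set_eqI iffI)
    fix x assume x: "x \<in> ?R"
    have "\<exists>y. \<bar>y - x\<bar> < d \<and> (f y - f x) * (y - x) > v * (y - x)\<^sup>2" if d: "d > 0" for d
    proof -
      obtain n where n: "1 / real (Suc n) < d" by (rule nat_approx_posE[OF d])
      obtain y where "\<bar>y - x\<bar> < 1 / real (Suc n)" "v * (y - x)\<^sup>2 < (f y - f x) * (y - x)" using x by blast
      then show ?thesis using n by (intro exI[of _ y]) auto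
    qed
    then show "x \<in> ?L" by (simp add: slope_above_def)
  qed (auto simp: slope_above_def)
  have "open {x. \<bar>y - x\<bar> < 1 / real (Suc n) \<and> v * (y - x)\<^sup>2 < (f y - f x) * (y - x)}" for n y
    by (intro open_Collect_conj open_Collect_less continuous_intros assms)
  then show ?thesis unfolding eq by (intro sets.countable_INT) (auto intro!: borel_open open_UN)
qed

lemma slope_not_above_imp_above_uminus:
  assumes "\<not> slope_above f v x" "w < - v"
  shows "slope_above (\<lambda>x. - f x) w x"
proof -
  obtain d where d: "d > 0" "\<And>y. \<bar>y - x\<bar> < d \<Longrightarrow> (f y - f x) * (y - x) \<le> v * (y - x)\<^sup>2"
    using assms(1) unfolding slope_above_def by (metis not_le)
  show ?thesis unfolding slope_above_def
  proof (intro allI impI)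
    fix e :: real assume e: "e > 0"
    define y where "y = x + min d e / 2"
    have y: "\<bar>y - x\<bar> < d" "\<bar>y - x\<bar> < e" "y \<noteq> x" using d(1) e by (auto simp: y_def min_def)
    have "w * (y - x)\<^sup>2 < (- v) * (y - x)\<^sup>2" using assms(2) y(3) by (intro mult_strict_right_mono) auto
    also have "\<dots> \<le> (- f y - - f x) * (y - x)" using d(2)[OF y(1)] by (simp add: algebra_simps)
    finally show "\<exists>y. \<bar>y - x\<bar> < e \<and> w * (y - x)\<^sup>2 < (- f y - - f x) * (y - x)" using y(2) by blast
  qed
qed

lemma has_real_derivative_if_slopes:
  assumes "\<And>e. e > 0 \<Longrightarrow> \<not> slope_above f (L + e) x"
    and "\<And>e. e > 0 \<Longrightarrow> \<not> slope_above (\<lambda>x. - f x) (- L + e) x"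
  shows "(f has_real_derivative L) (at x)"
  unfolding has_field_derivative_iff tendsto_iff
proof (intro allI impI)
  fix e :: real assume "e > 0"
  then have e: "e / 2 > 0" "e / 2 < e" by auto
  obtain d1 where d1: "d1 > 0" "\<And>y. \<bar>y - x\<bar> < d1 \<Longrightarrow> (f y - f x) * (y - x) \<le> (L + e / 2) * (y - x)\<^sup>2"
    using assms(1)[OF e(1)] unfolding slope_above_def by (metis not_le)
  obtain d2 where d2: "d2 > 0" "\<And>y. \<bar>y - x\<bar> < d2 \<Longrightarrow> (- f y - - f x) * (y - x) \<le> (- L + e / 2) * (y - x)\<^sup>2"
    using assms(2)[OF e(1)] unfolding slope_above_def by (metis not_le)
  have "dist ((f y - f x) / (y - x)) L < e" if y: "y \<noteq> x" "dist y x < min d1 d2" for y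
  proof -
    have sq: "(y - x)\<^sup>2 > 0" using y by simp
    define q where "q = (f y - f x) / (y - x)"
    have q: "(f y - f x) * (y - x) = q * (y - x)\<^sup>2" using y by (simp add: q_def power2_eq_square)
    have "q * (y - x)\<^sup>2 \<le> (L + e / 2) * (y - x)\<^sup>2" using d1(2)[of y] y q by (auto simp: dist_real_def)
    moreover have "(- q) * (y - x)\<^sup>2 \<le> (- L + e / 2) * (y - x)\<^sup>2"
      using d2(2)[of y] y q by (auto simp: dist_real_def algebra_simps)
    ultimately have "q \<le> L + e / 2" "- q \<le> - L + e / 2" using sq by (metis mult_le_cancel_right_pos)+
    then show ?thesis using e by (auto simp: q_def dist_real_def)
  qed
  then show "\<forall>\<^sub>F y in at x. dist ((f y - f x) / (y - x)) L < e"
    unfolding eventually_at using d1(1) d2(1) by (intro exI[of _ "min d1 d2"]) auto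
qed

text \<open>The derivative is the upper derivate, that is, the infimum of those \<open>v\<close> that are eventually not exceeded: it is
  finite by the first two hypotheses and agrees with the lower derivate by the third.\<close>

lemma differentiable_if_slopes:
  assumes "\<exists>n::nat. \<not> slope_above f n x" "\<exists>n::nat. \<not> slope_above (\<lambda>x. - f x) n x"
    and "\<And>u v. u \<in> \<rat> \<Longrightarrow> v \<in> \<rat> \<Longrightarrow> u < v \<Longrightarrow> \<not> (slope_above f v x \<and> slope_above (\<lambda>x. - f x) (- u) x)"
  shows "\<exists>L. (f has_real_derivative L) (at x)"
proof -
  define V where "V = {v. \<not> slope_above f v x}"
  obtain w where w: "\<not> slope_above (\<lambda>x. - f x) w x" using assms(2) by blast
  have ne: "V \<noteq> {}" using assms(1) by (auto simp: V_def)
  have bdd: "bdd_below V"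
  proof (rule bdd_belowI[of _ "- w"])
    fix v assume "v \<in> V"
    then show "- w \<le> v"
      using slope_not_above_imp_above_uminus[of f v x w] w by (force simp: V_def)
  qed
  define L where "L = Inf V"
  have up: "\<not> slope_above f (L + e) x" if e: "e > 0" for e
  proof -
    obtain v where "v \<in> V" "v < L + e" using cInf_lessD[OF ne, of "L + e"] e unfolding L_def[symmetric] by auto
    then show ?thesis using slope_above_mono[of f "L + e" x v] by (auto simp: V_def)
  qed
  have down: "\<not> slope_above (\<lambda>x. - f x) (- L + e) x" if e: "e > 0" for e
  proof
    assume above: "slope_above (\<lambda>x. - f x) (- L + e) x"
    obtain u where u: "u \<in> \<rat>" "L - e < u" "u < L" using Rats_dense_in_real[of "L - e" L] e by auto
    obtain v where v: "v \<in> \<rat>" "u < v" "v < L" using Rats_dense_in_real[of u L] u by auto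
    have "v \<notin> V" using cInf_lower[OF _ bdd, of v] v by (auto simp: L_def)
    moreover have "slope_above (\<lambda>x. - f x) (- u) x" using slope_above_mono[OF above, of "- u"] u by simp
    ultimately show False using assms(3)[OF u(1) v(1) v(2)] by (auto simp: V_def)
  qed
  show ?thesis using has_real_derivative_if_slopes[of f L x] up down by blast
qed

lemma measurable_hull_open:
  assumes "E \<in> lmeasurable" "E \<subseteq> {a<..<b}" "e > 0"
  obtains U where "open U" "E \<subseteq> U" "U \<subseteq> {a<..<b::real}" "U \<in> lmeasurable"
    "measure lebesgue U < measure lebesgue E + e"
proof -
  obtain T where T: "open T" "E \<subseteq> T" "T - E \<in> lmeasurable" "emeasure lebesgue (T - E) < ennreal e"
    using sets_lebesgue_outer_open[of E e] assms by (metis fmeasurableD)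
  define U where "U = T \<inter> {a<..<b}"
  have "open U" using T(1) unfolding U_def by auto
  moreover have "bounded U" unfolding U_def by (rule bounded_subset[of "{a..b}"]) auto
  ultimately have U: "open U" "U \<in> lmeasurable" by (auto intro: lmeasurable_open)
  have "measure lebesgue (T - E) < e"
    using T(3,4) assms(3) by (metis emeasure_eq_measure2 ennreal_less_iff measure_nonneg)
  moreover have "measure lebesgue U \<le> measure lebesgue (E \<union> (T - E))"
    by (rule measure_mono_fmeasurable) (use U T(3) assms in \<open>auto simp: U_def simp del: Un_Diff_cancel\<close>)
  moreover have "\<dots> \<le> measure lebesgue E + measure lebesgue (T - E)"
    using T(3) assms(1) by (intro measure_Un_le) auto
  ultimately show ?thesis using that[of U] U T assms(2) by (auto simp: U_def)
qed

text \<open>Suppose that \<open>E\<close> has positive measure.  Cover almost all of \<open>E\<close> by intervals \<open>I\<close> on which the slope exceeds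
  \<open>v\<close>, and then, inside these, by intervals \<open>K\<close> on which the slope is less than \<open>u\<close>.  Both families have nearly the
  length of \<open>E\<close>, so the gaps between them are short and carry almost no increment of \<open>f\<close>.  Thus the same
  increment is at least \<open>v\<close> and at most \<open>u\<close> times the measure of \<open>E\<close>, up to a small error.\<close>

lemma AC_on_oscillation_null:
  fixes f :: "real \<Rightarrow> real"
  assumes ac: "AC_on a b f" and E: "E \<in> lmeasurable" "E \<subseteq> {a<..<b}" and uv: "u < v"
    and up: "\<And>x. x \<in> E \<Longrightarrow> slope_above f v x"
    and down: "\<And>x. x \<in> E \<Longrightarrow> slope_above (\<lambda>x. - f x) (- u) x"
  shows "negligible E"
proof (rule ccontr)
  assume "\<not> negligible E"
  then have m: "measure lebesgue E > 0"
    using E by (metis negligible_iff_measure order_le_less measure_nonneg)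
  define m where "m = measure lebesgue E"
  define e where "e = (v - u) * m / 4"
  have e: "e > 0" using uv m by (simp add: e_def m_def)
  obtain d where d: "d > 0" "\<And>I. interval_family I \<Longrightarrow> (\<And>s t. (s, t) \<in> I \<Longrightarrow> a \<le> s \<and> t \<le> b) \<Longrightarrow>
      total_length I < d \<Longrightarrow> variation f I < e"
    using AC_onE[OF ac e] by metis
  \<comment> \<open>The family \<open>K\<close> below has length more than \<open>m - 3 r\<close>, and the gaps have length less than \<open>4 r\<close>; the third entry
      keeps the contribution \<open>4 r \<bar>v\<bar>\<close> of the gaps at most \<open>e / 2\<close>.\<close>
  define r where "r = min (d / 4) (min (m / 6) (e / 2 / (4 * (\<bar>v\<bar> + 1))))"
  have r: "r > 0" "4 * r \<le> d" "6 * r \<le> m" using d m e by (auto simp: r_def m_def)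
  have "r \<le> e / 2 / (4 * (\<bar>v\<bar> + 1))" by (simp add: r_def)
  then have vr: "4 * r * (\<bar>v\<bar> + 1) \<le> e / 2" by (simp add: field_simps)
  obtain U where U: "open U" "E \<subseteq> U" "U \<subseteq> {a<..<b}" "U \<in> lmeasurable" "measure lebesgue U < m + r"
    using measurable_hull_open[OF E r(1)] unfolding m_def by metis
  obtain I where I: "interval_family I" "\<forall>(s, t)\<in>I. f t - f s > v * (t - s) \<and> {s..t} \<subseteq> U"
     "total_length I > m - r"
    by (rule Vitali_covering_intervals[OF E(1) U(1,2) r(1) slope_above_interval[OF up], folded m_def])
  define W where "W = (\<Union>(s, t)\<in>I. {s<..<t})"
  have W: "open W" "W \<in> lmeasurable" "measure lebesgue W = total_length I"
    unfolding W_def using interval_family_Union(2,3)[OF I(1), of "\<lambda>(s, t). {s<..<t}"] by (auto intro!: open_UN)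
  have "W \<subseteq> U"
  proof
    fix x assume "x \<in> W"
    then obtain s t where st: "(s, t) \<in> I" "x \<in> {s<..<t}" by (auto simp: W_def)
    then have "x \<in> {s..t}" by auto
    then show "x \<in> U" using bspec[OF I(2) st(1)] by auto
  qed
  note W = W this
  have E': "E \<inter> W \<in> lmeasurable" using E W by (intro fmeasurable_Int_fmeasurable) auto
  have "m = measure lebesgue (E \<inter> W) + measure lebesgue (E - W)"
    using measurable_measure_Diff[OF E(1) fmeasurableD[OF E'] Int_lower1]
    by (simp add: m_def Diff_Int)
  moreover have "measure lebesgue (E - W) \<le> measure lebesgue (U - W)"
    using E U W by (intro measure_mono_fmeasurable fmeasurable_Diff) auto
  moreover have "measure lebesgue (U - W) = measure lebesgue U - measure lebesgue W"
    using U W by (intro measurable_measure_Diff) auto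
  ultimately have mE': "measure lebesgue (E \<inter> W) > m - 2 * r" using U(5) I(3) W(3) by linarith
  obtain K where K: "interval_family K" "\<forall>(s, t)\<in>K. - f t - - f s > - u * (t - s) \<and> {s..t} \<subseteq> W"
     "total_length K > measure lebesgue (E \<inter> W) - r"
    by (rule Vitali_covering_intervals[OF E' W(1) Int_lower2 r(1) slope_above_interval[OF down[OF IntD1]]])
  \<comment> \<open>A right endpoint of a member of \<open>I\<close> is not in \<open>W\<close>, so an interval contained in \<open>W\<close> cannot cross it.\<close>
  have inside: "\<exists>(a, b)\<in>I. a \<le> s \<and> t \<le> b" if st: "(s, t) \<in> K" for s t
  proof -
    have lt: "s < t" "{s..t} \<subseteq> W" using interval_family_less[OF K(1) st] K(2) st by auto
    then have "s \<in> W" by auto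
    then obtain p q where pq: "(p, q) \<in> I" "p < s" "s < q" by (auto simp: W_def)
    have "t \<le> q"
    proof (rule ccontr)
      assume "\<not> t \<le> q"
      then have "q \<in> W" using lt pq by auto
      then obtain p' q' where pq': "(p', q') \<in> I" "p' < q" "q < q'" by (auto simp: W_def)
      then show False using interval_family_apart[OF I(1) pq(1) pq'(1)] pq by auto
    qed
    then show ?thesis using pq by (intro bexI[OF _ pq(1)]) auto
  qed
  obtain G where G: "interval_family G" "\<forall>(s, t)\<in>G. \<exists>(a, b)\<in>I. a \<le> s \<and> t \<le> b"
     "\<And>f::real\<Rightarrow>real. increment f I = increment f K + increment f G"
    using interval_family_gaps[OF I(1) K(1)] inside by blast
  have len: "total_length I = total_length K + total_length G"
    using G(3)[of "\<lambda>x. x"] by (simp add: total_length_def)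
  have upper: "total_length I < m + r"
    using U(5) W measure_mono_fmeasurable[of W U lebesgue] U(4) by auto
  have "variation f G < e"
  proof (rule d(2)[OF G(1)])
    show "a \<le> s \<and> t \<le> b" if st: "(s, t) \<in> G" for s t
    proof -
      obtain p q where pq: "(p, q) \<in> I" "p \<le> s" "t \<le> q" using G(2) st by auto
      have "p < q" by (rule interval_family_less[OF I(1) pq(1)])
      moreover have "{p..q} \<subseteq> {a<..<b}" using bspec[OF I(2) pq(1)] U(3) by auto
      ultimately have "p \<in> {a<..<b}" "q \<in> {a<..<b}" by (metis atLeastAtMost_iff less_imp_le order_refl subsetD)+
      then show ?thesis using pq by auto
    qed
    show "total_length G < d" using len upper mE' K(3) r(2) by linarith
  qed
  moreover have "increment f G \<le> variation f G"
    by (intro sum_mono) auto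
  moreover have "v * total_length I \<le> increment f I"
    unfolding total_length_def sum_distrib_left using I(2) by (intro sum_mono) (auto simp: less_imp_le)
  moreover have "increment f K \<le> u * total_length K"
    unfolding total_length_def sum_distrib_left using K(2) by (intro sum_mono) (auto dest!: bspec[OF K(2)])
  ultimately have main: "v * total_length I < u * total_length K + e" using G(3)[of f] by linarith
  have 1: "(v - u) * (m - 3 * r) \<le> (v - u) * total_length K" using uv mE' K(3) by (intro mult_left_mono) auto
  have 2: "(v - u) * (m / 2) \<le> (v - u) * (m - 3 * r)" using uv r by (intro mult_left_mono) auto
  have 3: "(v - u) * (m / 2) = 2 * e" by (simp add: e_def)
  have 4: "- (v * total_length G) \<le> \<bar>v\<bar> * (4 * r)"
  proof -
    have "0 \<le> total_length G"
      unfolding total_length_def using interval_family_less[OF G(1)] by (intro sum_nonneg) (auto simp: less_imp_le)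
    moreover have "total_length G \<le> 4 * r" using len upper mE' K(3) by linarith
    ultimately have "\<bar>v\<bar> * total_length G \<le> \<bar>v\<bar> * (4 * r)" by (intro mult_left_mono) auto
    moreover have "- (v * total_length G) \<le> \<bar>v\<bar> * total_length G"
      using \<open>0 \<le> total_length G\<close> by (metis abs_ge_minus_self abs_mult abs_of_nonneg)
    ultimately show ?thesis by linarith
  qed
  have 5: "\<bar>v\<bar> * (4 * r) \<le> e / 2" using vr r(1) by (simp add: algebra_simps)
  have 6: "(v - u) * total_length K < e - v * total_length G" using main unfolding len by (simp add: algebra_simps)
  show False using 1 2 3 4 5 6 e by linarith
qed

text \<open>Intervals of small total length carry a total increment less than 1.  If the slope on them exceeds \<open>n\<close>,
  their total length is therefore less than \<open>1 / n\<close>.\<close>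

lemma AC_on_steep_null:
  fixes f :: "real \<Rightarrow> real"
  assumes ac: "AC_on a b f" and E: "E \<in> lmeasurable" "E \<subseteq> {a<..<b}"
    and steep: "\<And>x n. x \<in> E \<Longrightarrow> slope_above f (real n) x"
  shows "negligible E"
proof -
  obtain d where d: "d > 0" "\<And>I. interval_family I \<Longrightarrow> (\<And>s t. (s, t) \<in> I \<Longrightarrow> a \<le> s \<and> t \<le> b) \<Longrightarrow>
      total_length I < d \<Longrightarrow> variation f I < 1"
    using AC_onE[OF ac, of 1] by (metis zero_less_one)
  have local: "negligible (E \<inter> {x - d / 4<..<x + d / 4})" for x
  proof -
    define U where "U = {max a (x - d / 4)<..<min b (x + d / 4)}"
    define F where "F = E \<inter> {x - d / 4<..<x + d / 4}"
    have F: "F \<in> lmeasurable" "F \<subseteq> U" "F \<subseteq> E"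
      using E by (auto simp: F_def U_def intro!: fmeasurable_Int_fmeasurable)
    have bound: "measure lebesgue F \<le> 2 / real (Suc n)" for n
    proof -
      obtain I where I: "interval_family I" "\<forall>(s, t)\<in>I. f t - f s > real (Suc n) * (t - s) \<and> {s..t} \<subseteq> U"
         "total_length I > measure lebesgue F - 1 / real (Suc n)"
        by (rule Vitali_covering_intervals[OF F(1) _ F(2) _ slope_above_interval[OF steep[OF subsetD[OF F(3)], of _ "Suc n"]],
            of "1 / real (Suc n)"]) (auto simp: U_def)
      have "total_length I = measure lebesgue (\<Union>(s, t)\<in>I. {s<..<t})"
        by (rule interval_family_Union(3)[symmetric, OF I(1)]) auto
      also have "\<dots> \<le> measure lebesgue {x - d / 4<..<x + d / 4}"
      proof (rule measure_mono_fmeasurable)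
        show "(\<Union>(s, t)\<in>I. {s<..<t}) \<in> sets lebesgue"
          by (rule fmeasurableD[OF interval_family_Union(2)[OF I(1)]]) auto
        have "{s<..<t} \<subseteq> {x - d / 4<..<x + d / 4}" if "(s, t) \<in> I" for s t
        proof -
          have "{s<..<t} \<subseteq> {s..t}" by auto
          also have "\<dots> \<subseteq> U" using bspec[OF I(2) that] by auto
          also have "\<dots> \<subseteq> {x - d / 4<..<x + d / 4}" by (auto simp: U_def)
          finally show ?thesis .
        qed
        then show "(\<Union>(s, t)\<in>I. {s<..<t}) \<subseteq> {x - d / 4<..<x + d / 4}" by auto
      qed auto
      also have "\<dots> < d" using d(1) by simp
      finally have small: "total_length I < d" .
      have "real (Suc n) * total_length I \<le> variation f I"
        unfolding total_length_def sum_distrib_left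
      proof (intro sum_mono)
        fix i assume i: "i \<in> I"
        show "real (Suc n) * (case i of (s, t) \<Rightarrow> t - s) \<le> (case i of (s, t) \<Rightarrow> norm (f t - f s))"
          using bspec[OF I(2) i] by (auto split: prod.splits)
      qed
      also have "\<dots> < 1"
      proof (rule d(2)[OF I(1) _ small])
        show "a \<le> s \<and> t \<le> b" if "(s, t) \<in> I" for s t
        proof -
          have "{s..t} \<subseteq> U" "s < t" using I(2) interval_family_less[OF I(1)] that by auto
          then have "s \<in> U" "t \<in> U" by auto
          then show ?thesis by (auto simp: U_def)
        qed
      qed
      finally have "total_length I \<le> 1 / real (Suc n)" by (simp add: field_simps)
      then show ?thesis using I(3) by (simp add: field_simps)
    qed
    have "(\<lambda>n. 2 / real (Suc n)) \<longlonglongrightarrow> 0" by (rule LIMSEQ_Suc[OF lim_const_over_n])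
    then have "measure lebesgue F \<le> 0"
      by (rule LIMSEQ_le_const) (use bound in auto)
    then show ?thesis using F(1) unfolding F_def[symmetric]
      by (metis measure_le_0_iff negligible_iff_measure)
  qed
  show ?thesis unfolding locally_negligible_alt[of E]
  proof
    fix x assume "x \<in> E"
    then show "\<exists>U. openin (top_of_set E) U \<and> x \<in> U \<and> negligible U"
      using local[of x] d(1) by (intro exI[of _ "E \<inter> {x - d / 4<..<x + d / 4}"]) (auto intro: openin_open_Int)
  qed
qed

section \<open>Absolutely continuous functions are differentiable almost everywhere\<close>

text \<open>All closure properties of absolute continuity used below are instances of this comparison.\<close>

lemma AC_on_dominated:
  assumes "AC_on a b f" "AC_on a b k"
    and le: "\<And>s t. a \<le> s \<Longrightarrow> s \<le> t \<Longrightarrow> t \<le> b \<Longrightarrow> norm (g t - g s) \<le> C * (norm (f t - f s) + norm (k t - k s))"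
  shows "AC_on a b g"
  unfolding AC_on_iff
proof (intro allI impI)
  fix e :: real assume e: "e > 0"
  define c where "c = \<bar>C\<bar> + 1"
  have c: "c > 0" "C \<le> c" by (auto simp: c_def)
  have e': "e / (2 * c) > 0" using e c by simp
  obtain d1 where d1: "d1 > 0" "\<And>I. interval_family I \<Longrightarrow> (\<And>s t. (s, t) \<in> I \<Longrightarrow> a \<le> s \<and> t \<le> b) \<Longrightarrow>
      total_length I < d1 \<Longrightarrow> variation f I < e / (2 * c)"
    using AC_onE[OF assms(1) e'] by metis
  obtain d2 where d2: "d2 > 0" "\<And>I. interval_family I \<Longrightarrow> (\<And>s t. (s, t) \<in> I \<Longrightarrow> a \<le> s \<and> t \<le> b) \<Longrightarrow>
      total_length I < d2 \<Longrightarrow> variation k I < e / (2 * c)"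
    using AC_onE[OF assms(2) e'] by metis
  show "\<exists>d>0. \<forall>I. interval_family I \<and> (\<forall>(s, t)\<in>I. a \<le> s \<and> t \<le> b) \<and> total_length I < d
     \<longrightarrow> variation g I < e"
  proof (intro exI[of _ "min d1 d2"] conjI allI impI, goal_cases)
    case 1 then show ?case using d1 d2 by simp
  next
    case (2 I)
    then have I: "\<And>s t. (s, t) \<in> I \<Longrightarrow> a \<le> s \<and> s \<le> t \<and> t \<le> b"
      using interval_family_less[of I] by (force simp: less_imp_le)
    have 1: "variation f I < e / (2 * c)" using 2 I by (intro d1) auto
    have 2: "variation k I < e / (2 * c)" using 2 I by (intro d2) auto
    have "variation g I \<le> (\<Sum>(s, t)\<in>I. c * (norm (f t - f s) + norm (k t - k s)))"
    proof (intro sum_mono)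
      fix i assume i: "i \<in> I"
      obtain s t where st: "i = (s, t)" by force
      have "norm (g t - g s) \<le> C * (norm (f t - f s) + norm (k t - k s))" using I i st by (intro le) auto
      also have "\<dots> \<le> c * (norm (f t - f s) + norm (k t - k s))" using c by (intro mult_right_mono) auto
      finally show "(case i of (s, t) \<Rightarrow> norm (g t - g s)) \<le> (case i of (s, t) \<Rightarrow> c * (norm (f t - f s) + norm (k t - k s)))"
        by (simp add: st)
    qed
    also have "\<dots> = c * (variation f I + variation k I)"
      by (simp add: case_prod_unfold sum_distrib_left sum.distrib distrib_left)
    also have "\<dots> < c * (e / (2 * c) + e / (2 * c))"
      using 1 2 c by (intro mult_strict_left_mono) auto
    also have "\<dots> = e" using c by (simp add: field_simps)
    finally show ?case .
  qed
qed

lemma AC_on_dominated1: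
  assumes "AC_on a b f"
    and "\<And>s t. a \<le> s \<Longrightarrow> s \<le> t \<Longrightarrow> t \<le> b \<Longrightarrow> norm (g t - g s) \<le> C * norm (f t - f s)"
  shows "AC_on a b g"
  by (rule AC_on_dominated[OF assms(1,1), of _ "C / 2"]) (use assms(2) in \<open>auto simp: field_simps\<close>)

lemma AC_on_uminus: "AC_on a b f \<Longrightarrow> AC_on a b (\<lambda>x. - f x)"
  by (rule AC_on_dominated1[of _ _ f _ 1]) (auto simp: norm_minus_commute)

lemma AC_on_diff: "AC_on a b f \<Longrightarrow> AC_on a b k \<Longrightarrow> AC_on a b (\<lambda>x. f x - k x)"
  by (rule AC_on_dominated[of _ _ f k _ 1]) (auto simp: algebra_simps intro: order_trans[OF _ norm_triangle_ineq4[of "f _ - f _" "k _ - k _"]])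

lemma AC_on_ident: "AC_on a b (\<lambda>x::real. x)"
proof -
  have "(\<Sum>(s, t)\<in>I. norm (t - s)) = total_length I" if "interval_family I" for I
    unfolding total_length_def using interval_family_less[OF that] by (intro sum.cong) (auto simp: less_imp_le)
  then show ?thesis unfolding AC_on_iff by (intro allI impI) (metis (no_types, lifting))
qed

lemma AC_continuous_on_UNIV:
  assumes "\<And>a b. a \<le> b \<Longrightarrow> AC_on a b f"
  shows "continuous_on UNIV f"
proof (rule continuous_at_imp_continuous_on, rule ballI)
  fix x :: real
  have "continuous_on {x - 1..x + 1} f" using assms by (intro AC_on_continuous_on) auto
  then show "isCont f x" by (rule continuous_on_interior) auto
qed

lemma AE_notin_if_bounded_parts_negligible:
  assumes "\<And>n::nat. negligible (A \<inter> {- real n<..<real n})"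
  shows "AE x in lebesgue. x \<notin> A"
proof -
  have "A = (\<Union>n::nat. A \<inter> {- real n<..<real n})"
  proof (intro equalityI subsetI)
    fix x assume x: "x \<in> A"
    obtain n :: nat where "\<bar>x\<bar> < real n" using reals_Archimedean2 by blast
    then show "x \<in> (\<Union>n::nat. A \<inter> {- real n<..<real n})" using x by (intro UN_I[of n]) auto
  qed auto
  also have "negligible \<dots>" using assms by (intro negligible_countable_Union) auto
  finally show ?thesis by (auto simp: negligible_iff_null_sets dest: AE_not_in)
qed

lemma sets_borel_imp_lebesgue: "A \<in> sets borel \<Longrightarrow> A \<in> sets lebesgue"
  by (simp add: sets_completionI_sets)

lemma lmeasurable_Int_interval: "A \<in> sets lebesgue \<Longrightarrow> A \<inter> {a<..<b::real} \<in> lmeasurable"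
  by (metis Int_commute fmeasurable_Int_fmeasurable lmeasurable_interval(2) box_real(1))

lemma AC_differentiable_AE:
  fixes f :: "real \<Rightarrow> real"
  assumes ac: "\<And>a b. a \<le> b \<Longrightarrow> AC_on a b f"
  shows "AE x in lebesgue. \<exists>L. (f has_real_derivative L) (at x)"
proof -
  have ac': "\<And>a b. a \<le> b \<Longrightarrow> AC_on a b (\<lambda>x. - f x)" using ac by (rule AC_on_uminus)
  note cont = AC_continuous_on_UNIV[OF ac] and cont' = AC_continuous_on_UNIV[OF ac']
  have steep: "AE x in lebesgue. x \<notin> {x. \<forall>n::nat. slope_above k (real n) x}"
    if ac: "\<And>a b. a \<le> b \<Longrightarrow> AC_on a b k" for k :: "real \<Rightarrow> real"
  proof (rule AE_notin_if_bounded_parts_negligible)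
    fix n :: nat
    have "{x. \<forall>n::nat. slope_above k (real n) x} = (\<Inter>n. {x. slope_above k (real n) x})" by auto
    also have "\<dots> \<in> sets borel"
      using slope_above_borel[OF AC_continuous_on_UNIV[OF ac]] by (intro sets.countable_INT) auto
    finally show "negligible ({x. \<forall>n::nat. slope_above k (real n) x} \<inter> {- real n<..<real n})"
      by (intro AC_on_steep_null[OF ac, of "- real n" "real n"] lmeasurable_Int_interval sets_borel_imp_lebesgue) auto
  qed
  have osc: "AE x in lebesgue. \<forall>(u, v)\<in>\<rat> \<times> \<rat>. u < v \<longrightarrow> x \<notin> {x. slope_above f v x \<and> slope_above (\<lambda>x. - f x) (- u) x}"
  proof (rule AE_ball_countable')
    show "countable (\<rat> \<times> \<rat> :: (real \<times> real) set)" by (intro countable_SIGMA countable_rat)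
    fix i :: "real \<times> real"
    obtain u v where i: "i = (u, v)" by force
    have "AE x in lebesgue. x \<notin> {x. slope_above f v x \<and> slope_above (\<lambda>x. - f x) (- u) x}" if uv: "u < v"
    proof (rule AE_notin_if_bounded_parts_negligible)
      fix n :: nat
      have "{x. slope_above f v x \<and> slope_above (\<lambda>x. - f x) (- u) x}
          = {x. slope_above f v x} \<inter> {x. slope_above (\<lambda>x. - f x) (- u) x}" by auto
      also have "\<dots> \<in> sets borel"
        using slope_above_borel[OF cont] slope_above_borel[OF cont'] by (intro sets.Int) auto
      finally show "negligible ({x. slope_above f v x \<and> slope_above (\<lambda>x. - f x) (- u) x} \<inter> {- real n<..<real n})"
        using uv by (intro AC_on_oscillation_null[OF ac, of "- real n" "real n" _ u v]
            lmeasurable_Int_interval sets_borel_imp_lebesgue) auto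
    qed
    then show "AE x in lebesgue. case i of (u, v) \<Rightarrow> u < v \<longrightarrow>
        x \<notin> {x. slope_above f v x \<and> slope_above (\<lambda>x. - f x) (- u) x}"
      by (cases "u < v") (auto simp: i)
  qed
  have s1: "AE x in lebesgue. x \<notin> {x. \<forall>n::nat. slope_above f (real n) x}" by (rule steep) (rule ac)
  have s2: "AE x in lebesgue. x \<notin> {x. \<forall>n::nat. slope_above (\<lambda>x. - f x) (real n) x}" by (rule steep) (rule ac')
  show ?thesis using s1 s2 osc
  proof eventually_elim
    case (elim x)
    show ?case using elim by (intro differentiable_if_slopes) auto
  qed
qed

text \<open>Almost all of \<open>[a, b]\<close> is covered by intervals on which the increment is at most \<open>c\<close> times the length, with \<open>c\<close>
  as small as desired, and the increment over the remaining gaps is small by absolute continuity.\<close>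

lemma AC_on_eq_if_derivative_zero:
  fixes f :: "real \<Rightarrow> real"
  assumes ac: "AC_on a b f" and ab: "a \<le> b"
    and deriv: "AE x in lebesgue. x \<in> {a<..<b} \<longrightarrow> (f has_real_derivative 0) (at x)"
  shows "f b = f a"
proof -
  obtain N where N: "negligible N" "{x. \<not> (x \<in> {a<..<b} \<longrightarrow> (f has_real_derivative 0) (at x))} \<subseteq> N"
    using deriv unfolding eventually_ae_filter_negligible by blast
  define E where "E = {a<..<b} - N"
  have E: "E \<in> lmeasurable" "E \<subseteq> {a<..<b}" "measure lebesgue E = b - a"
    using N(1) ab unfolding E_def
    by (auto simp: negligible_imp_sets negligible_iff_null_sets measure_Diff_null_set intro!: fmeasurable_Diff)
  have "\<bar>f b - f a\<bar> \<le> e" if e: "e > 0" for e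
  proof -
    define w where "w = b - a + 1"
    have w: "w > 0" using ab by (simp add: w_def)
    define c where "c = e / 2 / w"
    have c: "c > 0" using e w by (simp add: c_def)
    obtain d where d: "d > 0" "\<And>I. interval_family I \<Longrightarrow> (\<And>s t. (s, t) \<in> I \<Longrightarrow> a \<le> s \<and> t \<le> b) \<Longrightarrow>
        total_length I < d \<Longrightarrow> variation f I < e / 2"
      using AC_onE[OF ac half_gt_zero[OF e]] by metis
    have fine: "\<exists>s t. s < t \<and> s \<le> x \<and> x \<le> t \<and> t - s < r \<and> \<bar>f t - f s\<bar> \<le> c * (t - s)"
      if x: "x \<in> E" and r: "r > 0" for x r
    proof -
      have "(f has_real_derivative 0) (at x)" using x N(2) by (auto simp: E_def)
      then have "((\<lambda>y. (f y - f x) / (y - x)) \<longlongrightarrow> 0) (at x)" by (simp add: has_field_derivative_iff)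
      then have "\<forall>\<^sub>F y in at x. dist ((f y - f x) / (y - x)) 0 < c" using c by (rule tendstoD)
      then obtain q where q: "q > 0" "\<And>y. y \<noteq> x \<Longrightarrow> dist y x < q \<Longrightarrow> \<bar>(f y - f x) / (y - x)\<bar> < c"
        unfolding eventually_at by (auto simp: dist_real_def)
      define y where "y = x + min q r / 2"
      have y: "x < y" "y - x < r" "dist y x < q" using q r by (auto simp: y_def dist_real_def min_def)
      have "\<bar>f y - f x\<bar> \<le> c * (y - x)" using q(2)[of y] y by (simp add: abs_divide field_simps)
      then show ?thesis using y by (intro exI[of _ x] exI[of _ y]) auto
    qed
    obtain K where K: "interval_family K" "\<forall>(s, t)\<in>K. \<bar>f t - f s\<bar> \<le> c * (t - s) \<and> {s..t} \<subseteq> {a<..<b}"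
        "total_length K > b - a - d"
      by (rule Vitali_covering_intervals[OF E(1) open_greaterThanLessThan E(2) d(1) fine, unfolded E(3)])
    have Kab: "a \<le> s \<and> t \<le> b" if "(s, t) \<in> K" for s t
    proof -
      have "{s..t} \<subseteq> {a<..<b}" "s < t" using bspec[OF K(2) that] interval_family_less[OF K(1) that] by auto
      then have "s \<in> {a<..<b}" "t \<in> {a<..<b}" by (metis atLeastAtMost_iff less_imp_le order_refl subsetD)+
      then show ?thesis by auto
    qed
    obtain G where G: "interval_family G" "\<forall>(s, t)\<in>G. a \<le> s \<and> t \<le> b"
      "\<And>f::real\<Rightarrow>real. f b - f a = increment f K + increment f G"
      using interval_family_gaps_single[OF K(1) _ ab] Kab by blast
    have len: "b - a = total_length K + total_length G"
      using G(3)[of "\<lambda>x. x"] by (simp add: total_length_def)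
    have "variation f G < e / 2"
      using G(2) len K(3) by (intro d(2)[OF G(1)]) auto
    moreover have "\<bar>increment f G\<bar> \<le> variation f G"
      using sum_abs[of "\<lambda>(s, t). f t - f s" G] by (simp add: case_prod_unfold)
    moreover have "\<bar>increment f K\<bar> \<le> c * total_length K"
    proof -
      have "\<bar>increment f K\<bar> \<le> (\<Sum>(s, t)\<in>K. \<bar>f t - f s\<bar>)"
        using sum_abs[of "\<lambda>(s, t). f t - f s" K] by (simp add: case_prod_unfold)
      also have "\<dots> \<le> c * total_length K"
        unfolding total_length_def sum_distrib_left
      proof (intro sum_mono)
        fix i assume i: "i \<in> K"
        show "(case i of (s, t) \<Rightarrow> \<bar>f t - f s\<bar>) \<le> c * (case i of (s, t) \<Rightarrow> t - s)"
          using bspec[OF K(2) i] by (auto split: prod.splits)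
      qed
      finally show ?thesis .
    qed
    moreover have "c * total_length K \<le> e / 2"
    proof -
      have "0 \<le> total_length G"
        unfolding total_length_def using interval_family_less[OF G(1)] by (intro sum_nonneg) (auto simp: less_imp_le)
      then have "c * total_length K \<le> c * w" using c len by (intro mult_left_mono) (auto simp: w_def)
      also have "\<dots> = e / 2" using w by (simp add: c_def)
      finally show ?thesis .
    qed
    ultimately show ?thesis using G(3)[of f] by linarith
  qed
  then have "\<not> \<bar>f b - f a\<bar> > 0" by (metis dense not_le)
  then show ?thesis by simp
qed

text \<open>The part of \<open>g\<close> above a high level has small integral everywhere, and the bounded rest has small integral over
  sets of small measure.\<close>

lemma integral_small_on_small_sets:
  fixes g :: "'a \<Rightarrow> 'b::{banach, second_countable_topology}"
  assumes g: "integrable M g" and e: "e > 0"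
  shows "\<exists>d>0. \<forall>A\<in>sets M. emeasure M A < ennreal d \<longrightarrow> (LINT x:A|M. norm (g x)) < e"
proof -
  define k where "k n x = max (norm (g x) - real n) 0" for n x
  have [measurable]: "g \<in> borel_measurable M" using g by auto
  have [measurable]: "k n \<in> borel_measurable M" for n unfolding k_def by measurable
  have "(\<lambda>n. LINT x|M. k n x) \<longlonglongrightarrow> (LINT x|M. 0)"
  proof (rule integral_dominated_convergence[where w = "\<lambda>x. norm (g x)"])
    show "AE x in M. (\<lambda>n. k n x) \<longlonglongrightarrow> 0"
    proof (rule AE_I2)
      fix x
      obtain N :: nat where N: "norm (g x) \<le> real N" using real_arch_simple by blast
      have "\<forall>\<^sub>F n in sequentially. k n x = 0"
        unfolding eventually_sequentially using N by (intro exI[of _ N]) (auto simp: k_def)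
      then show "(\<lambda>n. k n x) \<longlonglongrightarrow> 0" by (rule tendsto_eventually)
    qed
    show "AE x in M. norm (k n x) \<le> norm (g x)" for n by (rule AE_I2) (auto simp: k_def)
  qed (use g in auto)
  then have "\<forall>\<^sub>F n in sequentially. (LINT x|M. k n x) < e / 2"
    using e by (intro order_tendstoD(2)) auto
  then obtain n where n: "(LINT x|M. k n x) < e / 2" by (meson eventually_sequentially order_refl)
  have kint: "integrable M (k n)"
    by (rule Bochner_Integration.integrable_bound[OF integrable_norm[OF g]]) (auto simp: k_def)
  define d where "d = e / 2 / real (Suc n)"
  have d: "d > 0" using e by (simp add: d_def)
  have "(LINT x:A|M. norm (g x)) < e" if A: "A \<in> sets M" and small: "emeasure M A < ennreal d" for A
  proof -
    have fin: "emeasure M A < \<infinity>" using small by (metis ennreal_less_top infinity_ennreal_def order_less_trans)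
    have mA: "measure M A < d"
      using small fin d by (metis emeasure_eq_ennreal_measure ennreal_less_iff infinity_ennreal_def measure_nonneg less_irrefl)
    have iA: "integrable M (\<lambda>x. real n * indicator A x)" using A fin by (intro integrable_mult_right integrable_real_indicator)
    have "(LINT x:A|M. norm (g x)) \<le> (LINT x|M. k n x + real n * indicator A x)"
      unfolding set_lebesgue_integral_def
    proof (rule integral_mono)
      show "integrable M (\<lambda>x. indicator A x *\<^sub>R norm (g x))"
        using A by (intro integrable_mult_indicator integrable_norm g)
      show "integrable M (\<lambda>x. k n x + real n * indicator A x)" using kint iA by auto
    qed (auto simp: k_def indicator_def)
    also have "\<dots> = (LINT x|M. k n x) + real n * measure M A"
      using kint iA A fin by (simp add: Bochner_Integration.integral_add)
    also have "\<dots> < e / 2 + e / 2"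
    proof (rule add_less_le_mono[OF n])
      have "real n * measure M A \<le> real (Suc n) * d" using mA by (intro mult_mono) auto
      also have "\<dots> = e / 2" by (simp add: d_def del: of_nat_Suc)
      finally show "real n * measure M A \<le> e / 2" .
    qed
    finally show ?thesis by simp
  qed
  then show ?thesis using d by blast
qed

section \<open>Lebesgue's differentiation theorem on the line\<close>

definition locally_integrable :: "(real \<Rightarrow> 'a::{banach, second_countable_topology}) \<Rightarrow> bool" where
  "locally_integrable g \<longleftrightarrow> (\<forall>a b. set_integrable lebesgue {a..b} g)"

lemma locally_integrable_subset:
  "locally_integrable g \<Longrightarrow> A \<in> sets lebesgue \<Longrightarrow> A \<subseteq> {a..b} \<Longrightarrow> set_integrable lebesgue A g"
  unfolding locally_integrable_def by (meson set_integrable_subset)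

lemma integrable_imp_locally_integrable: "integrable lebesgue g \<Longrightarrow> locally_integrable g"
  unfolding locally_integrable_def set_integrable_def by (intro allI integrable_mult_indicator) auto

lemma locally_integrable_measurable:
  assumes "locally_integrable g"
  shows "g \<in> borel_measurable lebesgue"
proof (rule borel_measurable_LIMSEQ_metric)
  show "(\<lambda>x. indicator {- real n..real n} x *\<^sub>R g x) \<in> borel_measurable lebesgue" for n
    using assms unfolding locally_integrable_def set_integrable_def by (blast dest: borel_measurable_integrable)
  fix x
  obtain N :: nat where N: "\<bar>x\<bar> \<le> real N" using real_arch_simple by blast
  have "\<forall>\<^sub>F n in sequentially. indicator {- real n..real n} x *\<^sub>R g x = g x"
    unfolding eventually_sequentially using N by (intro exI[of _ N]) (auto simp: indicator_def)
  then show "(\<lambda>n. indicator {- real n..real n} x *\<^sub>R g x) \<longlonglongrightarrow> g x" by (rule tendsto_eventually)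
qed

lemma indefinite_integral_AC_on:
  assumes g: "locally_integrable g"
    and G: "\<And>s t. s \<le> t \<Longrightarrow> G t - G s = (LINT x:{s<..t}|lebesgue. g x)"
  shows "AC_on a b G"
  unfolding AC_on_iff
proof (intro allI impI)
  fix e :: real assume e: "e > 0"
  define k where "k x = indicator {a..b} x *\<^sub>R g x" for x
  have k: "integrable lebesgue k" using g unfolding k_def locally_integrable_def set_integrable_def by blast
  obtain d where d: "d > 0" "\<And>A. A \<in> sets lebesgue \<Longrightarrow> emeasure lebesgue A < ennreal d \<Longrightarrow>
      (LINT x:A|lebesgue. norm (k x)) < e"
    using integral_small_on_small_sets[OF k e] by blast
  have "variation G I < e"
    if fam: "interval_family I" and I: "\<forall>(s, t)\<in>I. a \<le> s \<and> t \<le> b" and len: "total_length I < d" for I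
  proof -
    define J where "J i = (case i of (s, t) \<Rightarrow> {s<..t::real})" for i
    have "J (s, t) = {s<..<t} \<or> J (s, t) = {s<..t}" for s t by (simp add: J_def)
    note Un = interval_family_Union[OF fam, of J, OF this]
    have J: "J i \<in> sets lebesgue" for i by (auto simp: J_def split: prod.split)
    have kJ: "set_integrable lebesgue (J i) (\<lambda>x. norm (k x))" for i
      unfolding set_integrable_def using k J by (intro integrable_mult_indicator integrable_norm)
    have "variation G I \<le> (\<Sum>i\<in>I. LINT x:J i|lebesgue. norm (k x))"
    proof (rule sum_mono)
      fix i assume i: "i \<in> I"
      obtain s t where st: "i = (s, t)" by force
      have le: "a \<le> s" "s \<le> t" "t \<le> b" using bspec[OF I i] interval_family_less[OF fam, of s t] i by (auto simp: st)
      have "norm (G t - G s) \<le> (LINT x:{s<..t}|lebesgue. norm (g x))"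
        unfolding G[OF le(2)]
        by (intro set_integral_norm_bound locally_integrable_subset[OF g, of _ a b]) (use le in auto)
      also have "\<dots> = (LINT x:J i|lebesgue. norm (k x))"
        unfolding J_def st prod.case by (intro set_lebesgue_integral_cong) (use le in \<open>auto simp: k_def\<close>)
      finally show "(case i of (s, t) \<Rightarrow> norm (G t - G s)) \<le> (LINT x:J i|lebesgue. norm (k x))" by (simp add: st)
    qed
    also have "\<dots> = (LINT x:(\<Union>i\<in>I. J i)|lebesgue. norm (k x))"
      by (intro set_integral_finite_Union[symmetric] interval_family_finite[OF fam] J kJ) (rule Un)
    also have "\<dots> < e"
    proof (rule d(2))
      show "(\<Union>i\<in>I. J i) \<in> sets lebesgue" using Un(2) by (rule fmeasurableD)
      show "emeasure lebesgue (\<Union>i\<in>I. J i) < ennreal d"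
        using len d(1) unfolding emeasure_eq_measure2[OF Un(2)] Un(3) by (rule ennreal_lessI[rotated])
    qed
    finally show ?thesis .
  qed
  then show "\<exists>d>0. \<forall>I. interval_family I \<and> (\<forall>(s, t)\<in>I. a \<le> s \<and> t \<le> b) \<and> total_length I < d
      \<longrightarrow> variation G I < e"
    using d(1) by (intro exI[of _ d]) blast
qed

text \<open>Cover almost all of \<open>E\<close> by intervals with slope above \<open>v\<close> inside an open set that is hardly larger than \<open>E\<close>.  The
  integral of \<open>g\<close> over these intervals exceeds \<open>v\<close> times their length; but on \<open>E\<close> itself \<open>g\<close> is less than \<open>u\<close>, and the
  part outside \<open>E\<close> has small measure and hence contributes little.\<close>

lemma indefinite_integral_slope_null:
  fixes g :: "real \<Rightarrow> real"
  assumes g: "locally_integrable g"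
    and G: "\<And>s t. s \<le> t \<Longrightarrow> G t - G s = (LINT x:{s<..t}|lebesgue. g x)"
    and uv: "u < v" and E: "E \<in> lmeasurable" "E \<subseteq> {a<..<b}"
    and above: "\<And>x. x \<in> E \<Longrightarrow> slope_above G v x" and below: "\<And>x. x \<in> E \<Longrightarrow> g x < u"
  shows "negligible E"
proof (rule ccontr)
  assume "\<not> negligible E"
  then have "measure lebesgue E > 0"
    using E by (metis negligible_iff_measure order_le_less measure_nonneg)
  define m where "m = measure lebesgue E"
  have m: "m > 0" unfolding m_def by fact
  define e where "e = (v - u) * m / 4"
  have e: "e > 0" using uv m by (simp add: e_def)
  define k where "k x = indicator {a..b} x *\<^sub>R g x" for x
  have k: "integrable lebesgue k" using g unfolding k_def locally_integrable_def set_integrable_def by blast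
  obtain d where d: "d > 0" "\<And>A. A \<in> sets lebesgue \<Longrightarrow> emeasure lebesgue A < ennreal d \<Longrightarrow>
      (LINT x:A|lebesgue. norm (k x)) < e"
    using integral_small_on_small_sets[OF k e] by blast
  \<comment> \<open>The intervals cover more than \<open>m - 2 r\<close> of \<open>E\<close> and less than \<open>r\<close> of its complement.\<close>
  define r where "r = min d (min (m / 6) (e / (\<bar>v\<bar> + 1)))"
  have r: "r > 0" "r \<le> d" "6 * r \<le> m" using d m e by (auto simp: r_def)
  have "r \<le> e / (\<bar>v\<bar> + 1)" by (simp add: r_def)
  then have vr: "r * (\<bar>v\<bar> + 1) \<le> e" by (simp add: field_simps)
  obtain U where U: "open U" "E \<subseteq> U" "U \<subseteq> {a<..<b}" "U \<in> lmeasurable" "measure lebesgue U < m + r"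
    using measurable_hull_open[OF E r(1)] unfolding m_def by metis
  obtain I where I: "interval_family I" "\<forall>(s, t)\<in>I. G t - G s > v * (t - s) \<and> {s..t} \<subseteq> U"
     "total_length I > m - r"
    by (rule Vitali_covering_intervals[OF E(1) U(1,2) r(1) slope_above_interval[OF above], folded m_def])
  define J where "J i = (case i of (s, t) \<Rightarrow> {s<..t::real})" for i
  have "J (s, t) = {s<..<t} \<or> J (s, t) = {s<..t}" for s t by (simp add: J_def)
  note Un = interval_family_Union[OF I(1), of J, OF this]
  define S where "S = (\<Union>i\<in>I. J i)"
  have S: "S \<in> lmeasurable" and mS: "measure lebesgue S = total_length I"
    unfolding S_def by (rule Un)+
  have SU: "S \<subseteq> U"
  proof
    fix x assume "x \<in> S"
    then obtain s t where st: "(s, t) \<in> I" "x \<in> {s<..t}" by (auto simp: S_def J_def)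
    then have "x \<in> {s..t}" by auto
    then show "x \<in> U" using bspec[OF I(2) st(1)] by auto
  qed
  have Sab: "S \<subseteq> {a..b}" using SU U(3) by fastforce
  have SE: "S \<inter> E \<in> lmeasurable" "S - E \<in> lmeasurable"
    using S E by (auto intro: fmeasurable_Int_fmeasurable fmeasurable_Diff)
  have split: "measure lebesgue S = measure lebesgue (S \<inter> E) + measure lebesgue (S - E)"
    using measurable_measure_Diff[OF S fmeasurableD[OF SE(1)] Int_lower1] by (simp add: Diff_Int)
  have small: "measure lebesgue (S - E) < r"
  proof -
    have "measure lebesgue (S - E) \<le> measure lebesgue (U - E)"
      using SE U E SU by (intro measure_mono_fmeasurable fmeasurable_Diff) auto
    also have "\<dots> = measure lebesgue U - m"
      unfolding m_def using U E by (intro measurable_measure_Diff) auto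
    finally show ?thesis using U(5) by linarith
  qed
  have int: "set_integrable lebesgue A g" if "A \<in> sets lebesgue" "A \<subseteq> S" for A
    using locally_integrable_subset[OF g that(1), of a b] that(2) Sab by blast
  have iSE: "integrable lebesgue (indicat_real (S \<inter> E))"
    using SE(1) unfolding fmeasurable_def by (intro integrable_real_indicator) blast+
  have "v * total_length I \<le> increment G I"
    unfolding total_length_def sum_distrib_left
  proof (rule sum_mono)
    fix i assume i: "i \<in> I"
    show "v * (case i of (s, t) \<Rightarrow> t - s) \<le> (case i of (s, t) \<Rightarrow> G t - G s)"
      using bspec[OF I(2) i] by (auto split: prod.splits)
  qed
  also have "\<dots> = (\<Sum>i\<in>I. LINT x:J i|lebesgue. g x)"
    by (intro sum.cong) (use interval_family_less[OF I(1)] in \<open>auto simp: J_def G less_imp_le\<close>)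
  also have "\<dots> = (LINT x:S|lebesgue. g x)"
    unfolding S_def
    by (intro set_integral_finite_Union[symmetric] interval_family_finite[OF I(1)] Un(1) int) (auto simp: S_def J_def)
  also have "\<dots> = (LINT x:(S \<inter> E) \<union> (S - E)|lebesgue. g x)" by (simp add: Int_Diff_Un)
  also have "\<dots> = (LINT x:S \<inter> E|lebesgue. g x) + (LINT x:S - E|lebesgue. g x)"
    using SE by (intro set_integral_Un int) auto
  also have "(LINT x:S \<inter> E|lebesgue. g x) \<le> (LINT x:S \<inter> E|lebesgue. u)"
    using SE below by (intro set_integral_mono int) (auto simp: set_integrable_def less_imp_le iSE)
  also have "(LINT x:S \<inter> E|lebesgue. u) = u * measure lebesgue (S \<inter> E)"
    using SE iSE by (simp add: set_lebesgue_integral_def)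
  also have "(LINT x:S - E|lebesgue. g x) \<le> (LINT x:S - E|lebesgue. norm (k x))"
  proof -
    have "(LINT x:S - E|lebesgue. g x) \<le> (LINT x:S - E|lebesgue. norm (g x))"
      using SE int[of "S - E"] by (intro set_integral_mono) (auto intro: set_integrable_abs)
    also have "\<dots> = (LINT x:S - E|lebesgue. norm (k x))"
      using SE Sab by (intro set_lebesgue_integral_cong) (auto simp: k_def indicator_def)
    finally show ?thesis .
  qed
  also have "(LINT x:S - E|lebesgue. norm (k x)) < e"
  proof (rule d(2))
    have "emeasure lebesgue (S - E) = ennreal (measure lebesgue (S - E))"
      by (rule emeasure_eq_measure2[OF SE(2)])
    also have "\<dots> < ennreal d" using small r d(1) by (intro ennreal_lessI) auto
    finally show "emeasure lebesgue (S - E) < ennreal d" .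
  qed (use SE in auto)
  finally have main: "v * total_length I < u * measure lebesgue (S \<inter> E) + e" by simp
  define p q where "p = measure lebesgue (S \<inter> E)" and "q = measure lebesgue (S - E)"
  have pq: "total_length I = p + q" "q < r" "q \<ge> 0" "p > m - 2 * r"
    using split mS small I(3) by (auto simp: p_def q_def)
  have 1: "(v - u) * (m * 2 / 3) \<le> (v - u) * p" using uv pq r by (intro mult_left_mono) auto
  have 2: "- (v * q) \<le> \<bar>v\<bar> * r"
  proof -
    have "- (v * q) \<le> \<bar>v\<bar> * q" using pq(3) by (metis abs_ge_minus_self abs_mult abs_of_nonneg)
    also have "\<dots> \<le> \<bar>v\<bar> * r" using pq by (intro mult_left_mono) auto
    finally show ?thesis .
  qed
  have 3: "(v - u) * p < e - v * q" using main unfolding pq(1) p_def[symmetric] by (simp add: algebra_simps)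
  have 4: "\<bar>v\<bar> * r \<le> e" using vr r by (simp add: algebra_simps)
  have 5: "(v - u) * (m * 2 / 3) = e * 8 / 3" by (simp add: e_def)
  show False using 1 2 3 4 5 e by linarith
qed

lemma indefinite_integral_slope_AE:
  fixes g :: "real \<Rightarrow> real"
  assumes g: "locally_integrable g"
    and G: "\<And>s t. s \<le> t \<Longrightarrow> G t - G s = (LINT x:{s<..t}|lebesgue. g x)"
  shows "AE x in lebesgue. \<forall>e>0. \<not> slope_above G (g x + e) x"
proof -
  have ac: "AC_on a b G" for a b by (rule indefinite_integral_AC_on[OF g G])
  have [measurable]: "g \<in> borel_measurable lebesgue" by (rule locally_integrable_measurable[OF g])
  have "AE x in lebesgue. \<forall>(u, v)\<in>\<rat> \<times> \<rat>. u < v \<longrightarrow> x \<notin> {x. slope_above G v x \<and> g x < u}"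
  proof (rule AE_ball_countable')
    show "countable (\<rat> \<times> \<rat> :: (real \<times> real) set)" by (intro countable_SIGMA countable_rat)
    fix i :: "real \<times> real"
    obtain u v where i: "i = (u, v)" by force
    have "AE x in lebesgue. x \<notin> {x. slope_above G v x \<and> g x < u}" if uv: "u < v"
    proof (rule AE_notin_if_bounded_parts_negligible)
      fix n :: nat
      have "{x \<in> space lebesgue. g x < u} \<in> sets lebesgue" by measurable
      moreover have "{x. slope_above G v x} \<in> sets lebesgue"
        by (rule sets_borel_imp_lebesgue[OF slope_above_borel[OF AC_continuous_on_UNIV[OF ac]]])
      ultimately have "{x. slope_above G v x} \<inter> {x \<in> space lebesgue. g x < u} \<in> sets lebesgue" by auto
      moreover have "{x. slope_above G v x \<and> g x < u} = {x. slope_above G v x} \<inter> {x \<in> space lebesgue. g x < u}"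
        by auto
      ultimately have "{x. slope_above G v x \<and> g x < u} \<in> sets lebesgue" by simp
      then show "negligible ({x. slope_above G v x \<and> g x < u} \<inter> {- real n<..<real n})"
        using uv by (intro indefinite_integral_slope_null[OF g G, of u v _ "- real n" "real n"]
            lmeasurable_Int_interval) auto
    qed
    then show "AE x in lebesgue. case i of (u, v) \<Rightarrow> u < v \<longrightarrow> x \<notin> {x. slope_above G v x \<and> g x < u}"
      by (cases "u < v") (auto simp: i)
  qed
  then show ?thesis
  proof eventually_elim
    case (elim x)
    show ?case
    proof (intro allI impI notI)
      fix e :: real assume e: "e > 0" and above: "slope_above G (g x + e) x"
      obtain u where u: "u \<in> \<rat>" "g x < u" "u < g x + e" using Rats_dense_in_real[of "g x" "g x + e"] e by auto
      obtain v where v: "v \<in> \<rat>" "u < v" "v < g x + e" using Rats_dense_in_real[of u "g x + e"] u by auto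
      show False
        using bspec[OF elim, of "(u, v)"] u v slope_above_mono[OF above, of v] by auto
    qed
  qed
qed

text \<open>The previous lemma bounds the upper derivate of \<open>G\<close> by \<open>g\<close>; applied to \<open>- G\<close> it bounds the lower derivate.\<close>

lemma indefinite_integral_has_real_derivative_AE:
  fixes g :: "real \<Rightarrow> real"
  assumes g: "locally_integrable g"
    and G: "\<And>s t. s \<le> t \<Longrightarrow> G t - G s = (LINT x:{s<..t}|lebesgue. g x)"
  shows "AE x in lebesgue. (G has_real_derivative g x) (at x)"
proof -
  have g': "locally_integrable (\<lambda>x. - g x)" using g by (simp add: locally_integrable_def set_integrable_def)
  have G': "- G t - - G s = (LINT x:{s<..t}|lebesgue. - g x)" if "s \<le> t" for s t
    using G[OF that] by (simp add: set_lebesgue_integral_def)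
  have "AE x in lebesgue. \<forall>e>0. \<not> slope_above G (g x + e) x"
    by (rule indefinite_integral_slope_AE[OF g]) (rule G)
  moreover have "AE x in lebesgue. \<forall>e>0. \<not> slope_above (\<lambda>x. - G x) (- g x + e) x"
    by (rule indefinite_integral_slope_AE[OF g']) (rule G')
  ultimately show ?thesis
    by eventually_elim (rule has_real_derivative_if_slopes, auto)
qed

section \<open>Calculus of locally absolutely continuous functions\<close>

lemma has_vector_derivative_complexI:
  assumes "((\<lambda>x. Re (f x)) has_real_derivative Re d) (at x)" "((\<lambda>x. Im (f x)) has_real_derivative Im d) (at x)"
  shows "(f has_vector_derivative d) (at x)"
proof -
  have "((\<lambda>x. of_real (Re (f x)) + \<i> * of_real (Im (f x))) has_vector_derivative of_real (Re d) + \<i> * of_real (Im d)) (at x)"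
    using assms unfolding has_real_derivative_iff_has_vector_derivative
    by (intro has_vector_derivative_add has_vector_derivative_mult_right
        bounded_linear.has_vector_derivative[OF bounded_linear_of_real])
  then show ?thesis by (simp add: complex_eq[symmetric])
qed

lemma AC_locD: "f \<in> AC_loc \<Longrightarrow> a \<le> b \<Longrightarrow> AC_on a b f"
  by (simp add: AC_loc_def)

lemma AC_on_bounded_linear:
  assumes "bounded_linear T" "AC_on a b f"
  shows "AC_on a b (\<lambda>x. T (f x))"
proof -
  interpret bounded_linear T by fact
  obtain C where "\<And>x. norm (T x) \<le> norm x * C" using bounded by blast
  then show ?thesis
    by (intro AC_on_dominated1[OF assms(2), of _ C]) (simp add: mult.commute[of C] flip: diff)
qed

lemma AC_loc_continuous: "f \<in> AC_loc \<Longrightarrow> continuous_on UNIV f"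
  by (rule AC_continuous_on_UNIV) (rule AC_locD)

lemma continuous_imp_lebesgue_measurable:
  "continuous_on UNIV f \<Longrightarrow> f \<in> borel_measurable (lebesgue :: real measure)"
  by (intro measurable_completion) (simp add: borel_measurable_continuous_onI)

lemma AC_loc_measurable: "f \<in> AC_loc \<Longrightarrow> f \<in> borel_measurable lebesgue"
  by (intro continuous_imp_lebesgue_measurable AC_loc_continuous)

lemma AC_loc_has_vector_derivative:
  assumes "f \<in> AC_loc"
  shows "AE x in lebesgue. (f has_vector_derivative ac_deriv f x) (at x)"
proof -
  have "AE x in lebesgue. \<exists>L. ((\<lambda>x. Re (f x)) has_real_derivative L) (at x)"
    by (rule AC_differentiable_AE) (rule AC_on_bounded_linear[OF bounded_linear_Re AC_locD[OF assms]])
  moreover have "AE x in lebesgue. \<exists>L. ((\<lambda>x. Im (f x)) has_real_derivative L) (at x)"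
    by (rule AC_differentiable_AE) (rule AC_on_bounded_linear[OF bounded_linear_Im AC_locD[OF assms]])
  ultimately show ?thesis
  proof eventually_elim
    case (elim x)
    then obtain a b where "((\<lambda>x. Re (f x)) has_real_derivative a) (at x)" "((\<lambda>x. Im (f x)) has_real_derivative b) (at x)"
      by blast
    then have "(f has_vector_derivative Complex a b) (at x)" by (intro has_vector_derivative_complexI) auto
    then show ?case using vector_derivative_at by fastforce
  qed
qed

lemma locally_integrable_bounded_linear:
  assumes "bounded_linear T" "locally_integrable g"
  shows "locally_integrable (\<lambda>x. T (g x))"
  using assms integrable_bounded_linear[OF assms(1)] unfolding locally_integrable_def set_integrable_def
  by (fastforce simp flip: linear_scale[OF bounded_linear.linear[OF assms(1)]])

lemma set_integral_bounded_linear: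
  assumes "bounded_linear T" "set_integrable M A g"
  shows "(LINT x:A|M. T (g x)) = T (LINT x:A|M. g x)"
  using integral_bounded_linear[OF assms(1) assms(2)[unfolded set_integrable_def]]
  by (simp add: set_lebesgue_integral_def linear_scale[OF bounded_linear.linear[OF assms(1)]])

lemma indefinite_integral_AC_loc:
  assumes "locally_integrable g"
    and "\<And>s t. s \<le> t \<Longrightarrow> G t - G s = (LINT x:{s<..t}|lebesgue. g x)"
  shows "G \<in> AC_loc"
  using indefinite_integral_AC_on[OF assms] by (simp add: AC_loc_def)

lemma indefinite_integral_has_vector_derivative_AE:
  fixes g :: "real \<Rightarrow> complex"
  assumes g: "locally_integrable g"
    and G: "\<And>s t. s \<le> t \<Longrightarrow> G t - G s = (LINT x:{s<..t}|lebesgue. g x)"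
  shows "AE x in lebesgue. (G has_vector_derivative g x) (at x)"
proof -
  have int: "set_integrable lebesgue {s<..t} g" for s t
    by (rule locally_integrable_subset[OF g, of _ s t]) auto
  have "AE x in lebesgue. ((\<lambda>x. Re (G x)) has_real_derivative Re (g x)) (at x)"
    by (rule indefinite_integral_has_real_derivative_AE[OF locally_integrable_bounded_linear[OF bounded_linear_Re g]])
      (simp add: set_integral_bounded_linear[OF bounded_linear_Re int] flip: G)
  moreover have "AE x in lebesgue. ((\<lambda>x. Im (G x)) has_real_derivative Im (g x)) (at x)"
    by (rule indefinite_integral_has_real_derivative_AE[OF locally_integrable_bounded_linear[OF bounded_linear_Im g]])
      (simp add: set_integral_bounded_linear[OF bounded_linear_Im int] flip: G)
  ultimately show ?thesis by eventually_elim (rule has_vector_derivative_complexI)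
qed

lemma AC_loc_diff: "f \<in> AC_loc \<Longrightarrow> g \<in> AC_loc \<Longrightarrow> (\<lambda>x. f x - g x) \<in> AC_loc"
  by (simp add: AC_loc_def AC_on_diff)

text \<open>The difference of \<open>f\<close> and the indefinite integral of its derivative is absolutely continuous, with derivative
  zero almost everywhere, and hence constant.\<close>

lemma AC_loc_integral_derivative:
  assumes f: "f \<in> AC_loc" and f': "AE x in lebesgue. (f has_vector_derivative f' x) (at x)"
    and int: "locally_integrable f'" and ab: "a \<le> b"
  shows "f b - f a = (LINT x:{a<..b}|lebesgue. f' x)"
proof -
  define k where "k x = indicator {a..b} x *\<^sub>R f' x" for x
  have k: "integrable lebesgue k" using int unfolding k_def locally_integrable_def set_integrable_def by blast
  have sk: "set_integrable lebesgue A k" if "A \<in> sets lebesgue" for A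
    unfolding set_integrable_def using that k by (rule integrable_mult_indicator)
  define G where "G x = (LINT y:{..x}|lebesgue. k y)" for x
  have G: "G t - G s = (LINT x:{s<..t}|lebesgue. k x)" if "s \<le> t" for s t
  proof -
    have "G t = (LINT x:{..s} \<union> {s<..t}|lebesgue. k x)" using that by (simp add: G_def ivl_disj_un)
    also have "\<dots> = G s + (LINT x:{s<..t}|lebesgue. k x)"
      unfolding G_def by (intro set_integral_Un sk) auto
    finally show ?thesis by simp
  qed
  have lk: "locally_integrable k" by (rule integrable_imp_locally_integrable[OF k])
  have "G \<in> AC_loc" by (rule indefinite_integral_AC_loc[OF lk]) (rule G)
  then have H: "(\<lambda>x. f x - G x) \<in> AC_loc" using f by (intro AC_loc_diff)
  have "AE x in lebesgue. (G has_vector_derivative k x) (at x)"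
    by (rule indefinite_integral_has_vector_derivative_AE[OF lk]) (rule G)
  with f' have AE: "AE x in lebesgue. x \<in> {a<..<b} \<longrightarrow> ((\<lambda>x. f x - G x) has_vector_derivative 0) (at x)"
  proof eventually_elim
    case (elim x)
    show ?case
    proof
      assume "x \<in> {a<..<b}"
      then have "k x = f' x" by (auto simp: k_def)
      then show "((\<lambda>x. f x - G x) has_vector_derivative 0) (at x)"
        using has_vector_derivative_diff[OF elim] by simp
    qed
  qed
  have "T (f b - G b) = T (f a - G a)" if T: "bounded_linear T" for T :: "complex \<Rightarrow> real"
  proof (rule AC_on_eq_if_derivative_zero[OF AC_on_bounded_linear[OF T AC_locD[OF H ab]] ab])
    show "AE x in lebesgue. x \<in> {a<..<b} \<longrightarrow> ((\<lambda>x. T (f x - G x)) has_real_derivative 0) (at x)"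
      using AE bounded_linear.has_vector_derivative[OF T] linear_0[OF bounded_linear.linear[OF T]]
      by (auto simp: has_real_derivative_iff_has_vector_derivative elim!: eventually_mono) fastforce
  qed
  then have "f b - G b = f a - G a" using bounded_linear_Re bounded_linear_Im by (intro complex_eqI) blast+
  then have "f b - f a = G b - G a" by (simp add: algebra_simps)
  also have "\<dots> = (LINT x:{a<..b}|lebesgue. f' x)"
    unfolding G[OF ab] by (rule set_lebesgue_integral_cong) (auto simp: k_def)
  finally show ?thesis .
qed

lemma AC_loc_mult:
  assumes f: "f \<in> AC_loc" and g: "g \<in> AC_loc"
  shows "(\<lambda>x. f x * g x) \<in> AC_loc"
  unfolding AC_loc_def
proof (intro CollectI allI impI)
  fix a b :: real assume ab: "a \<le> b"
  have "bounded ((\<lambda>x. f x) ` {a..b})" "bounded ((\<lambda>x. g x) ` {a..b})"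
    by (intro compact_imp_bounded compact_continuous_image continuous_on_subset[OF AC_loc_continuous] f g; simp)+
  then obtain M N where "\<forall>y\<in>f ` {a..b}. norm y \<le> M" "\<forall>y\<in>g ` {a..b}. norm y \<le> N"
    unfolding bounded_iff by blast
  then have M: "\<And>x. x \<in> {a..b} \<Longrightarrow> norm (f x) \<le> M" and N: "\<And>x. x \<in> {a..b} \<Longrightarrow> norm (g x) \<le> N"
    by blast+
  show "AC_on a b (\<lambda>x. f x * g x)"
  proof (rule AC_on_dominated[OF AC_locD[OF f ab] AC_locD[OF g ab], of _ "max M N"])
    fix s t assume st: "a \<le> s" "s \<le> t" "t \<le> b"
    have "norm (f t) \<le> M" "norm (g s) \<le> N" using M N st by auto
    then have MN: "norm (f t) \<le> max M N" "norm (g s) \<le> max M N" by auto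
    then have MN0: "0 \<le> max M N" using norm_ge_zero order_trans by blast
    have "f t * g t - f s * g s = f t * (g t - g s) + (f t - f s) * g s" by (simp add: algebra_simps)
    also have "norm \<dots> \<le> norm (f t) * norm (g t - g s) + norm (f t - f s) * norm (g s)"
      by (rule order_trans[OF norm_triangle_ineq]) (simp add: norm_mult)
    also have "\<dots> \<le> max M N * norm (g t - g s) + norm (f t - f s) * max M N"
      by (intro add_mono mult_mono order_refl norm_ge_zero MN MN0)
    finally show "norm (f t * g t - f s * g s) \<le> max M N * (norm (f t - f s) + norm (g t - g s))"
      by (simp add: algebra_simps)
  qed
qed

lemma AC_loc_const [simp]: "(\<lambda>x. c) \<in> AC_loc"
  by (auto simp: AC_loc_def AC_on_def case_prod_unfold intro: exI[of _ "1::real"])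

lemma AC_loc_cnj: "f \<in> AC_loc \<Longrightarrow> (\<lambda>x. cnj (f x)) \<in> AC_loc"
  by (simp add: AC_loc_def AC_on_bounded_linear bounded_linear_cnj)

lemma AC_loc_exp: "(\<lambda>x. exp (c * of_real x)) \<in> AC_loc"
  unfolding AC_loc_def
proof (intro CollectI allI impI)
  fix a b :: real assume ab: "a \<le> b"
  define e where "e = (\<lambda>x::real. exp (c * of_real x))"
  have deriv: "(e has_vector_derivative c * e x) (at x within A)" for x A
    unfolding e_def
    by (rule has_vector_derivative_real_field) (auto intro!: derivative_eq_intros)
  have "bounded ((\<lambda>x. c * e x) ` {a..b})"
    unfolding e_def by (intro compact_imp_bounded compact_continuous_image continuous_intros) auto
  then obtain B where "\<forall>y\<in>(\<lambda>x. c * e x) ` {a..b}. norm y \<le> B" unfolding bounded_iff by blast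
  then have B: "norm (c * e x) \<le> B" if "x \<in> {a..b}" for x using that by blast
  show "AC_on a b (\<lambda>x. exp (c * of_real x))"
  proof (rule AC_on_dominated1[OF AC_on_ident, of _ _ _ B])
    fix s t assume st: "a \<le> s" "s \<le> t" "t \<le> b"
    have "norm (e t - e s) \<le> B * norm (t - s)"
    proof (rule differentiable_bound[of "{a..b}" e "\<lambda>x h. h *\<^sub>R (c * e x)"])
      show "(e has_derivative (\<lambda>h. h *\<^sub>R (c * e x))) (at x within {a..b})" for x
        using deriv unfolding has_vector_derivative_def .
      show "onorm (\<lambda>h. h *\<^sub>R (c * e x)) \<le> B" if "x \<in> {a..b}" for x
        using B[OF that] order_trans[OF norm_ge_zero B[OF that]]
        by (intro onorm_bound) (auto simp: mult.commute[of B] intro!: mult_left_mono)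
    qed (use st in auto)
    then show "norm (exp (c * of_real t) - exp (c * of_real s)) \<le> B * norm (t - s)" by (simp add: e_def)
  qed
qed

lemma nn_integral_lebesgue_translate:
  fixes f :: "real \<Rightarrow> ennreal"
  assumes [measurable]: "f \<in> borel_measurable borel"
  shows "(\<integral>\<^sup>+x. f (x + c) \<partial>lebesgue) = (\<integral>\<^sup>+x. f x \<partial>lebesgue)"
  using nn_integral_real_affine[of f 1 c] by (simp add: nn_integral_completion add.commute)

text \<open>The increments \<open>W (x + n) - W (x - n)\<close> converge to the integral \<open>J\<close> of \<open>W'\<close>, for every \<open>x\<close>.  Their \<open>L\<^sup>1\<close> norms as
  functions of \<open>x\<close> are at most twice the norm of \<open>W\<close>, so by Fatou's lemma the constant \<open>J\<close> is integrable over the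
  whole line, which is possible only for \<open>J = 0\<close>.\<close>

lemma integral_derivative_eq_0:
  fixes W W' :: "real \<Rightarrow> complex"
  assumes ac: "W \<in> AC_loc" and W: "integrable lebesgue W" and W': "integrable lebesgue W'"
    and deriv: "AE x in lebesgue. (W has_vector_derivative W' x) (at x)"
  shows "(LINT x|lebesgue. W' x) = 0"
proof (rule ccontr)
  define J where "J = (LINT x|lebesgue. W' x)"
  assume "(LINT x|lebesgue. W' x) \<noteq> 0"
  then have J: "norm J > 0" by (simp add: J_def)
  have [measurable]: "W \<in> borel_measurable borel"
    by (intro borel_measurable_continuous_onI AC_loc_continuous ac)
  have lim: "(\<lambda>n. W (x + real n) - W (x + - real n)) \<longlonglongrightarrow> J" for x
  proof -
    have "W (x + real n) - W (x + - real n) = (LINT y|lebesgue. indicator {x + - real n<..x + real n} y *\<^sub>R W' y)" for n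
      using AC_loc_integral_derivative[OF ac deriv integrable_imp_locally_integrable[OF W'], of "x + - real n" "x + real n"]
      by (simp add: set_lebesgue_integral_def)
    moreover have "(\<lambda>n. LINT y|lebesgue. indicator {x + - real n<..x + real n} y *\<^sub>R W' y) \<longlonglongrightarrow> (LINT y|lebesgue. W' y)"
    proof (rule integral_dominated_convergence[where w = "\<lambda>y. norm (W' y)"])
      show "AE y in lebesgue. (\<lambda>n. indicator {x + - real n<..x + real n} y *\<^sub>R W' y) \<longlonglongrightarrow> W' y"
      proof (rule AE_I2)
        fix y
        obtain N :: nat where N: "\<bar>y - x\<bar> < real N" using reals_Archimedean2 by blast
        have "\<forall>\<^sub>F n in sequentially. indicator {x + - real n<..x + real n} y *\<^sub>R W' y = W' y"
          unfolding eventually_sequentially using N by (intro exI[of _ N]) (auto simp: indicator_def)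
        then show "(\<lambda>n. indicator {x + - real n<..x + real n} y *\<^sub>R W' y) \<longlonglongrightarrow> W' y" by (rule tendsto_eventually)
      qed
      show "AE y in lebesgue. norm (indicator {x + - real n<..x + real n} y *\<^sub>R W' y) \<le> norm (W' y)" for n
        by (rule AE_I2) (auto simp: indicator_def)
    qed (use W' in \<open>auto intro!: borel_measurable_scaleR borel_measurable_indicator\<close>)
    ultimately show ?thesis unfolding J_def by simp
  qed
  have translate: "(\<integral>\<^sup>+x. ennreal (norm (W (x + c))) \<partial>lebesgue) = (\<integral>\<^sup>+x. ennreal (norm (W x)) \<partial>lebesgue)" for c
    by (rule nn_integral_lebesgue_translate) simp
  have "(\<integral>\<^sup>+x. ennreal (norm J) \<partial>(lebesgue :: real measure))
      = (\<integral>\<^sup>+x. liminf (\<lambda>n. ennreal (norm (W (x + real n) - W (x + - real n)))) \<partial>lebesgue)"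
    by (intro nn_integral_cong lim_imp_Liminf[symmetric] tendsto_ennrealI tendsto_norm lim) auto
  also have "\<dots> \<le> liminf (\<lambda>n. \<integral>\<^sup>+x. ennreal (norm (W (x + real n) - W (x + - real n))) \<partial>lebesgue)"
    by (intro nn_integral_liminf measurable_completion) simp
  also have "\<dots> \<le> liminf (\<lambda>n::nat. 2 * (\<integral>\<^sup>+x. ennreal (norm (W x)) \<partial>lebesgue))"
  proof (intro Liminf_mono always_eventually allI)
    fix n :: nat
    have "(\<integral>\<^sup>+x. ennreal (norm (W (x + real n) - W (x + - real n))) \<partial>lebesgue)
        \<le> (\<integral>\<^sup>+x. ennreal (norm (W (x + real n))) + ennreal (norm (W (x + - real n))) \<partial>lebesgue)"
      by (intro nn_integral_mono) (auto simp flip: ennreal_plus intro!: ennreal_leI norm_triangle_ineq4)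
    also have "\<dots> = (\<integral>\<^sup>+x. ennreal (norm (W (x + real n))) \<partial>lebesgue) + (\<integral>\<^sup>+x. ennreal (norm (W (x + - real n))) \<partial>lebesgue)"
      by (intro nn_integral_add measurable_completion) simp_all
    also have "\<dots> = 2 * (\<integral>\<^sup>+x. ennreal (norm (W x)) \<partial>lebesgue)"
      unfolding translate mult_2 ..
    finally show "(\<integral>\<^sup>+x. ennreal (norm (W (x + real n) - W (x + - real n))) \<partial>lebesgue)
        \<le> 2 * (\<integral>\<^sup>+x. ennreal (norm (W x)) \<partial>lebesgue)" .
  qed
  also have "\<dots> = 2 * (\<integral>\<^sup>+x. ennreal (norm (W x)) \<partial>lebesgue)" by (simp add: Liminf_const)
  also have "\<dots> < \<infinity>" using W by (simp add: integrable_iff_bounded ennreal_mult_less_top)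
  finally show False using J by (simp add: ennreal_top_mult emeasure_lborel_UNIV)
qed

section \<open>Square-integrable functions\<close>

abbreviation L2_sq :: "(real \<Rightarrow> 'a::{real_normed_vector, second_countable_topology}) \<Rightarrow> real" where
  "L2_sq f \<equiv> (LINT x|lebesgue. (norm (f x))\<^sup>2)"

lemma L2_measurable: "f \<in> L2 \<Longrightarrow> f \<in> borel_measurable lebesgue"
  and L2_integrable: "f \<in> L2 \<Longrightarrow> integrable lebesgue (\<lambda>x. (norm (f x))\<^sup>2)"
  by (auto simp: L2_def)

lemma L2I_dominated:
  assumes "f \<in> borel_measurable lebesgue" "integrable lebesgue w" "AE x in lebesgue. (norm (f x))\<^sup>2 \<le> w x"
  shows "f \<in> L2" "L2_sq f \<le> (LINT x|lebesgue. w x)"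
proof -
  have int: "integrable lebesgue (\<lambda>x. (norm (f x))\<^sup>2)"
    by (rule Bochner_Integration.integrable_bound[OF assms(2)]) (use assms in \<open>auto elim!: eventually_mono\<close>)
  then show "f \<in> L2" using assms(1) by (simp add: L2_def)
  show "L2_sq f \<le> (LINT x|lebesgue. w x)"
    by (rule integral_mono_AE[OF int assms(2,3)])
qed

lemma norm_add_sq_le: "(norm (a + b))\<^sup>2 \<le> 2 * (norm a)\<^sup>2 + 2 * (norm (b::'a::real_normed_vector))\<^sup>2"
proof -
  have "(norm (a + b))\<^sup>2 \<le> (norm a + norm b)\<^sup>2" by (intro power_mono norm_triangle_ineq norm_ge_zero)
  also have "\<dots> \<le> 2 * (norm a)\<^sup>2 + 2 * (norm b)\<^sup>2"
    using sum_squares_bound[of "norm a" "norm b"] by (simp add: power2_sum)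
  finally show ?thesis .
qed

lemma norm_diff_sq_le: "(norm (a - b))\<^sup>2 \<le> 2 * (norm a)\<^sup>2 + 2 * (norm (b::'a::real_normed_vector))\<^sup>2"
  using norm_add_sq_le[of a "- b"] by simp

lemma L2_add: assumes "f \<in> L2" "g \<in> L2" shows "(\<lambda>x. f x + g x) \<in> L2"
proof (rule L2I_dominated(1))
  show "integrable lebesgue (\<lambda>x. 2 * (norm (f x))\<^sup>2 + 2 * (norm (g x))\<^sup>2)"
    using assms by (intro Bochner_Integration.integrable_add integrable_mult_right L2_integrable)
qed (use assms in \<open>auto simp: norm_add_sq_le intro!: borel_measurable_add dest: L2_measurable\<close>)

lemma L2_diff: "f \<in> L2 \<Longrightarrow> g \<in> L2 \<Longrightarrow> (\<lambda>x. f x - g x) \<in> L2"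
  using L2_add[of f "\<lambda>x. - g x"] by (simp add: L2_def)

lemma L2_bounded_mult:
  fixes f k :: "real \<Rightarrow> complex"
  assumes "f \<in> L2" "k \<in> borel_measurable lebesgue" "AE x in lebesgue. norm (k x) \<le> M"
  shows "(\<lambda>x. k x * f x) \<in> L2"
proof (rule L2I_dominated(1))
  show "integrable lebesgue (\<lambda>x. M\<^sup>2 * (norm (f x))\<^sup>2)"
    using assms by (intro integrable_mult_right L2_integrable)
  show "AE x in lebesgue. (norm (k x * f x))\<^sup>2 \<le> M\<^sup>2 * (norm (f x))\<^sup>2"
    using assms(3) by eventually_elim (auto simp: norm_mult power_mult_distrib intro!: mult_right_mono power_mono)
qed (use assms in \<open>auto intro!: borel_measurable_times dest: L2_measurable\<close>)

lemma L2_scale: "f \<in> L2 \<Longrightarrow> (\<lambda>x. (c::complex) * f x) \<in> L2"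
  by (rule L2_bounded_mult[where M = "norm c"]) auto

lemma L2_AE_cong:
  fixes f g :: "real \<Rightarrow> 'a::euclidean_space"
  assumes "f \<in> L2" "AE x in lebesgue. f x = g x"
  shows "g \<in> L2"
proof (rule L2I_dominated(1)[OF _ L2_integrable[OF assms(1)]])
  show "g \<in> borel_measurable lebesgue"
    by (rule borel_measurable_AE[OF L2_measurable[OF assms(1)] assms(2)])
  show "AE x in lebesgue. (norm (g x))\<^sup>2 \<le> (norm (f x))\<^sup>2" using assms(2) by eventually_elim simp
qed

lemma L2_mult_integrable:
  fixes f g :: "real \<Rightarrow> complex"
  assumes "f \<in> L2" "g \<in> L2"
  shows "integrable lebesgue (\<lambda>x. f x * g x)"
proof (rule Bochner_Integration.integrable_bound)
  show "integrable lebesgue (\<lambda>x. (norm (f x))\<^sup>2 + (norm (g x))\<^sup>2)"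
    using assms by (intro Bochner_Integration.integrable_add L2_integrable)
  show "AE x in lebesgue. norm (f x * g x) \<le> norm ((norm (f x))\<^sup>2 + (norm (g x))\<^sup>2)"
  proof (rule AE_I2)
    fix x
    have "norm (f x) * norm (g x) \<le> (norm (f x))\<^sup>2 + (norm (g x))\<^sup>2"
      using sum_squares_bound[of "norm (f x)" "norm (g x)"] mult_nonneg_nonneg[OF norm_ge_zero[of "f x"] norm_ge_zero[of "g x"]]
      by linarith
    then show "norm (f x * g x) \<le> norm ((norm (f x))\<^sup>2 + (norm (g x))\<^sup>2)" by (simp add: norm_mult)
  qed
qed (use assms in \<open>auto intro!: borel_measurable_times dest: L2_measurable\<close>)

lemma L2_cnj: "f \<in> L2 \<Longrightarrow> (\<lambda>x. cnj (f x)) \<in> L2"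
  by (auto simp: L2_def intro: borel_measurable_continuous_on[of cnj] continuous_intros)

lemma L2_locally_integrable:
  fixes f :: "real \<Rightarrow> 'a::{banach, second_countable_topology}"
  assumes "f \<in> L2"
  shows "locally_integrable f"
  unfolding locally_integrable_def set_integrable_def
proof (intro allI, rule Bochner_Integration.integrable_bound)
  fix a b :: real
  have "integrable lebesgue (indicat_real {a..b})"
    using lmeasurable_cbox[of a b] by (intro integrable_real_indicator) (auto simp: fmeasurable_def)
  then show "integrable lebesgue (\<lambda>x. indicat_real {a..b} x + (norm (f x))\<^sup>2)"
    using assms by (intro Bochner_Integration.integrable_add L2_integrable)
  have "t \<le> 1 + t\<^sup>2" if "t \<ge> 0" for t :: real
    using sum_squares_bound[of t 1] that by simp
  then show "AE x in lebesgue. norm (indicator {a..b} x *\<^sub>R f x) \<le> norm (indicat_real {a..b} x + (norm (f x))\<^sup>2)"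
    by (intro AE_I2) (auto simp: indicator_def)
qed (use assms in \<open>auto intro!: borel_measurable_scaleR borel_measurable_indicator dest: L2_measurable\<close>)

text \<open>Banach's fixed point theorem, which includes the completeness of \<open>L\<^sup>2\<close>: the iterates converge pointwise almost
  everywhere, because their differences decrease geometrically in norm.  The rate \<open>1 / 16\<close> for squared norms
  leaves room for the weights \<open>4 ^ n\<close> that make the pointwise majorant geometric as well.\<close>

lemma L2_contraction_fixed_point:
  fixes T :: "(real \<Rightarrow> 'a::{banach, second_countable_topology}) \<Rightarrow> (real \<Rightarrow> 'a)"
  assumes maps: "\<And>f. f \<in> L2 \<Longrightarrow> T f \<in> L2"
    and contr: "\<And>f g. f \<in> L2 \<Longrightarrow> g \<in> L2 \<Longrightarrow>
      L2_sq (\<lambda>x. T f x - T g x) \<le> L2_sq (\<lambda>x. f x - g x) / 16"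
  shows "\<exists>f\<in>L2. AE x in lebesgue. T f x = f x"
proof -
  define F where "F n = (T ^^ n) (\<lambda>x. 0)" for n
  have F0: "F 0 = (\<lambda>x. 0)" and FS: "F (Suc n) = T (F n)" for n by (simp_all add: F_def)
  have FL2: "F n \<in> L2" for n
  proof (induction n)
    case 0 then show ?case by (simp add: F0 L2_def)
  next
    case (Suc n) then show ?case by (simp add: FS maps)
  qed
  define d where "d n x = F (Suc n) x - F n x" for n x
  have dL2: "d n \<in> L2" for n unfolding d_def by (intro L2_diff FL2)
  define C where "C = L2_sq (d 0)"
  have dC: "L2_sq (d n) \<le> C / 16 ^ n" for n
  proof (induction n)
    case (Suc n)
    have "L2_sq (\<lambda>x. d (Suc n) x) \<le> L2_sq (d n) / 16"
      using contr[OF FL2[of "Suc n"] FL2[of n]] unfolding d_def by (simp add: FS)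
    also have "\<dots> \<le> C / 16 ^ n / 16" using Suc by (intro divide_right_mono) auto
    finally show ?case by simp
  qed (simp add: C_def)
  \<comment> \<open>The weighted sum of these functions is integrable, and bounds \<open>norm (d n x)\<close> by a multiple of \<open>2 ^ (- n)\<close>.\<close>
  define w where "w n x = 4 ^ n * (norm (d n x))\<^sup>2" for n x
  have wint: "integrable lebesgue (w n)" for n unfolding w_def using dL2 by (intro integrable_mult_right L2_integrable)
  have wC: "(LINT x|lebesgue. norm (w n x)) \<le> C * (1 / 4) ^ n" for n
  proof -
    have "(LINT x|lebesgue. norm (w n x)) = 4 ^ n * L2_sq (d n)" by (simp add: w_def)
    also have "\<dots> \<le> 4 ^ n * (C / 16 ^ n)" using dC by (intro mult_left_mono) auto
    also have "\<dots> = C * (4 / 16) ^ n" unfolding power_divide by simp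
    also have "\<dots> = C * (1 / 4) ^ n" by simp
    finally show ?thesis .
  qed
  have sumC: "summable (\<lambda>n. C * (1 / 4 :: real) ^ n)" by (intro summable_mult summable_geometric) auto
  have wsum: "summable (\<lambda>n. LINT x|lebesgue. norm (w n x))"
    by (rule summable_comparison_test'[OF sumC, of 0]) (use wC in \<open>simp add: w_def\<close>)
  have "(\<integral>\<^sup>+x. (\<Sum>n. ennreal (norm (w n x))) \<partial>lebesgue) = (\<Sum>n. \<integral>\<^sup>+x. ennreal (norm (w n x)) \<partial>lebesgue)"
    using wint by (intro nn_integral_suminf) auto
  also have "\<dots> = (\<Sum>n. ennreal (LINT x|lebesgue. norm (w n x)))"
    using wint by (intro suminf_cong nn_integral_eq_integral) auto
  also have "\<dots> = ennreal (\<Sum>n. LINT x|lebesgue. norm (w n x))"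
    using wsum by (intro suminf_ennreal2) auto
  also have "\<dots> \<noteq> \<infinity>" by simp
  finally have "AE x in lebesgue. (\<Sum>n. ennreal (norm (w n x))) \<noteq> \<infinity>"
    using wint by (intro nn_integral_PInf_AE borel_measurable_suminf) auto
  then have AEs: "AE x in lebesgue. summable (\<lambda>n. norm (w n x))"
    by eventually_elim (rule summable_suminf_not_top, auto)
  have half_sq: "((1 / 2) ^ n)\<^sup>2 = 1 / (4 :: real) ^ n" for n
    by (simp add: power2_eq_square power_divide flip: power_mult_distrib)
  define S where "S x = (\<Sum>n. w n x)" for x
  have Sint: "integrable lebesgue S" unfolding S_def by (rule integrable_suminf[OF wint AEs wsum])
  define f where "f x = lim (\<lambda>n. F n x)" for x
  have fmeas: "f \<in> borel_measurable lebesgue"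
    unfolding f_def using L2_measurable[OF FL2] by (rule borel_measurable_lim_metric)
  have close: "AE x in lebesgue. (norm (f x - F n x))\<^sup>2 \<le> 4 / 4 ^ n * S x" for n
    using AEs
  proof eventually_elim
    case (elim x)
    have w0: "w n x \<ge> 0" for n by (simp add: w_def)
    have sw: "summable (\<lambda>n. w n x)" using elim w0 by simp
    have Sx: "w n x \<le> S x" for n
      using sum_le_suminf[OF sw, of "{n}"] w0 by (simp add: S_def)
    have S0: "S x \<ge> 0" using Sx[of 0] w0[of 0] by linarith
    have dle: "norm (d n x) \<le> sqrt (S x) * (1 / 2) ^ n" for n
    proof -
      have "(norm (d n x))\<^sup>2 \<le> S x / 4 ^ n" using Sx[of n] by (simp add: w_def field_simps)
      also have "\<dots> = (sqrt (S x) * (1 / 2) ^ n)\<^sup>2"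
        using S0 by (simp add: power_mult_distrib half_sq)
      finally show ?thesis by (rule power2_le_imp_le) (use S0 in simp)
    qed
    have geo: "(\<lambda>k. sqrt (S x) * (1 / 2) ^ (k + n)) sums (sqrt (S x) * (1 / 2) ^ n * 2)"
      using sums_mult[OF geometric_sums[of "1 / 2 :: real"], of "sqrt (S x) * (1 / 2) ^ n"] by (simp add: power_add mult_ac)
    have sd: "summable (\<lambda>k. norm (d (k + n) x))"
      by (rule summable_comparison_test'[OF sums_summable[OF geo], of 0]) (use dle in auto)
    have tele: "(\<Sum>k<m. d (k + n) x) = F (m + n) x - F n x" for m
      by (induction m) (auto simp: d_def)
    have "(\<lambda>m. F (m + n) x - F n x) \<longlonglongrightarrow> (\<Sum>k. d (k + n) x)"
      using summable_LIMSEQ[OF summable_norm_cancel[OF sd]] unfolding tele .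
    then have "(\<lambda>m. F (m + n) x - F n x + F n x) \<longlonglongrightarrow> (\<Sum>k. d (k + n) x) + F n x"
      by (intro tendsto_intros)
    then have "(\<lambda>m. F m x) \<longlonglongrightarrow> (\<Sum>k. d (k + n) x) + F n x"
      by (simp add: LIMSEQ_offset[of _ n])
    then have "f x = (\<Sum>k. d (k + n) x) + F n x" unfolding f_def by (rule limI)
    then have "norm (f x - F n x) = norm (\<Sum>k. d (k + n) x)" by simp
    also have "\<dots> \<le> (\<Sum>k. norm (d (k + n) x))" by (rule summable_norm[OF sd])
    also have "\<dots> \<le> sqrt (S x) * (1 / 2) ^ n * 2"
      using suminf_le[OF _ sd sums_summable[OF geo]] dle sums_unique[OF geo] by simp
    finally have "(norm (f x - F n x))\<^sup>2 \<le> (sqrt (S x) * (1 / 2) ^ n * 2)\<^sup>2" by (intro power_mono) auto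
    also have "\<dots> = 4 / 4 ^ n * S x"
      using S0 by (simp add: power_mult_distrib half_sq)
    finally show ?case .
  qed
  have mint: "integrable lebesgue (\<lambda>x. 4 / 4 ^ n * S x)" for n :: nat using Sint by (intro integrable_mult_right)
  have fF: "(\<lambda>x. f x - F n x) \<in> L2" "L2_sq (\<lambda>x. f x - F n x) \<le> 4 / 4 ^ n * (LINT x|lebesgue. S x)" for n
    using L2I_dominated[OF _ mint close] fmeas L2_measurable[OF FL2] by auto
  have fL2: "f \<in> L2" using fF(1)[of 0] by (simp add: F0)
  define e where "e n = 4 / 4 ^ n * (LINT x|lebesgue. S x)" for n :: nat
  have elim: "e \<longlonglongrightarrow> 0"
  proof -
    have "(\<lambda>n. 4 * (LINT x|lebesgue. S x) * (1 / 4) ^ n) \<longlonglongrightarrow> 4 * (LINT x|lebesgue. S x) * 0"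
      by (intro tendsto_mult_left LIMSEQ_realpow_zero) auto
    then show ?thesis unfolding e_def by (simp add: power_divide mult_ac)
  qed
  have "L2_sq (\<lambda>x. T f x - f x) \<le> 2 * (e n / 16) + 2 * e (Suc n)" for n
  proof -
    have i1: "integrable lebesgue (\<lambda>x. (norm (T f x - T (F n) x))\<^sup>2)"
      by (intro L2_integrable L2_diff maps fL2 FL2)
    have i2: "integrable lebesgue (\<lambda>x. (norm (f x - F (Suc n) x))\<^sup>2)"
      by (intro L2_integrable fF)
    have "L2_sq (\<lambda>x. T f x - f x)
        \<le> (LINT x|lebesgue. 2 * (norm (T f x - T (F n) x))\<^sup>2 + 2 * (norm (f x - F (Suc n) x))\<^sup>2)"
    proof (rule integral_mono)
      show "integrable lebesgue (\<lambda>x. (norm (T f x - f x))\<^sup>2)" by (intro L2_integrable L2_diff maps fL2)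
      show "(norm (T f x - f x))\<^sup>2 \<le> 2 * (norm (T f x - T (F n) x))\<^sup>2 + 2 * (norm (f x - F (Suc n) x))\<^sup>2" for x
        using norm_diff_sq_le[of "T f x - T (F n) x" "f x - F (Suc n) x"] by (simp add: FS)
    qed (use i1 i2 in auto)
    also have "\<dots> = 2 * L2_sq (\<lambda>x. T f x - T (F n) x) + 2 * L2_sq (\<lambda>x. f x - F (Suc n) x)"
      using i1 i2 by simp
    also have "\<dots> \<le> 2 * (e n / 16) + 2 * e (Suc n)"
      using contr[OF fL2 FL2[of n]] fF(2)[of n, folded e_def] fF(2)[of "Suc n", folded e_def] by linarith
    finally show ?thesis .
  qed
  moreover have "(\<lambda>n. 2 * (e n / 16) + 2 * e (Suc n)) \<longlonglongrightarrow> 2 * (0 / 16) + 2 * 0"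
    by (intro tendsto_intros elim LIMSEQ_Suc) auto
  ultimately have "L2_sq (\<lambda>x. T f x - f x) \<le> 0"
    by (intro LIMSEQ_le_const[of "\<lambda>n. 2 * (e n / 16) + 2 * e (Suc n)"]) auto
  moreover have "L2_sq (\<lambda>x. T f x - f x) \<ge> 0" by simp
  ultimately have "L2_sq (\<lambda>x. T f x - f x) = 0" by linarith
  then have "AE x in lebesgue. (norm (T f x - f x))\<^sup>2 = 0"
    by (subst (asm) integral_nonneg_eq_0_iff_AE) (auto intro!: L2_integrable L2_diff maps fL2)
  then show ?thesis using fL2 by (intro bexI[of _ f]) auto
qed

section \<open>The energy estimate\<close>

lemma weighted_AM_GM:
  fixes a c x y :: real
  assumes "c > 0"
  shows "2 * a * x * y \<le> c / 4 * y\<^sup>2 + 4 * a\<^sup>2 / c * x\<^sup>2"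
proof -
  have "0 \<le> (c * y - 4 * a * x)\<^sup>2 / (4 * c)" using assms by simp
  also have "\<dots> = c / 4 * y\<^sup>2 + 4 * a\<^sup>2 / c * x\<^sup>2 - 2 * a * x * y"
    using assms by (simp add: power2_eq_square field_simps)
  finally show ?thesis by simp
qed

text \<open>The left-hand side is the pairing of \<open>(\<DD> - z) \<Psi>\<close> with \<open>(\<DD>\<^sup>* + cnj z) \<Psi>\<close> at a point, for \<open>\<Psi> = (u, v)\<close>.  The first
  two terms on the right are those of the quadratic form of \<open>\<DD>\<^sup>2 - z\<^sup>2\<close>, the third is the derivative of
  \<open>i h z (\<bar>u\<bar>\<^sup>2 - \<bar>v\<bar>\<^sup>2) - h p u cnj v - h q v cnj u\<close>, and the last comes from \<open>i h \<sigma>\<^sub>3 Q'\<close>.\<close>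

lemma dirac_pointwise_identity:
  fixes u v u' v' p q p' q' z :: complex and h :: real
  shows "(\<i> * h * u' - \<i> * q * v - z * u) * (- (\<i> * h * cnj u') + \<i> * p * cnj v + z * cnj u)
     + (- (\<i> * h * v') + \<i> * p * u - z * v) * (\<i> * h * cnj v' - \<i> * q * cnj u + z * cnj v)
   = h\<^sup>2 * (u' * cnj u' + v' * cnj v') + (p * q - z\<^sup>2) * (u * cnj u + v * cnj v)
     + (\<i> * h * z * ((u' * cnj u + u * cnj u') - (v' * cnj v + v * cnj v'))
        - h * (p' * (u * cnj v) + p * (u' * cnj v + u * cnj v'))
        - h * (q' * (v * cnj u) + q * (v' * cnj u + v * cnj u')))
     + h * (p' * (u * cnj v) + q' * (v * cnj u))"
  by (simp add: algebra_simps power2_eq_square)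

text \<open>The imaginary part of the identity, multiplied by the sign of \<open>Im z\<^sup>2\<close>.  The factors \<open>g\<^sub>1, g\<^sub>2\<close> belonging to the
  adjoint are traded for \<open>f\<^sub>1, f\<^sub>2\<close> plus multiples of \<open>u\<close> and \<open>v\<close>, and the resulting mixed terms are absorbed into
  half of the gap \<open>c\<close>.\<close>

lemma dirac_pointwise_estimate:
  fixes u v u' v' p q p' q' z :: complex and h c P Q b M :: real
  assumes h: "h > 0" and c: "c > 0" and p': "cmod p' \<le> P" and q': "cmod q' \<le> Q"
    and b: "\<bar>Im (p * q)\<bar> \<le> b" and p: "cmod p \<le> M" and q: "cmod q \<le> M"
    and gap: "h / 2 * (P + Q) + b + c \<le> \<bar>Im (z\<^sup>2)\<bar>"
    and f1: "f1 = \<i> * h * u' - \<i> * q * v - z * u" and f2: "f2 = - (\<i> * h * v') + \<i> * p * u - z * v"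
    and W': "W' = \<i> * h * z * ((u' * cnj u + u * cnj u') - (v' * cnj v + v * cnj v'))
        - h * (p' * (u * cnj v) + p * (u' * cnj v + u * cnj v'))
        - h * (q' * (v * cnj u) + q * (v' * cnj u + v * cnj u'))"
  shows "c / 2 * ((cmod u)\<^sup>2 + (cmod v)\<^sup>2)
    \<le> (1 + 4 * M\<^sup>2 / c + 4 * (cmod z)\<^sup>2 / c) * ((cmod f1)\<^sup>2 + (cmod f2)\<^sup>2) + sgn (Im (z\<^sup>2)) * Im W'"
proof -
  define s where "s = sgn (Im (z\<^sup>2))"
  define N where "N = (cmod u)\<^sup>2 + (cmod v)\<^sup>2"
  define g1 where "g1 = - (\<i> * h * cnj u') + \<i> * p * cnj v + z * cnj u"
  define g2 where "g2 = \<i> * h * cnj v' - \<i> * q * cnj u + z * cnj v"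
  have s: "\<bar>s\<bar> \<le> 1" by (simp add: s_def sgn_if)
  have N: "of_real N = u * cnj u + v * cnj v" unfolding N_def by (simp only: of_real_add complex_norm_square)
  have N0: "N \<ge> 0" by (simp add: N_def)
  have uv: "cmod u * cmod v \<le> N / 2"
    using sum_squares_bound[of "cmod u" "cmod v"] by (simp add: N_def)
  have "f1 * g1 + f2 * g2 = of_real (h\<^sup>2 * ((cmod u')\<^sup>2 + (cmod v')\<^sup>2)) + (p * q - z\<^sup>2) * of_real N + W'
      + h * (p' * (u * cnj v) + q' * (v * cnj u))"
    unfolding f1 f2 g1_def g2_def N W' dirac_pointwise_identity[of h u' q v z u p v' p' q']
    by (simp only: of_real_add of_real_mult complex_norm_square)
  then have im_eq: "Im (f1 * g1 + f2 * g2) = (Im (p * q) - Im (z\<^sup>2)) * N + Im W' + h * Im (p' * (u * cnj v) + q' * (v * cnj u))"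
    by simp
  have imag: "s * Im (z\<^sup>2) * N = s * Im (p * q) * N + s * Im W' + h * (s * Im (p' * (u * cnj v) + q' * (v * cnj u)))
      + (- s) * Im (f1 * g1 + f2 * g2)"
  proof -
    have "s * I * N = s * J * N + s * w + h * (s * D) + (- s) * A" if "A = (J - I) * N + w + h * D" for A D I J w :: real
      unfolding that by (simp add: algebra_simps)
    then show ?thesis using im_eq by blast
  qed
  have "s * Im (z\<^sup>2) = \<bar>Im (z\<^sup>2)\<bar>" by (simp add: s_def abs_sgn mult.commute)
  note imag[unfolded this]
  moreover have le: "t * Im x \<le> cmod x" if "\<bar>t\<bar> \<le> 1" for t x
  proof -
    have "t * Im x \<le> \<bar>t\<bar> * \<bar>Im x\<bar>" by (metis abs_ge_self abs_mult)
    also have "\<dots> \<le> 1 * cmod x" using that by (intro mult_mono abs_Im_le_cmod) auto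
    finally show ?thesis by simp
  qed
  moreover have "s * Im (p * q) * N \<le> b * N"
  proof (rule mult_right_mono[OF _ N0])
    have "s * Im (p * q) \<le> \<bar>s\<bar> * \<bar>Im (p * q)\<bar>" by (metis abs_ge_self abs_mult)
    also have "\<dots> \<le> 1 * b" using s b by (intro mult_mono) auto
    finally show "s * Im (p * q) \<le> b" by simp
  qed
  moreover have "h * (s * Im (p' * (u * cnj v) + q' * (v * cnj u))) \<le> h * ((P + Q) * (N / 2))"
  proof (rule mult_left_mono)
    have "s * Im (p' * (u * cnj v) + q' * (v * cnj u)) \<le> cmod (p' * (u * cnj v) + q' * (v * cnj u))" by (rule le[OF s])
    also have "\<dots> \<le> cmod p' * (cmod u * cmod v) + cmod q' * (cmod u * cmod v)"
      by (rule order_trans[OF norm_triangle_ineq]) (simp add: norm_mult mult_ac)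
    also have "\<dots> = (cmod p' + cmod q') * (cmod u * cmod v)" by (simp add: algebra_simps)
    also have "\<dots> \<le> (P + Q) * (N / 2)"
      using uv p' q' order_trans[OF norm_ge_zero p'] order_trans[OF norm_ge_zero q'] by (intro mult_mono add_mono) auto
    finally show "s * Im (p' * (u * cnj v) + q' * (v * cnj u)) \<le> (P + Q) * (N / 2)" .
  qed (use h in simp)
  moreover have "(- s) * Im (f1 * g1 + f2 * g2) \<le> cmod f1 * cmod g1 + cmod f2 * cmod g2"
  proof -
    have "(- s) * Im (f1 * g1 + f2 * g2) \<le> cmod (f1 * g1 + f2 * g2)" using s by (intro le) simp
    also have "\<dots> \<le> cmod f1 * cmod g1 + cmod f2 * cmod g2"
      by (rule order_trans[OF norm_triangle_ineq]) (simp add: norm_mult)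
    finally show ?thesis .
  qed
  ultimately have main: "\<bar>Im (z\<^sup>2)\<bar> * N \<le> b * N + s * Im W' + h * ((P + Q) * (N / 2)) + (cmod f1 * cmod g1 + cmod f2 * cmod g2)"
    by linarith
  have "(h / 2 * (P + Q) + b + c) * N \<le> \<bar>Im (z\<^sup>2)\<bar> * N" using gap N0 by (rule mult_right_mono)
  then have cN: "c * N \<le> s * Im W' + (cmod f1 * cmod g1 + cmod f2 * cmod g2)" using main by (simp add: algebra_simps)
  have bound: "cmod (x + \<i> * a * y + w * t) \<le> cmod x + 2 * M * cmod y + 2 * cmod z * cmod t"
    if "cmod a \<le> 2 * M" "cmod w \<le> 2 * cmod z" for x a y w t
  proof -
    have "cmod (x + \<i> * a * y + w * t) \<le> cmod x + cmod (\<i> * a * y) + cmod (w * t)"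
      by (intro order_trans[OF norm_triangle_ineq] add_mono norm_triangle_ineq order_refl)
    also have "\<dots> \<le> cmod x + 2 * M * cmod y + 2 * cmod z * cmod t"
      using that by (simp add: norm_mult add_mono mult_right_mono)
    finally show ?thesis .
  qed
  \<comment> \<open>The conjugates of \<open>f\<^sub>1\<close> and \<open>f\<^sub>2\<close> have the same derivative terms as \<open>g\<^sub>1\<close> and \<open>g\<^sub>2\<close>, so that the
      differences are bounded by multiples of \<open>u\<close> and \<open>v\<close>.\<close>
  have zz: "cmod (z + cnj z) \<le> 2 * cmod z" using norm_triangle_ineq[of z "cnj z"] by simp
  have "cmod g1 \<le> cmod (cnj f1) + 2 * M * cmod (cnj v) + 2 * cmod z * cmod (cnj u)"
  proof -
    have "g1 = cnj f1 + \<i> * (p - cnj q) * cnj v + (z + cnj z) * cnj u"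
      unfolding g1_def f1 by (simp add: algebra_simps)
    moreover have "cmod (p - cnj q) \<le> 2 * M" using norm_triangle_ineq4[of p "cnj q"] p q by simp
    ultimately show ?thesis using bound[OF _ zz] by metis
  qed
  then have g1: "cmod g1 \<le> cmod f1 + 2 * M * cmod v + 2 * cmod z * cmod u" by simp
  have "cmod g2 \<le> cmod (cnj f2) + 2 * M * cmod (cnj u) + 2 * cmod z * cmod (cnj v)"
  proof -
    have "g2 = cnj f2 + \<i> * (cnj p - q) * cnj u + (z + cnj z) * cnj v"
      unfolding g2_def f2 by (simp add: algebra_simps)
    moreover have "cmod (cnj p - q) \<le> 2 * M" using norm_triangle_ineq4[of "cnj p" q] p q by simp
    ultimately show ?thesis using bound[OF _ zz] by metis
  qed
  then have g2: "cmod g2 \<le> cmod f2 + 2 * M * cmod u + 2 * cmod z * cmod v" by simp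
  have "cmod f1 * cmod g1 + cmod f2 * cmod g2
      \<le> cmod f1 * (cmod f1 + 2 * M * cmod v + 2 * cmod z * cmod u) + cmod f2 * (cmod f2 + 2 * M * cmod u + 2 * cmod z * cmod v)"
    using g1 g2 by (intro add_mono mult_left_mono) auto
  also have "\<dots> = (cmod f1)\<^sup>2 + (cmod f2)\<^sup>2 + (2 * M * cmod f1 * cmod v + 2 * cmod z * cmod f1 * cmod u
      + 2 * M * cmod f2 * cmod u + 2 * cmod z * cmod f2 * cmod v)"
    by (simp add: algebra_simps power2_eq_square)
  also have "\<dots> \<le> (cmod f1)\<^sup>2 + (cmod f2)\<^sup>2
      + ((c / 4 * (cmod v)\<^sup>2 + 4 * M\<^sup>2 / c * (cmod f1)\<^sup>2) + (c / 4 * (cmod u)\<^sup>2 + 4 * (cmod z)\<^sup>2 / c * (cmod f1)\<^sup>2)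
      + (c / 4 * (cmod u)\<^sup>2 + 4 * M\<^sup>2 / c * (cmod f2)\<^sup>2) + (c / 4 * (cmod v)\<^sup>2 + 4 * (cmod z)\<^sup>2 / c * (cmod f2)\<^sup>2))"
    by (intro add_mono order_refl weighted_AM_GM c)
  also have "\<dots> = c / 2 * N + (1 + 4 * M\<^sup>2 / c + 4 * (cmod z)\<^sup>2 / c) * ((cmod f1)\<^sup>2 + (cmod f2)\<^sup>2)"
    by (simp add: N_def algebra_simps add_divide_distrib)
  finally have "c * N \<le> s * Im W' + (c / 2 * N + (1 + 4 * M\<^sup>2 / c + 4 * (cmod z)\<^sup>2 / c) * ((cmod f1)\<^sup>2 + (cmod f2)\<^sup>2))"
    using cN by linarith
  moreover have "c * N = c / 2 * N + c / 2 * N" by (simp add: field_simps)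
  ultimately show ?thesis unfolding N_def[symmetric] s_def[symmetric] by linarith
qed

definition H1 :: "(real \<Rightarrow> complex) set" where
  "H1 = {u \<in> AC_loc. u \<in> L2 \<and> ac_deriv u \<in> L2}"

lemma dirac_a_priori_estimate:
  fixes p q u v f1 f2 :: "real \<Rightarrow> complex" and h c P Q b M :: real and z :: complex
  assumes h: "h > 0" and c: "c > 0" and pq: "p \<in> AC_loc" "q \<in> AC_loc"
    and meas: "ac_deriv p \<in> borel_measurable lebesgue" "ac_deriv q \<in> borel_measurable lebesgue"
    and p': "AE x in lebesgue. cmod (ac_deriv p x) \<le> P" and q': "AE x in lebesgue. cmod (ac_deriv q x) \<le> Q"
    and b: "AE x in lebesgue. \<bar>Im (p x * q x)\<bar> \<le> b" and M: "\<And>x. cmod (p x) \<le> M" "\<And>x. cmod (q x) \<le> M"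
    and gap: "h / 2 * (P + Q) + b + c \<le> \<bar>Im (z\<^sup>2)\<bar>"
    and u: "u \<in> H1" and v: "v \<in> H1" and f: "f1 \<in> L2" "f2 \<in> L2"
    and f1: "AE x in lebesgue. f1 x = \<i> * h * ac_deriv u x - \<i> * q x * v x - z * u x"
    and f2: "AE x in lebesgue. f2 x = - (\<i> * h * ac_deriv v x) + \<i> * p x * u x - z * v x"
  shows "c / 2 * (LINT x|lebesgue. (cmod (u x))\<^sup>2 + (cmod (v x))\<^sup>2)
    \<le> (1 + 4 * M\<^sup>2 / c + 4 * (cmod z)\<^sup>2 / c) * (LINT x|lebesgue. (cmod (f1 x))\<^sup>2 + (cmod (f2 x))\<^sup>2)"
proof -
  define u' v' p1 q1 where "u' = ac_deriv u" and "v' = ac_deriv v" and "p1 = ac_deriv p" and "q1 = ac_deriv q"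
  have uL: "u \<in> L2" "u' \<in> L2" "u \<in> AC_loc" and vL: "v \<in> L2" "v' \<in> L2" "v \<in> AC_loc"
    using u v by (auto simp: H1_def u'_def v'_def)
  define W where "W x = \<i> * h * z * (u x * cnj (u x) - v x * cnj (v x))
      - h * (p x * (u x * cnj (v x))) - h * (q x * (v x * cnj (u x)))" for x
  define W' where "W' x = \<i> * h * z * ((u' x * cnj (u x) + u x * cnj (u' x)) - (v' x * cnj (v x) + v x * cnj (v' x)))
        - h * (p1 x * (u x * cnj (v x)) + p x * (u' x * cnj (v x) + u x * cnj (v' x)))
        - h * (q1 x * (v x * cnj (u x)) + q x * (v' x * cnj (u x) + v x * cnj (u' x)))" for x
  have pL: "(\<lambda>x. p x * w x) \<in> L2" "(\<lambda>x. q x * w x) \<in> L2" if "w \<in> L2" for w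
    using that M by (auto intro!: L2_bounded_mult[where M = M] AC_loc_measurable pq)
  have p1L: "(\<lambda>x. p1 x * w x) \<in> L2" "(\<lambda>x. q1 x * w x) \<in> L2" if "w \<in> L2" for w
    unfolding p1_def q1_def using that meas p' q' by (auto intro: L2_bounded_mult)
  have int: "integrable lebesgue (\<lambda>x. w1 x * cnj (w2 x))" if "w1 \<in> L2" "w2 \<in> L2" for w1 w2
    using that by (intro L2_mult_integrable L2_cnj)
  have int3: "integrable lebesgue (\<lambda>x. r x * (w1 x * cnj (w2 x)))" if "(\<lambda>x. r x * w1 x) \<in> L2" "w2 \<in> L2" for r w1 w2
    using int[OF that] by (simp add: mult.assoc)
  have "W \<in> AC_loc"
    unfolding W_def by (intro AC_loc_diff AC_loc_mult AC_loc_const AC_loc_cnj uL vL pq)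
  moreover have "integrable lebesgue W"
    unfolding W_def by (intro Bochner_Integration.integrable_diff integrable_mult_right int int3 pL uL vL)
  moreover have W'int: "integrable lebesgue W'"
    unfolding W'_def distrib_left
    by (intro Bochner_Integration.integrable_diff Bochner_Integration.integrable_add integrable_mult_right int int3 pL p1L uL vL)
  moreover have "AE x in lebesgue. (W has_vector_derivative W' x) (at x)"
    using AC_loc_has_vector_derivative[OF uL(3)] AC_loc_has_vector_derivative[OF vL(3)]
      AC_loc_has_vector_derivative[OF pq(1)] AC_loc_has_vector_derivative[OF pq(2)]
  proof eventually_elim
    case (elim x)
    have 1: "((\<lambda>x. w1 x * cnj (w2 x)) has_vector_derivative w1' * cnj (w2 x) + w1 x * cnj w2') (at x)"
      if "(w1 has_vector_derivative w1') (at x)" "(w2 has_vector_derivative w2') (at x)" for w1 w2 w1' w2'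
      using has_vector_derivative_mult[OF that(1) has_vector_derivative_cnj[OF that(2)]] by (simp add: add.commute)
    have 2: "((\<lambda>x. r x * (w1 x * cnj (w2 x))) has_vector_derivative
        r' * (w1 x * cnj (w2 x)) + r x * (w1' * cnj (w2 x) + w1 x * cnj w2')) (at x)"
      if "(r has_vector_derivative r') (at x)" "(w1 has_vector_derivative w1') (at x)" "(w2 has_vector_derivative w2') (at x)"
      for r w1 w2 r' w1' w2'
      using has_vector_derivative_mult[OF that(1) 1[OF that(2,3)]] by (simp add: add.commute)
    show ?case unfolding W_def W'_def u'_def v'_def p1_def q1_def
      by (intro has_vector_derivative_diff has_vector_derivative_mult_right 1 2 elim)
  qed
  ultimately have W0: "(LINT x|lebesgue. W' x) = 0" by (rule integral_derivative_eq_0)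
  have ImW: "integrable lebesgue (\<lambda>x. Im (W' x))" "(LINT x|lebesgue. Im (W' x)) = 0"
    using W'int W0 by simp_all
  have N: "integrable lebesgue (\<lambda>x. (cmod (u x))\<^sup>2 + (cmod (v x))\<^sup>2)"
    and F: "integrable lebesgue (\<lambda>x. (cmod (f1 x))\<^sup>2 + (cmod (f2 x))\<^sup>2)"
    using uL vL f by (auto intro!: Bochner_Integration.integrable_add L2_integrable)
  define K where "K = 1 + 4 * M\<^sup>2 / c + 4 * (cmod z)\<^sup>2 / c"
  have "AE x in lebesgue. c / 2 * ((cmod (u x))\<^sup>2 + (cmod (v x))\<^sup>2)
    \<le> K * ((cmod (f1 x))\<^sup>2 + (cmod (f2 x))\<^sup>2) + sgn (Im (z\<^sup>2)) * Im (W' x)"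
    using p' q' b f1 f2
  proof eventually_elim
    case (elim x)
    show ?case unfolding K_def
      using elim by (intro dirac_pointwise_estimate[OF h c elim(1-3) M gap]) (auto simp: u'_def v'_def W'_def p1_def q1_def)
  qed
  then have "(LINT x|lebesgue. c / 2 * ((cmod (u x))\<^sup>2 + (cmod (v x))\<^sup>2))
    \<le> (LINT x|lebesgue. K * ((cmod (f1 x))\<^sup>2 + (cmod (f2 x))\<^sup>2) + sgn (Im (z\<^sup>2)) * Im (W' x))"
    by (rule integral_mono_AE[OF integrable_mult_right[OF N]
          Bochner_Integration.integrable_add[OF integrable_mult_right[OF F] integrable_mult_right[OF ImW(1)]]])
  also have "\<dots> = (LINT x|lebesgue. K * ((cmod (f1 x))\<^sup>2 + (cmod (f2 x))\<^sup>2)) + (LINT x|lebesgue. sgn (Im (z\<^sup>2)) * Im (W' x))"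
    by (rule Bochner_Integration.integral_add[OF integrable_mult_right[OF F] integrable_mult_right[OF ImW(1)]])
  also have "\<dots> = K * (LINT x|lebesgue. (cmod (f1 x))\<^sup>2 + (cmod (f2 x))\<^sup>2)"
    using ImW(2) by simp
  finally show ?thesis by (simp add: K_def)
qed

section \<open>First-order scalar equations with square-integrable right-hand side\<close>

lemma locally_integrable_bounded_mult:
  fixes f k :: "real \<Rightarrow> complex"
  assumes f: "locally_integrable f" and k: "k \<in> borel_measurable lebesgue" and M: "\<And>x. norm (k x) \<le> M"
  shows "locally_integrable (\<lambda>x. k x * f x)"
  unfolding locally_integrable_def set_integrable_def
proof (intro allI)
  fix a b :: real
  have i: "integrable lebesgue (\<lambda>x. indicator {a..b} x *\<^sub>R f x)"
    using f unfolding locally_integrable_def set_integrable_def by blast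
  show "integrable lebesgue (\<lambda>x. indicator {a..b} x *\<^sub>R (k x * f x))"
  proof (rule Bochner_Integration.integrable_bound[OF integrable_mult_right[OF integrable_norm[OF i], of M]])
    show "(\<lambda>x. indicator {a..b} x *\<^sub>R (k x * f x)) \<in> borel_measurable lebesgue"
      using k locally_integrable_measurable[OF f]
      by (intro borel_measurable_scaleR borel_measurable_indicator borel_measurable_times) auto
    show "AE x in lebesgue. norm (indicator {a..b} x *\<^sub>R (k x * f x)) \<le> norm (M * norm (indicator {a..b} x *\<^sub>R f x))"
    proof (rule AE_I2)
      fix x
      have "norm (k x) * norm (f x) \<le> \<bar>M\<bar> * norm (f x)"
        using M[of x] by (intro mult_right_mono) auto
      then show "norm (indicator {a..b} x *\<^sub>R (k x * f x)) \<le> norm (M * norm (indicator {a..b} x *\<^sub>R f x))"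
        by (auto simp: indicator_def norm_mult abs_mult)
    qed
  qed
qed

lemma locally_integrable_add:
  "locally_integrable f \<Longrightarrow> locally_integrable g \<Longrightarrow> locally_integrable (\<lambda>x. f x + g x)"
  unfolding locally_integrable_def by (simp add: set_integral_add)

lemma integrable_exp_abs:
  fixes a :: real
  assumes a: "a > 0"
  shows "integrable lborel (\<lambda>y. exp (- a * \<bar>y\<bar>))"
proof -
  have "(\<lambda>y. exp (- a * y)) absolutely_integrable_on {0..}"
    by (rule nonnegative_absolutely_integrable_1) (use integrable_on_exp_minus_to_infinity[OF a, of 0] in auto)
  then have "integrable lebesgue (\<lambda>y. indicator {0..} y *\<^sub>R exp (- a * y))" by (simp add: set_integrable_def)
  then have i: "integrable lborel (\<lambda>y. indicator {0..} y *\<^sub>R exp (- a * y))"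
    by (subst (asm) integrable_completion) auto
  have "integrable lborel (\<lambda>y. indicator {0..} (0 + (-1) * y) *\<^sub>R exp (- a * (0 + (-1) * y)))"
    by (rule lborel_integrable_real_affine[OF i]) simp
  then have "integrable lborel (\<lambda>y. indicator {0..} y *\<^sub>R exp (- a * y) + indicator {0..} (0 + (-1) * y) *\<^sub>R exp (- a * (0 + (-1) * y)))"
    by (rule Bochner_Integration.integrable_add[OF i])
  then show ?thesis
    by (rule Bochner_Integration.integrable_bound) (auto simp: indicator_def abs_if)
qed

text \<open>The integral does not depend on \<open>x\<close>; this makes the bound on the solution of the scalar equation uniform.\<close>

lemma integrable_exp_abs_translate:
  fixes a x :: real
  assumes a: "a > 0"
  shows "integrable lebesgue (\<lambda>y. exp (- a * \<bar>x - y\<bar>))"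
    and "(LINT y|lebesgue. exp (- a * \<bar>x - y\<bar>)) = (LINT y|lborel. exp (- a * \<bar>y\<bar>))"
proof -
  have i: "integrable lborel (\<lambda>y. exp (- a * \<bar>x + (-1) * y\<bar>))"
    by (rule lborel_integrable_real_affine[OF integrable_exp_abs[OF a]]) simp
  have m: "(\<lambda>y. exp (- a * \<bar>x - y\<bar>)) \<in> borel_measurable lborel" by measurable
  show "integrable lebesgue (\<lambda>y. exp (- a * \<bar>x - y\<bar>))" using i m by (simp add: integrable_completion)
  show "(LINT y|lebesgue. exp (- a * \<bar>x - y\<bar>)) = (LINT y|lborel. exp (- a * \<bar>y\<bar>))"
    using lborel_integral_real_affine[of "-1" "\<lambda>y. exp (- a * \<bar>y\<bar>)" x] m by (simp add: integral_completion)
qed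

lemma integrable_if_bounded_on_intervals:
  fixes f :: "real \<Rightarrow> real"
  assumes meas: "f \<in> borel_measurable lebesgue" and f0: "\<And>x. f x \<ge> 0"
    and int: "locally_integrable f" and le: "\<And>n::nat. (LINT x:{- real n<..real n}|lebesgue. f x) \<le> C"
  shows "integrable lebesgue f"
proof -
  define k where "k n x = indicator {- real n<..real n} x * f x" for n :: nat and x
  have kint: "integrable lebesgue (k n)" for n
  proof -
    have "set_integrable lebesgue {- real n<..real n} f"
      by (rule locally_integrable_subset[OF int, of _ "- real n" "real n"]) auto
    then show ?thesis unfolding k_def set_integrable_def by simp
  qed
  have mono: "k n x \<le> k m x" if "n \<le> m" for n m x
    using that f0[of x] by (auto simp: k_def indicator_def)
  have "incseq (\<lambda>n. LINT x|lebesgue. k n x)"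
    unfolding incseq_def by (intro allI impI integral_mono kint mono)
  moreover have "(LINT x|lebesgue. k n x) \<le> C" for n
    using le[of n] by (simp add: k_def set_lebesgue_integral_def)
  ultimately obtain L where L: "(\<lambda>n. LINT x|lebesgue. k n x) \<longlonglongrightarrow> L"
    using incseq_convergent[of "\<lambda>n. LINT x|lebesgue. k n x" C] by blast
  show ?thesis
  proof (rule integrable_monotone_convergence[OF kint _ _ L meas])
    show "AE x in lebesgue. mono (\<lambda>n. k n x)" by (intro AE_I2 monoI mono)
    show "AE x in lebesgue. (\<lambda>n. k n x) \<longlonglongrightarrow> f x"
    proof (rule AE_I2)
      fix x
      obtain N :: nat where N: "\<bar>x\<bar> < real N" using reals_Archimedean2 by blast
      have "\<forall>\<^sub>F n in sequentially. k n x = f x"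
        unfolding eventually_sequentially using N by (intro exI[of _ N]) (auto simp: k_def indicator_def)
      then show "(\<lambda>n. k n x) \<longlonglongrightarrow> f x" by (rule tendsto_eventually)
    qed
  qed
qed

text \<open>The derivative of \<open>\<bar>u\<bar>\<^sup>2\<close> is \<open>2 Re l \<bar>u\<bar>\<^sup>2 + 2 Re (f cnj u)\<close>.  Its integral over a bounded interval is a difference
  of boundary values of \<open>\<bar>u\<bar>\<^sup>2\<close>, and so the integral of \<open>\<bar>u\<bar>\<^sup>2\<close> is bounded independently of the interval.\<close>

lemma bounded_solution_in_H1:
  fixes u f :: "real \<Rightarrow> complex" and l :: complex
  assumes l: "Re l \<noteq> 0" and f: "f \<in> L2" and u: "u \<in> AC_loc" and B: "\<And>x. cmod (u x) \<le> B"
    and deriv: "AE x in lebesgue. (u has_vector_derivative l * u x + f x) (at x)"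
  shows "u \<in> H1"
proof -
  define a where "a = \<bar>Re l\<bar>"
  have a: "a > 0" using l by (simp add: a_def)
  define s where "s = sgn (Re l)"
  have s: "s * Re l = a" "\<bar>s\<bar> = 1" using l by (auto simp: s_def a_def sgn_if)
  define u' where "u' x = l * u x + f x" for x
  have um: "u \<in> borel_measurable lebesgue" by (rule AC_loc_measurable[OF u])
  have one: "locally_integrable (\<lambda>x. 1 :: complex)"
    unfolding locally_integrable_def by (intro allI absolutely_integrable_on_const) auto
  have u'loc: "locally_integrable u'" unfolding u'_def
  proof (rule locally_integrable_add[OF _ L2_locally_integrable[OF f]])
    have "locally_integrable (\<lambda>x. (l * u x) * 1)"
      by (rule locally_integrable_bounded_mult[OF one, of _ "cmod l * B"])
        (use um B in \<open>auto simp: norm_mult intro!: mult_left_mono\<close>)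
    then show "locally_integrable (\<lambda>x. l * u x)" by simp
  qed
  define d where "d x = u x * cnj (u' x) + u' x * cnj (u x)" for x
  have dRe: "Re (d x) = 2 * Re (u' x * cnj (u x))" for x by (simp add: d_def)
  note cnjloc = locally_integrable_bounded_linear[OF bounded_linear_cnj u'loc]
  have dloc: "locally_integrable d"
    unfolding d_def
  proof (rule locally_integrable_add)
    show "locally_integrable (\<lambda>x. u x * cnj (u' x))" by (rule locally_integrable_bounded_mult[OF cnjloc um B])
    have "locally_integrable (\<lambda>x. cnj (u x) * u' x)"
      by (rule locally_integrable_bounded_mult[OF u'loc AC_loc_measurable[OF AC_loc_cnj[OF u]], of B]) (simp add: B)
    then show "locally_integrable (\<lambda>x. u' x * cnj (u x))" by (simp add: mult.commute)
  qed
  have dderiv: "AE x in lebesgue. ((\<lambda>x. u x * cnj (u x)) has_vector_derivative d x) (at x)"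
    using deriv
  proof eventually_elim
    case (elim x)
    then show ?case using has_vector_derivative_mult[OF elim has_vector_derivative_cnj[OF elim]]
      by (simp add: d_def u'_def)
  qed
  have point: "a * (cmod (u x))\<^sup>2 \<le> (cmod (f x))\<^sup>2 / a + s * Re (d x)" for x
  proof -
    have "s * Re (d x) = 2 * a * (cmod (u x))\<^sup>2 + 2 * s * Re (f x * cnj (u x))"
    proof -
      have "Re (l * u x * cnj (u x)) = Re l * (cmod (u x))\<^sup>2"
        unfolding mult.assoc complex_norm_square[symmetric] by simp
      then have "Re (d x) = 2 * (Re l * (cmod (u x))\<^sup>2 + Re (f x * cnj (u x)))"
        unfolding dRe u'_def by (simp add: distrib_right)
      then have "s * Re (d x) = 2 * (s * Re l) * (cmod (u x))\<^sup>2 + 2 * s * Re (f x * cnj (u x))"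
        by (simp only: distrib_left mult_ac)
      then show ?thesis unfolding s .
    qed
    moreover have "- (2 * s * Re (f x * cnj (u x))) \<le> a * (cmod (u x))\<^sup>2 + (cmod (f x))\<^sup>2 / a"
    proof -
      have "- (s * Re (f x * cnj (u x))) \<le> \<bar>s\<bar> * \<bar>Re (f x * cnj (u x))\<bar>" by (metis abs_ge_minus_self abs_mult)
      also have "\<dots> \<le> cmod (f x) * cmod (u x)"
        using s abs_Re_le_cmod[of "f x * cnj (u x)"] by (simp add: norm_mult)
      finally have "- (2 * s * Re (f x * cnj (u x))) \<le> 2 * cmod (f x) * cmod (u x)" by simp
      also have "\<dots> \<le> a * (cmod (u x))\<^sup>2 + (cmod (f x))\<^sup>2 / a"
        using weighted_AM_GM[of "4 * a" 1 "cmod (f x)" "cmod (u x)"] a by simp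
      finally show ?thesis .
    qed
    ultimately show ?thesis by linarith
  qed
  have u2loc: "locally_integrable (\<lambda>x. (cmod (u x))\<^sup>2)"
  proof -
    have "locally_integrable (\<lambda>x. u x * cnj (u x))"
      by (rule locally_integrable_bounded_mult[OF _ um B])
        (use locally_integrable_bounded_mult[OF one AC_loc_measurable[OF AC_loc_cnj[OF u]], of B] B in simp)
    then have "locally_integrable (\<lambda>x. Re (u x * cnj (u x)))" by (rule locally_integrable_bounded_linear[OF bounded_linear_Re])
    then show ?thesis by (simp flip: complex_norm_square)
  qed
  have "integrable lebesgue (\<lambda>x. (cmod (u x))\<^sup>2)"
  proof (rule integrable_if_bounded_on_intervals[OF _ _ u2loc])
    fix n :: nat
    let ?J = "{- real n<..real n}"
    have sint: "set_integrable lebesgue ?J w" if "locally_integrable w" for w :: "real \<Rightarrow> real"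
      by (rule locally_integrable_subset[OF that, of _ "- real n" "real n"]) auto
    have f2: "integrable lebesgue (\<lambda>x. (cmod (f x))\<^sup>2)" by (rule L2_integrable[OF f])
    have "a * (LINT x:?J|lebesgue. (cmod (u x))\<^sup>2) = (LINT x:?J|lebesgue. a * (cmod (u x))\<^sup>2)" by simp
    also have "\<dots> \<le> (LINT x:?J|lebesgue. (cmod (f x))\<^sup>2 / a + s * Re (d x))"
    proof (rule set_integral_mono[OF _ _ point])
      show "set_integrable lebesgue ?J (\<lambda>x. a * (cmod (u x))\<^sup>2)" using sint[OF u2loc] by simp
      show "set_integrable lebesgue ?J (\<lambda>x. (cmod (f x))\<^sup>2 / a + s * Re (d x))"
        using sint[OF integrable_imp_locally_integrable[OF f2]] sint[OF locally_integrable_bounded_linear[OF bounded_linear_Re dloc]] by (intro set_integral_add) auto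
    qed
    also have "\<dots> = (LINT x:?J|lebesgue. (cmod (f x))\<^sup>2) / a + s * (LINT x:?J|lebesgue. Re (d x))"
      using sint[OF integrable_imp_locally_integrable[OF f2]] sint[OF locally_integrable_bounded_linear[OF bounded_linear_Re dloc]] by (simp add: set_integral_add)
    also have "(LINT x:?J|lebesgue. (cmod (f x))\<^sup>2) \<le> L2_sq f"
      unfolding set_lebesgue_integral_def
      using f2 sint[OF integrable_imp_locally_integrable[OF f2]]
      by (intro integral_mono) (auto simp: indicator_def set_integrable_def)
    also have "s * (LINT x:?J|lebesgue. Re (d x)) \<le> 2 * B\<^sup>2"
    proof -
      have "(LINT x:?J|lebesgue. d x) = u (real n) * cnj (u (real n)) - u (- real n) * cnj (u (- real n))"
        by (rule AC_loc_integral_derivative[symmetric, OF AC_loc_mult[OF u AC_loc_cnj[OF u]] dderiv dloc]) simp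
      then have "(LINT x:?J|lebesgue. Re (d x)) = (cmod (u (real n)))\<^sup>2 - (cmod (u (- real n)))\<^sup>2"
      proof -
        have "set_integrable lebesgue ?J d"
          by (rule locally_integrable_subset[OF dloc, of _ "- real n" "real n"]) auto
        moreover assume "(LINT x:?J|lebesgue. d x) = u (real n) * cnj (u (real n)) - u (- real n) * cnj (u (- real n))"
        ultimately show ?thesis by (simp add: set_integral_bounded_linear[OF bounded_linear_Re] flip: complex_norm_square)
      qed
      moreover have "(cmod (u x))\<^sup>2 \<le> B\<^sup>2" for x using B by (intro power_mono) auto
      ultimately have "\<bar>LINT x:?J|lebesgue. Re (d x)\<bar> \<le> 2 * B\<^sup>2"
        by (smt (verit) zero_le_power2)
      then show ?thesis using s(2) by (metis abs_ge_self abs_mult mult_1 order_trans)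
    qed
    finally have "a * (LINT x:?J|lebesgue. (cmod (u x))\<^sup>2) \<le> L2_sq f / a + 2 * B\<^sup>2"
      using a by (simp add: divide_right_mono)
    then show "(LINT x:?J|lebesgue. (cmod (u x))\<^sup>2) \<le> (L2_sq f / a + 2 * B\<^sup>2) / a"
      using a by (simp add: pos_le_divide_eq mult.commute)
  qed (use um in auto)
  then have uL: "u \<in> L2" using um by (simp add: L2_def)
  have "(\<lambda>x. l * u x + f x) \<in> L2" by (intro L2_add L2_scale uL f)
  moreover have "AE x in lebesgue. l * u x + f x = ac_deriv u x"
    using deriv by eventually_elim (simp add: vector_derivative_at)
  ultimately have "ac_deriv u \<in> L2" by (rule L2_AE_cong)
  then show ?thesis using u uL by (simp add: H1_def)
qed

text \<open>Variation of constants, integrating from that end of the line towards which the homogeneous solution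
  \<open>exp (l x)\<close> grows: \<open>- \<infinity>\<close> if \<open>Re l < 0\<close> and \<open>+ \<infinity>\<close> if \<open>Re l > 0\<close>.  The kernel is then \<open>exp (- \<bar>Re l\<bar> \<bar>x - y\<bar>)\<close> in
  absolute value, and the solution is bounded because \<open>f\<close> and the kernel are square-integrable.\<close>

lemma exists_H1_solution_first_order:
  fixes f :: "real \<Rightarrow> complex" and l :: complex
  assumes l: "Re l \<noteq> 0" and f: "f \<in> L2"
  shows "\<exists>u\<in>H1. AE x in lebesgue. ac_deriv u x = l * u x + f x"
proof -
  define a where "a = \<bar>Re l\<bar>"
  have a: "2 * a > 0" using l by (simp add: a_def)
  define g where "g y = exp (- l * of_real y) * f y" for y :: real
  \<comment> \<open>The range of integration and, below, the sign \<open>w\<close> treat both signs of \<open>Re l\<close> at once.\<close>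
  define S where "S x = (if Re l < 0 then {..x} else {x<..})" for x :: real
  have S: "S x \<in> sets lebesgue" for x by (simp add: S_def)
  define k where "k x y = exp (- (2 * a) * \<bar>x - y\<bar>) + (cmod (f y))\<^sup>2" for x y
  have k: "integrable lebesgue (k x)" for x
    unfolding k_def by (intro Bochner_Integration.integrable_add integrable_exp_abs_translate(1)[OF a] L2_integrable f)
  define B where "B = (LINT y|lborel. exp (- (2 * a) * \<bar>y\<bar>)) + (LINT y|lebesgue. (cmod (f y))\<^sup>2)"
  have kB: "(LINT y|lebesgue. k x y) = B" for x
    unfolding k_def B_def integrable_exp_abs_translate(2)[OF a, symmetric, of x]
    by (intro Bochner_Integration.integral_add integrable_exp_abs_translate(1)[OF a] L2_integrable f)
  have point: "cmod (exp (l * of_real x) * g y) \<le> k x y" if y: "y \<in> S x" for x y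
  proof -
    have eq: "exp (l * of_real x) * g y = exp (l * of_real (x - y)) * f y"
      by (simp add: g_def algebra_simps flip: exp_add mult.assoc)
    have "Re l * (x - y) = - a * \<bar>x - y\<bar>" using y l by (auto simp: S_def a_def abs_if algebra_simps split: if_splits)
    then have "cmod (exp (l * of_real x) * g y) = exp (- a * \<bar>x - y\<bar>) * cmod (f y)"
      unfolding eq by (simp add: norm_mult norm_exp_eq_Re)
    also have "\<dots> \<le> (exp (- a * \<bar>x - y\<bar>))\<^sup>2 + (cmod (f y))\<^sup>2"
      using sum_squares_bound[of "exp (- a * \<bar>x - y\<bar>)" "cmod (f y)"] mult_nonneg_nonneg[OF less_imp_le[OF exp_gt_zero[of "- a * \<bar>x - y\<bar>"]] norm_ge_zero[of "f y"]]
      by linarith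
    also have "(exp (- a * \<bar>x - y\<bar>))\<^sup>2 = exp (- (2 * a) * \<bar>x - y\<bar>)"
      by (simp flip: exp_of_nat_mult add: algebra_simps)
    finally show ?thesis by (simp add: k_def)
  qed
  have "(\<lambda>y. exp (- l * of_real y)) \<in> borel_measurable (lebesgue :: real measure)"
    by (rule continuous_imp_lebesgue_measurable) (intro continuous_intros)
  then have gm: "g \<in> borel_measurable lebesgue"
    unfolding g_def using L2_measurable[OF f] by (rule borel_measurable_times)
  have egint: "set_integrable lebesgue (S x) (\<lambda>y. exp (l * of_real x) * g y)" for x
    unfolding set_integrable_def
  proof (rule Bochner_Integration.integrable_bound[OF k[of x]])
    show "(\<lambda>y. indicator (S x) y *\<^sub>R (exp (l * of_real x) * g y)) \<in> borel_measurable lebesgue"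
      using gm S by (intro borel_measurable_scaleR borel_measurable_indicator borel_measurable_times) auto
    show "AE y in lebesgue. norm (indicator (S x) y *\<^sub>R (exp (l * of_real x) * g y)) \<le> norm (k x y)"
    proof (rule AE_I2)
      fix y
      have "k x y \<ge> 0" by (simp add: k_def)
      then show "norm (indicator (S x) y *\<^sub>R (exp (l * of_real x) * g y)) \<le> norm (k x y)"
        using point[of y x] by (auto simp: indicator_def)
    qed
  qed
  have gint: "set_integrable lebesgue (S x) g" for x
  proof -
    have "set_integrable lebesgue (S x) (\<lambda>y. exp (- l * of_real x) * (exp (l * of_real x) * g y))"
      using egint[of x] by (rule set_integrable_mult_right)
    moreover have "exp (- l * of_real x) * (exp (l * of_real x) * g y) = g y" for y
      by (simp add: exp_minus field_simps)
    ultimately show ?thesis by simp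
  qed
  have gloc: "locally_integrable g"
    unfolding locally_integrable_def
  proof (intro allI)
    fix b c :: real
    show "set_integrable lebesgue {b..c} g"
    proof (cases "Re l < 0")
      case True
      then show ?thesis by (intro set_integrable_subset[OF gint[of c]]) (auto simp: S_def)
    next
      case False
      then show ?thesis by (intro set_integrable_subset[OF gint[of "b - 1"]]) (auto simp: S_def)
    qed
  qed
  define w where "w = (if Re l < 0 then 1 else - 1 :: complex)"
  define G where "G x = w * (LINT y:S x|lebesgue. g y)" for x
  have G: "G t - G s = (LINT y:{s<..t}|lebesgue. g y)" if st: "s \<le> t" for s t
  proof -
    have i: "set_integrable lebesgue {s<..t} g" by (rule locally_integrable_subset[OF gloc, of _ s t]) auto
    show ?thesis
    proof (cases "Re l < 0")
      case True
      have eq: "S t = S s \<union> {s<..t}" using st True by (auto simp: S_def)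
      have "(LINT y:S t|lebesgue. g y) = (LINT y:S s|lebesgue. g y) + (LINT y:{s<..t}|lebesgue. g y)"
        unfolding eq by (rule set_integral_Un[OF _ gint i]) (use True in \<open>auto simp: S_def\<close>)
      then show ?thesis using True by (simp add: G_def w_def)
    next
      case False
      have eq: "S s = {s<..t} \<union> S t" using st False by (auto simp: S_def)
      have "(LINT y:S s|lebesgue. g y) = (LINT y:{s<..t}|lebesgue. g y) + (LINT y:S t|lebesgue. g y)"
        unfolding eq by (rule set_integral_Un[OF _ i gint]) (use False in \<open>auto simp: S_def\<close>)
      then show ?thesis using False by (simp add: G_def w_def)
    qed
  qed
  have GAC: "G \<in> AC_loc" by (rule indefinite_integral_AC_loc[OF gloc]) (rule G)
  define u where "u x = exp (l * of_real x) * G x" for x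
  have uAC: "u \<in> AC_loc" unfolding u_def by (intro AC_loc_mult AC_loc_exp GAC)
  have "AE x in lebesgue. (G has_vector_derivative g x) (at x)"
    by (rule indefinite_integral_has_vector_derivative_AE[OF gloc]) (rule G)
  then have deriv: "AE x in lebesgue. (u has_vector_derivative l * u x + f x) (at x)"
  proof eventually_elim
    case (elim x)
    have "((\<lambda>x. exp (l * of_real x)) has_vector_derivative l * exp (l * of_real x)) (at x)"
      by (rule has_vector_derivative_real_field) (auto intro!: derivative_eq_intros)
    from has_vector_derivative_mult[OF this elim]
    have "(u has_vector_derivative exp (l * of_real x) * g x + l * exp (l * of_real x) * G x) (at x)"
      by (simp add: u_def[abs_def])
    moreover have "exp (l * of_real x) * g x = f x" by (simp add: g_def exp_minus field_simps)
    ultimately show ?case by (simp add: u_def mult.assoc add.commute)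
  qed
  have "cmod (u x) \<le> B" for x
  proof -
    have "u x = w * (LINT y:S x|lebesgue. exp (l * of_real x) * g y)" by (simp add: u_def G_def)
    then have "cmod (u x) = cmod (LINT y:S x|lebesgue. exp (l * of_real x) * g y)" by (simp add: w_def norm_mult)
    also have "\<dots> \<le> (LINT y:S x|lebesgue. cmod (exp (l * of_real x) * g y))" by (rule set_integral_norm_bound[OF egint])
    also have "\<dots> \<le> (LINT y|lebesgue. k x y)"
      unfolding set_lebesgue_integral_def
    proof (rule integral_mono[OF _ k])
      show "integrable lebesgue (\<lambda>y. indicator (S x) y *\<^sub>R cmod (exp (l * of_real x) * g y))"
        using integrable_norm[OF egint[of x, unfolded set_integrable_def]] by simp
      fix y
      have "k x y \<ge> 0" by (simp add: k_def)
      then show "indicator (S x) y *\<^sub>R cmod (exp (l * of_real x) * g y) \<le> k x y"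
        using point[of y x] by (auto simp: indicator_def)
    qed
    finally show ?thesis unfolding kB .
  qed
  then have "u \<in> H1" by (rule bounded_solution_in_H1[OF l f uAC _ deriv])
  moreover have "AE x in lebesgue. ac_deriv u x = l * u x + f x"
    using deriv by eventually_elim (simp add: vector_derivative_at)
  ultimately show ?thesis by blast
qed

section \<open>The Dirac operator in components\<close>

lemma norm_complex2: "(norm (w :: complex^2))\<^sup>2 = (cmod (w $ 1))\<^sup>2 + (cmod (w $ 2))\<^sup>2"
  by (simp add: norm_vec_def L2_set_def sum_2)

lemma bounded_linear_axis_complex2: "bounded_linear (axis i :: complex \<Rightarrow> complex^2)"
  unfolding linear_conv_bounded_linear[symmetric]
  by (rule linearI) (auto simp: vec_eq_iff axis_def)

lemma complex2_split: "w = axis 1 (w $ 1) + axis 2 (w $ 2 :: complex)" for w :: "complex^2"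
  by (simp add: vec_eq_iff forall_2 axis_def)

lemma L2_complex2_iff:
  fixes f :: "real \<Rightarrow> complex^2"
  shows "f \<in> L2 \<longleftrightarrow> (\<forall>i. (\<lambda>x. f x $ i) \<in> L2)"
proof
  assume f: "f \<in> L2"
  show "\<forall>i. (\<lambda>x. f x $ i) \<in> L2"
  proof
    fix i
    show "(\<lambda>x. f x $ i) \<in> L2"
    proof (rule L2I_dominated(1)[OF _ L2_integrable[OF f]])
      show "(\<lambda>x. f x $ i) \<in> borel_measurable lebesgue"
        using L2_measurable[OF f] by (rule borel_measurable_continuous_on[rotated]) (intro continuous_intros)
      show "AE x in lebesgue. (cmod (f x $ i))\<^sup>2 \<le> (norm (f x))\<^sup>2"
        by (intro AE_I2 power_mono) (auto simp: Finite_Cartesian_Product.norm_nth_le)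
    qed
  qed
next
  assume f: "\<forall>i. (\<lambda>x. f x $ i) \<in> L2"
  show "f \<in> L2"
  proof (rule L2I_dominated(1))
    have "(\<lambda>x. axis i (f x $ i) :: complex^2) \<in> borel_measurable lebesgue" for i
      using L2_measurable[OF f[rule_format]]
      by (rule borel_measurable_continuous_on[rotated])
        (intro linear_continuous_on bounded_linear_axis_complex2)
    then have "(\<lambda>x. axis 1 (f x $ 1) + axis 2 (f x $ 2) :: complex^2) \<in> borel_measurable lebesgue"
      by (intro borel_measurable_add)
    then show "f \<in> borel_measurable lebesgue" by (simp flip: complex2_split)
    show "integrable lebesgue (\<lambda>x. (cmod (f x $ 1))\<^sup>2 + (cmod (f x $ 2))\<^sup>2)"
      using f by (intro Bochner_Integration.integrable_add L2_integrable) auto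
  qed (simp add: norm_complex2)
qed

text \<open>For all bounded measurable potentials this is the domain of the Dirac operator.\<close>

definition H1_spinor :: "(real \<Rightarrow> complex^2) set" where
  "H1_spinor = {\<Psi>. \<forall>i. (\<lambda>x. \<Psi> x $ i) \<in> H1}"

lemma H1_L2: "u \<in> H1 \<Longrightarrow> u \<in> L2" and H1_AC_loc: "u \<in> H1 \<Longrightarrow> u \<in> AC_loc"
  by (simp_all add: H1_def)

lemma H1_spinor_L2: "\<Psi> \<in> H1_spinor \<Longrightarrow> \<Psi> \<in> L2"
  by (simp add: H1_spinor_def L2_complex2_iff H1_L2)

text \<open>At points where a component fails to be differentiable, \<^const>\<open>vector_derivative\<close> is arbitrary, so that components
  of the derivative and derivatives of the components need not agree there.\<close>

lemma ac_deriv_component_AE: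
  fixes \<Psi> :: "real \<Rightarrow> complex^2"
  assumes "\<forall>i. (\<lambda>x. \<Psi> x $ i) \<in> AC_loc"
  shows "AE x in lebesgue. \<forall>i. ac_deriv \<Psi> x $ i = ac_deriv (\<lambda>x. \<Psi> x $ i) x"
  using AC_loc_has_vector_derivative[OF assms[rule_format, of 1]] AC_loc_has_vector_derivative[OF assms[rule_format, of 2]]
proof eventually_elim
  case (elim x)
  have "((\<lambda>x. axis 1 (\<Psi> x $ 1) + axis 2 (\<Psi> x $ 2) :: complex^2) has_vector_derivative
      axis 1 (ac_deriv (\<lambda>x. \<Psi> x $ 1) x) + axis 2 (ac_deriv (\<lambda>x. \<Psi> x $ 2) x)) (at x)"
    using elim by (intro has_vector_derivative_add bounded_linear.has_vector_derivative[OF bounded_linear_axis_complex2])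
  then have "(\<Psi> has_vector_derivative
      axis 1 (ac_deriv (\<lambda>x. \<Psi> x $ 1) x) + axis 2 (ac_deriv (\<lambda>x. \<Psi> x $ 2) x)) (at x)"
    by (simp flip: complex2_split)
  then have "ac_deriv \<Psi> x = axis 1 (ac_deriv (\<lambda>x. \<Psi> x $ 1) x) + axis 2 (ac_deriv (\<lambda>x. \<Psi> x $ 2) x)"
    by (rule vector_derivative_at)
  then show ?case by (simp add: forall_2 axis_def)
qed

lemma dirac_nth:
  "dirac h p q \<Psi> x $ 1 = \<i> * h * ac_deriv \<Psi> x $ 1 - \<i> * q x * \<Psi> x $ 2"
  "dirac h p q \<Psi> x $ 2 = - (\<i> * h * ac_deriv \<Psi> x $ 2) + \<i> * p x * \<Psi> x $ 1"
  by (simp_all add: dirac_def sigma3_def potential_def matrix_vector_mult_def sum_2)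

lemma dirac_nth_AE:
  assumes "\<forall>i. (\<lambda>x. \<Psi> x $ i) \<in> AC_loc"
  shows "AE x in lebesgue. dirac h p q \<Psi> x $ 1 = \<i> * h * ac_deriv (\<lambda>x. \<Psi> x $ 1) x - \<i> * q x * \<Psi> x $ 2
    \<and> dirac h p q \<Psi> x $ 2 = - (\<i> * h * ac_deriv (\<lambda>x. \<Psi> x $ 2) x) + \<i> * p x * \<Psi> x $ 1"
  using ac_deriv_component_AE[OF assms] by eventually_elim (simp add: dirac_nth)

text \<open>For bounded potentials \<open>\<DD> \<Psi>\<close> and \<open>i h \<sigma>\<^sub>3 \<Psi>'\<close> differ by an element of \<open>L\<^sup>2\<close>.\<close>

lemma dirac_domain_eq_H1_spinor:
  assumes h: "h \<noteq> 0" and meas: "p \<in> borel_measurable lebesgue" "q \<in> borel_measurable lebesgue"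
    and M: "\<And>x. cmod (p x) \<le> M" "\<And>x. cmod (q x) \<le> M"
  shows "dirac_domain h p q = H1_spinor"
proof (intro set_eqI iffI)
  fix \<Psi> assume "\<Psi> \<in> dirac_domain h p q"
  then have \<Psi>: "\<And>i. (\<lambda>x. \<Psi> x $ i) \<in> L2" "\<forall>i. (\<lambda>x. \<Psi> x $ i) \<in> AC_loc" "\<And>i. (\<lambda>x. dirac h p q \<Psi> x $ i) \<in> L2"
    by (auto simp: dirac_domain_def L2_complex2_iff)
  have mult: "(\<lambda>x. k x * \<Psi> x $ i) \<in> L2" if "k = p \<or> k = q" for k i
    using that meas M by (auto intro!: L2_bounded_mult[where M = M] \<Psi>)
  have 1: "(\<lambda>x. - (\<i> / h) * (dirac h p q \<Psi> x $ 1 + \<i> * (q x * \<Psi> x $ 2))) \<in> L2"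
    by (intro L2_scale L2_add \<Psi> mult) simp
  have 2: "(\<lambda>x. (\<i> / h) * (dirac h p q \<Psi> x $ 2 - \<i> * (p x * \<Psi> x $ 1))) \<in> L2"
    by (intro L2_scale L2_diff \<Psi> mult) simp
  have "ac_deriv (\<lambda>x. \<Psi> x $ 1) \<in> L2"
  proof (rule L2_AE_cong[OF 1])
    show "AE x in lebesgue. - (\<i> / h) * (dirac h p q \<Psi> x $ 1 + \<i> * (q x * \<Psi> x $ 2)) = ac_deriv (\<lambda>x. \<Psi> x $ 1) x"
      using dirac_nth_AE[OF \<Psi>(2), of h p q]
    proof eventually_elim
      case (elim x)
      show ?case unfolding elim[THEN conjunct1] using h by (simp add: field_simps)
    qed
  qed
  moreover have "ac_deriv (\<lambda>x. \<Psi> x $ 2) \<in> L2"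
  proof (rule L2_AE_cong[OF 2])
    show "AE x in lebesgue. (\<i> / h) * (dirac h p q \<Psi> x $ 2 - \<i> * (p x * \<Psi> x $ 1)) = ac_deriv (\<lambda>x. \<Psi> x $ 2) x"
      using dirac_nth_AE[OF \<Psi>(2), of h p q]
    proof eventually_elim
      case (elim x)
      show ?case unfolding elim[THEN conjunct2] using h by (simp add: field_simps)
    qed
  qed
  ultimately show "\<Psi> \<in> H1_spinor" using \<Psi> by (simp add: H1_spinor_def H1_def forall_2)
next
  fix \<Psi> assume "\<Psi> \<in> H1_spinor"
  then have \<Psi>: "\<And>i. (\<lambda>x. \<Psi> x $ i) \<in> L2" "\<forall>i. (\<lambda>x. \<Psi> x $ i) \<in> AC_loc" "\<And>i. ac_deriv (\<lambda>x. \<Psi> x $ i) \<in> L2"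
    by (auto simp: H1_spinor_def H1_def)
  have mult: "(\<lambda>x. k x * \<Psi> x $ i) \<in> L2" if "k = p \<or> k = q" for k i
    using that meas M by (auto intro!: L2_bounded_mult[where M = M] \<Psi>)
  have 1: "(\<lambda>x. (\<i> * h) * ac_deriv (\<lambda>x. \<Psi> x $ 1) x - \<i> * (q x * \<Psi> x $ 2)) \<in> L2"
    by (intro L2_scale L2_diff \<Psi> mult) simp
  have 2: "(\<lambda>x. (- \<i> * h) * ac_deriv (\<lambda>x. \<Psi> x $ 2) x + \<i> * (p x * \<Psi> x $ 1)) \<in> L2"
    by (intro L2_scale L2_add \<Psi> mult) simp
  have "(\<lambda>x. dirac h p q \<Psi> x $ 1) \<in> L2"
    by (rule L2_AE_cong[OF 1]) (use dirac_nth_AE[OF \<Psi>(2), of h p q] in \<open>eventually_elim, simp add: mult.assoc\<close>)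
  moreover have "(\<lambda>x. dirac h p q \<Psi> x $ 2) \<in> L2"
    by (rule L2_AE_cong[OF 2]) (use dirac_nth_AE[OF \<Psi>(2), of h p q] in \<open>eventually_elim, simp add: mult.assoc\<close>)
  ultimately show "\<Psi> \<in> dirac_domain h p q" using \<Psi> by (simp add: dirac_domain_def L2_complex2_iff forall_2)
qed

section \<open>Continuation in the coupling constant\<close>

lemma AE_lebesgue_imp_ex:
  assumes "AE x in (lebesgue :: real measure). R x"
  shows "\<exists>x. R x"
proof (rule ccontr)
  assume "\<not> (\<exists>x. R x)"
  then obtain N :: "real set" where "negligible N" "UNIV \<subseteq> N"
    using assms unfolding eventually_ae_filter_negligible by auto
  then show False using non_negligible_UNIV negligible_subset by blast
qed

lemma H1_diff:
  assumes "u \<in> H1" "v \<in> H1"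
  shows "(\<lambda>x. u x - v x) \<in> H1"
    and "AE x in lebesgue. ac_deriv (\<lambda>x. u x - v x) x = ac_deriv u x - ac_deriv v x"
proof -
  show AE: "AE x in lebesgue. ac_deriv (\<lambda>x. u x - v x) x = ac_deriv u x - ac_deriv v x"
    using AC_loc_has_vector_derivative[OF H1_AC_loc[OF assms(1)]] AC_loc_has_vector_derivative[OF H1_AC_loc[OF assms(2)]]
    by eventually_elim (rule vector_derivative_at, rule has_vector_derivative_diff)
  have "(\<lambda>x. ac_deriv u x - ac_deriv v x) \<in> L2" using assms by (intro L2_diff) (auto simp: H1_def)
  then have "ac_deriv (\<lambda>x. u x - v x) \<in> L2"
    by (rule L2_AE_cong) (use AE in \<open>auto elim!: eventually_mono\<close>)
  then show "(\<lambda>x. u x - v x) \<in> H1" using assms by (auto simp: H1_def intro: AC_loc_diff L2_diff)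
qed

lemma H1_spinor_AC_loc: "\<Psi> \<in> H1_spinor \<Longrightarrow> \<forall>i. (\<lambda>x. \<Psi> x $ i) \<in> AC_loc"
  by (simp add: H1_spinor_def H1_AC_loc)

lemma H1_spinor_diff:
  assumes "\<Psi> \<in> H1_spinor" "\<Phi> \<in> H1_spinor"
  shows "(\<lambda>x. \<Psi> x - \<Phi> x) \<in> H1_spinor"
    and "AE x in lebesgue. dirac h p q (\<lambda>x. \<Psi> x - \<Phi> x) x = dirac h p q \<Psi> x - dirac h p q \<Phi> x"
proof -
  have comp: "\<And>i. (\<lambda>x. \<Psi> x $ i) \<in> H1" "\<And>i. (\<lambda>x. \<Phi> x $ i) \<in> H1" using assms by (auto simp: H1_spinor_def)
  show diff: "(\<lambda>x. \<Psi> x - \<Phi> x) \<in> H1_spinor" using comp by (simp add: H1_spinor_def H1_diff(1))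
  show "AE x in lebesgue. dirac h p q (\<lambda>x. \<Psi> x - \<Phi> x) x = dirac h p q \<Psi> x - dirac h p q \<Phi> x"
    using dirac_nth_AE[OF H1_spinor_AC_loc[OF assms(1)], of h p q] dirac_nth_AE[OF H1_spinor_AC_loc[OF assms(2)], of h p q]
      dirac_nth_AE[OF H1_spinor_AC_loc[OF diff], of h p q] H1_diff(2)[OF comp(1)[of 1] comp(2)[of 1]] H1_diff(2)[OF comp(1)[of 2] comp(2)[of 2]]
  proof eventually_elim
    case (elim x)
    note e = elim(1)[THEN conjunct1] elim(1)[THEN conjunct2] elim(2)[THEN conjunct1] elim(2)[THEN conjunct2]
      elim(3)[THEN conjunct1, unfolded vector_minus_component] elim(3)[THEN conjunct2, unfolded vector_minus_component] elim(4,5)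
    show ?case unfolding vec_eq_iff forall_2 vector_minus_component e by (simp add: algebra_simps)
  qed
qed

lemma potential_mult_nth:
  "(potential p q x *v w) $ 1 = - \<i> * q x * w $ 2" "(potential p q x *v w) $ 2 = \<i> * p x * w $ 1"
  by (simp_all add: potential_def matrix_vector_mult_def sum_2)

lemma norm_potential_mult_le:
  assumes "cmod (p x) \<le> M" "cmod (q x) \<le> M"
  shows "(norm (potential p q x *v w))\<^sup>2 \<le> M\<^sup>2 * (norm w)\<^sup>2"
proof -
  have "(cmod (q x))\<^sup>2 * (cmod (w $ 2))\<^sup>2 \<le> M\<^sup>2 * (cmod (w $ 2))\<^sup>2" "(cmod (p x))\<^sup>2 * (cmod (w $ 1))\<^sup>2 \<le> M\<^sup>2 * (cmod (w $ 1))\<^sup>2"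
    using assms by (auto intro!: mult_right_mono power_mono)
  then show ?thesis by (simp add: norm_complex2 potential_mult_nth norm_mult power_mult_distrib distrib_left)
qed

lemma dirac_add_potential:
  "dirac h (\<lambda>x. p x + p' x) (\<lambda>x. q x + q' x) \<Psi> x = dirac h p q \<Psi> x + potential p' q' x *v \<Psi> x"
  by (simp add: vec_eq_iff forall_2 dirac_nth potential_mult_nth algebra_simps)

lemma potential_mult_L2:
  assumes "p \<in> borel_measurable lebesgue" "q \<in> borel_measurable lebesgue"
    and "\<And>x. cmod (p x) \<le> M" "\<And>x. cmod (q x) \<le> M" and "\<Psi> \<in> L2"
  shows "(\<lambda>x. potential p q x *v \<Psi> x) \<in> L2"
proof -
  have \<Psi>: "\<And>i. (\<lambda>x. \<Psi> x $ i) \<in> L2" using assms(5) by (simp add: L2_complex2_iff)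
  have "(\<lambda>x. - \<i> * (q x * \<Psi> x $ 2)) \<in> L2" "(\<lambda>x. \<i> * (p x * \<Psi> x $ 1)) \<in> L2"
    using assms(1-4) by (intro L2_scale L2_bounded_mult[where M = M] \<Psi>; simp)+
  then show ?thesis by (simp add: L2_complex2_iff forall_2 potential_mult_nth mult.assoc)
qed

text \<open>Without potential the two components decouple; the equations have the exponents \<open>- i z / h\<close> and \<open>i z / h\<close>, with
  real parts \<open>Im z / h\<close> and \<open>- Im z / h\<close>.\<close>

lemma free_dirac_surjective:
  assumes h: "h > 0" and z: "Im z \<noteq> 0" and f: "f \<in> L2"
  shows "\<exists>\<Psi>\<in>H1_spinor. AE x in lebesgue. dirac h (\<lambda>x. 0) (\<lambda>x. 0) \<Psi> x - z *s \<Psi> x = f x"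
proof -
  have f': "\<And>i. (\<lambda>x. f x $ i) \<in> L2" using f by (simp add: L2_complex2_iff)
  obtain u where u: "u \<in> H1" "AE x in lebesgue. ac_deriv u x = (- \<i> * z / h) * u x + (- \<i> / h) * f x $ 1"
    using exists_H1_solution_first_order[OF _ L2_scale[OF f'], of "- \<i> * z / h" "- \<i> / h" 1] h z by (auto simp del: divide_minus_left mult_minus_left)
  obtain v where v: "v \<in> H1" "AE x in lebesgue. ac_deriv v x = (\<i> * z / h) * v x + (\<i> / h) * f x $ 2"
    using exists_H1_solution_first_order[OF _ L2_scale[OF f'], of "\<i> * z / h" "\<i> / h" 2] h z by auto
  define \<Psi> :: "real \<Rightarrow> complex^2" where "\<Psi> x = vector [u x, v x]" for x
  have comp: "(\<lambda>x. \<Psi> x $ 1) = u" "(\<lambda>x. \<Psi> x $ 2) = v" by (simp_all add: \<Psi>_def)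
  have \<Psi>: "\<Psi> \<in> H1_spinor" using u(1) v(1) by (simp add: H1_spinor_def forall_2 comp)
  have "AE x in lebesgue. dirac h (\<lambda>x. 0) (\<lambda>x. 0) \<Psi> x - z *s \<Psi> x = f x"
    using dirac_nth_AE[OF H1_spinor_AC_loc[OF \<Psi>], of h "\<lambda>x. 0" "\<lambda>x. 0"] u(2) v(2) unfolding comp
  proof eventually_elim
    case (elim x)
    have "\<i> * h * ac_deriv u x = z * u x + f x $ 1" "- (\<i> * h * ac_deriv v x) = z * v x + f x $ 2"
      unfolding elim using h by (simp_all add: field_simps)
    then show ?case using elim(1) fun_cong[OF comp(1), of x] fun_cong[OF comp(2), of x]
      by (simp add: vec_eq_iff forall_2)
  qed
  then show ?thesis using \<Psi> by blast
qed

text \<open>The parameter \<open>c\<close> is the amount by which \<open>\<bar>Im z\<^sup>2\<bar>\<close> exceeds the contribution of the potentials, with the \<open>L\<^sup>\<infinity>\<close>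
  norms replaced by real bounds \<open>P\<close>, \<open>Q\<close> and \<open>b\<close>.\<close>

locale dirac_gap =
  fixes h c P Q b M :: real and p q :: "real \<Rightarrow> complex" and z :: complex
  assumes h: "h > 0" and c: "c > 0" and pq: "p \<in> AC_loc" "q \<in> AC_loc"
    and meas: "ac_deriv p \<in> borel_measurable lebesgue" "ac_deriv q \<in> borel_measurable lebesgue"
    and p': "AE x in lebesgue. cmod (ac_deriv p x) \<le> P" and q': "AE x in lebesgue. cmod (ac_deriv q x) \<le> Q"
    and b: "AE x in lebesgue. \<bar>Im (p x * q x)\<bar> \<le> b" and M: "\<And>x. cmod (p x) \<le> M" "\<And>x. cmod (q x) \<le> M"
    and gap: "h / 2 * (P + Q) + b + c \<le> \<bar>Im (z\<^sup>2)\<bar>"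
begin

definition inverse_bound :: real where "inverse_bound = 2 / c * (1 + 4 * M\<^sup>2 / c + 4 * (cmod z)\<^sup>2 / c)"

lemma inverse_bound_pos: "inverse_bound > 0"
proof -
  have "1 + 4 * M\<^sup>2 / c + 4 * (cmod z)\<^sup>2 / c > 0" using c by (intro add_pos_nonneg) auto
  then show ?thesis unfolding inverse_bound_def using c by (intro mult_pos_pos) auto
qed

definition D_scaled :: "real \<Rightarrow> (real \<Rightarrow> complex^2) \<Rightarrow> real \<Rightarrow> complex^2" where
  "D_scaled t = dirac h (\<lambda>x. of_real t * p x) (\<lambda>x. of_real t * q x)"

lemma D_scaled_1: "D_scaled 1 = dirac h p q"
  by (simp add: D_scaled_def)

lemma scaled_derivative:
  assumes r: "r \<in> AC_loc" and t: "0 \<le> t" "t \<le> 1" and rm: "ac_deriv r \<in> borel_measurable lebesgue"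
    and le: "AE x in lebesgue. cmod (ac_deriv r x) \<le> C"
  shows "ac_deriv (\<lambda>x. of_real t * r x) \<in> borel_measurable lebesgue"
    and "AE x in lebesgue. cmod (ac_deriv (\<lambda>x. of_real t * r x) x) \<le> C"
proof -
  have AE: "AE x in lebesgue. of_real t * ac_deriv r x = ac_deriv (\<lambda>x. of_real t * r x) x"
    using AC_loc_has_vector_derivative[OF r]
    by eventually_elim (rule vector_derivative_at[symmetric], rule has_vector_derivative_mult_right)
  show "ac_deriv (\<lambda>x. of_real t * r x) \<in> borel_measurable lebesgue"
    by (rule borel_measurable_AE[OF _ AE]) (use rm in auto)
  show "AE x in lebesgue. cmod (ac_deriv (\<lambda>x. of_real t * r x) x) \<le> C"
    using AE le
  proof eventually_elim
    case (elim x)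
    have "cmod (of_real t * ac_deriv r x) \<le> 1 * cmod (ac_deriv r x)"
      unfolding norm_mult using t by (intro mult_right_mono) auto
    then show ?case using elim by simp
  qed
qed

text \<open>For \<open>0 \<le> t \<le> 1\<close> the bounds \<open>P\<close>, \<open>Q\<close>, \<open>b\<close> and \<open>M\<close> also hold for the potentials \<open>t p\<close> and \<open>t q\<close>, so the constant does not
  depend on \<open>t\<close>.\<close>

lemma scaled_estimate:
  assumes t: "0 \<le> t" "t \<le> 1" and \<Psi>: "\<Psi> \<in> H1_spinor" and f: "f \<in> L2"
    and eq: "AE x in lebesgue. D_scaled t \<Psi> x - z *s \<Psi> x = f x"
  shows "L2_sq \<Psi> \<le> inverse_bound * L2_sq f"
proof -
  have t1: "cmod (of_real t * w) \<le> cmod w" for w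
    using t by (simp add: norm_mult mult_left_le_one_le)
  have comp: "(\<lambda>x. \<Psi> x $ 1) \<in> H1" "(\<lambda>x. \<Psi> x $ 2) \<in> H1" using \<Psi> by (auto simp: H1_spinor_def)
  have fcomp: "(\<lambda>x. f x $ 1) \<in> L2" "(\<lambda>x. f x $ 2) \<in> L2" using f by (auto simp: L2_complex2_iff)
  have eqs: "AE x in lebesgue. f x $ 1 = \<i> * h * ac_deriv (\<lambda>x. \<Psi> x $ 1) x - \<i> * (of_real t * q x) * \<Psi> x $ 2 - z * \<Psi> x $ 1
      \<and> f x $ 2 = - (\<i> * h * ac_deriv (\<lambda>x. \<Psi> x $ 2) x) + \<i> * (of_real t * p x) * \<Psi> x $ 1 - z * \<Psi> x $ 2"
    using eq[unfolded D_scaled_def] dirac_nth_AE[OF H1_spinor_AC_loc[OF \<Psi>], of h "\<lambda>x. of_real t * p x" "\<lambda>x. of_real t * q x"]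
  proof eventually_elim
    case (elim x)
    show ?case
      unfolding elim(1)[symmetric] vector_minus_component vector_smult_component elim(2)[THEN conjunct1] elim(2)[THEN conjunct2]
      by simp
  qed
  have "c / 2 * (LINT x|lebesgue. (cmod (\<Psi> x $ 1))\<^sup>2 + (cmod (\<Psi> x $ 2))\<^sup>2)
    \<le> (1 + 4 * M\<^sup>2 / c + 4 * (cmod z)\<^sup>2 / c) * (LINT x|lebesgue. (cmod (f x $ 1))\<^sup>2 + (cmod (f x $ 2))\<^sup>2)"
  proof (rule dirac_a_priori_estimate[OF h c _ _ _ _ _ _ _ _ _ gap comp fcomp])
    show "(\<lambda>x. of_real t * p x) \<in> AC_loc" "(\<lambda>x. of_real t * q x) \<in> AC_loc"
      using pq by (auto intro: AC_loc_mult)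
    show "cmod (of_real t * p x) \<le> M" "cmod (of_real t * q x) \<le> M" for x
      using M t1 order_trans by blast+
    show "AE x in lebesgue. \<bar>Im ((of_real t * p x) * (of_real t * q x))\<bar> \<le> b"
      using b
    proof eventually_elim
      case (elim x)
      have "(of_real t * p x) * (of_real t * q x) = of_real (t * t) * (p x * q x)" by (simp add: mult_ac)
      moreover have "Im (of_real r * w) = r * Im w" for r w by simp
      ultimately have "Im ((of_real t * p x) * (of_real t * q x)) = (t * t) * Im (p x * q x)" by metis
      then have "\<bar>Im ((of_real t * p x) * (of_real t * q x))\<bar> = (t * t) * \<bar>Im (p x * q x)\<bar>"
        by (simp only: abs_mult abs_mult_self_eq)
      also have "\<dots> \<le> 1 * \<bar>Im (p x * q x)\<bar>" using t by (intro mult_right_mono mult_le_one) auto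
      finally show ?case using elim by simp
    qed
  qed (use scaled_derivative[OF pq(1) t meas(1) p'] scaled_derivative[OF pq(2) t meas(2) q'] eqs in \<open>auto elim!: eventually_mono\<close>)
  then have "2 / c * (c / 2 * L2_sq \<Psi>)
    \<le> 2 / c * ((1 + 4 * M\<^sup>2 / c + 4 * (cmod z)\<^sup>2 / c) * L2_sq f)"
    unfolding norm_complex2 using c by (intro mult_left_mono) auto
  moreover have "2 / c * (c / 2 * y) = y" for y using c by simp
  ultimately show ?thesis unfolding inverse_bound_def mult.assoc by simp
qed

definition surjective :: "real \<Rightarrow> bool" where
  "surjective t \<longleftrightarrow> (\<forall>f\<in>L2. \<exists>\<Psi>\<in>H1_spinor. AE x in lebesgue. D_scaled t \<Psi> x - z *s \<Psi> x = f x)"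

text \<open>The gap forces \<open>Im z\<^sup>2 \<noteq> 0\<close>, and so \<open>z\<close> is not real.\<close>

lemma surjective_0: "surjective 0"
proof -
  have "P \<ge> 0" "Q \<ge> 0" "b \<ge> 0"
    using AE_lebesgue_imp_ex[OF p'] AE_lebesgue_imp_ex[OF q'] AE_lebesgue_imp_ex[OF b]
    by (meson norm_ge_zero abs_ge_zero order_trans)+
  then have "\<bar>Im (z\<^sup>2)\<bar> > 0" using gap c h by (smt (verit) divide_pos_pos mult_nonneg_nonneg)
  then have "Im z \<noteq> 0" by (auto simp: power2_eq_square)
  then show ?thesis using free_dirac_surjective[OF h] by (simp add: surjective_def D_scaled_def)
qed

text \<open>Let \<open>R\<close> invert \<open>\<DD>\<^sub>t - z\<close>, and let \<open>V\<close> be the difference of the potentials for \<open>s\<close> and \<open>t\<close>.  Then \<open>R f\<close> solves the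
  equation for \<open>s\<close> with right-hand side \<open>g\<close> if and only if \<open>f = g - V R f\<close>, and the map on the right is a contraction
  because \<open>R\<close> is bounded and \<open>V\<close> is small.\<close>

lemma surjective_step:
  assumes surj: "surjective t" and t: "0 \<le> t" "t \<le> 1" and small: "(s - t)\<^sup>2 * M\<^sup>2 * inverse_bound \<le> 1 / 16"
  shows "surjective s"
  unfolding surjective_def
proof
  fix g :: "real \<Rightarrow> complex^2" assume g: "g \<in> L2"
  define V where "V x = potential (\<lambda>x. of_real (s - t) * p x) (\<lambda>x. of_real (s - t) * q x) x" for x
  have Vb: "cmod (of_real (s - t) * p x) \<le> \<bar>s - t\<bar> * M" "cmod (of_real (s - t) * q x) \<le> \<bar>s - t\<bar> * M" for x
    using M by (auto simp: norm_mult mult_left_mono simp flip: of_real_diff)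
  have VL2: "(\<lambda>x. V x *v \<Psi> x) \<in> L2" if "\<Psi> \<in> L2" for \<Psi>
    unfolding V_def
    by (rule potential_mult_L2[OF _ _ Vb that]; intro AC_loc_measurable AC_loc_mult AC_loc_const pq)
  have Vle: "(norm (V x *v w))\<^sup>2 \<le> (s - t)\<^sup>2 * M\<^sup>2 * (norm w)\<^sup>2" for x w
    using norm_potential_mult_le[of "\<lambda>x. of_real (s - t) * p x" x "\<bar>s - t\<bar> * M" "\<lambda>x. of_real (s - t) * q x" w, OF Vb]
    by (simp add: V_def power_mult_distrib)
  obtain R where R: "\<And>f. f \<in> L2 \<Longrightarrow> R f \<in> H1_spinor"
      "\<And>f. f \<in> L2 \<Longrightarrow> AE x in lebesgue. D_scaled t (R f) x - z *s R f x = f x"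
  proof -
    have "\<forall>f\<in>L2. \<exists>\<Psi>. \<Psi> \<in> H1_spinor \<and> (AE x in lebesgue. D_scaled t \<Psi> x - z *s \<Psi> x = f x)"
      using surj unfolding surjective_def by blast
    from bchoice[OF this] that show ?thesis by blast
  qed
  define T where "T f x = g x - V x *v R f x" for f x
  have "\<exists>f\<in>L2. AE x in lebesgue. T f x = f x"
  proof (rule L2_contraction_fixed_point)
    fix f :: "real \<Rightarrow> complex^2" assume f: "f \<in> L2"
    show "T f \<in> L2"
      using L2_diff[OF g VL2[OF H1_spinor_L2[OF R(1)[OF f]]]] by (simp add: T_def[abs_def])
  next
    fix f k :: "real \<Rightarrow> complex^2" assume f: "f \<in> L2" and k: "k \<in> L2"
    have diff: "(\<lambda>x. R f x - R k x) \<in> H1_spinor" by (rule H1_spinor_diff(1)[OF R(1)[OF f] R(1)[OF k]])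
    have "AE x in lebesgue. D_scaled t (\<lambda>x. R f x - R k x) x - z *s (R f x - R k x) = f x - k x"
      using H1_spinor_diff(2)[OF R(1)[OF f] R(1)[OF k], where h = h and p = "\<lambda>x. of_real t * p x" and q = "\<lambda>x. of_real t * q x"] R(2)[OF f] R(2)[OF k] unfolding D_scaled_def
    proof eventually_elim
      case (elim x)
      show ?case unfolding elim(1) elim(2,3)[symmetric] by (simp add: vec_eq_iff algebra_simps)
    qed
    note est = scaled_estimate[OF t diff L2_diff[OF f k] this]
    have i: "integrable lebesgue (\<lambda>x. (s - t)\<^sup>2 * M\<^sup>2 * (norm (R f x - R k x))\<^sup>2)"
      by (intro integrable_mult_right L2_integrable H1_spinor_L2 diff)
    have "L2_sq (\<lambda>x. T f x - T k x) \<le> (LINT x|lebesgue. (s - t)\<^sup>2 * M\<^sup>2 * (norm (R f x - R k x))\<^sup>2)"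
    proof (rule L2I_dominated(2)[OF _ i])
      have eq: "T f x - T k x = V x *v (R k x - R f x)" for x
        by (simp add: T_def matrix_vector_mult_diff_distrib)
      show "(\<lambda>x. T f x - T k x) \<in> borel_measurable lebesgue"
        unfolding eq by (rule L2_measurable[OF VL2[OF H1_spinor_L2[OF H1_spinor_diff(1)[OF R(1)[OF k] R(1)[OF f]]]]])
      show "AE x in lebesgue. (norm (T f x - T k x))\<^sup>2 \<le> (s - t)\<^sup>2 * M\<^sup>2 * (norm (R f x - R k x))\<^sup>2"
        unfolding eq using Vle by (intro AE_I2) (metis norm_minus_commute)
    qed
    also have "\<dots> = (s - t)\<^sup>2 * M\<^sup>2 * L2_sq (\<lambda>x. R f x - R k x)" by simp
    also have "\<dots> \<le> (s - t)\<^sup>2 * M\<^sup>2 * (inverse_bound * L2_sq (\<lambda>x. f x - k x))"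
      using est by (intro mult_left_mono) auto
    also have "\<dots> = ((s - t)\<^sup>2 * M\<^sup>2 * inverse_bound) * L2_sq (\<lambda>x. f x - k x)" by simp
    also have "\<dots> \<le> 1 / 16 * L2_sq (\<lambda>x. f x - k x)" using small by (intro mult_right_mono) auto
    finally show "L2_sq (\<lambda>x. T f x - T k x) \<le> L2_sq (\<lambda>x. f x - k x) / 16" by simp
  qed
  then obtain f where f: "f \<in> L2" "AE x in lebesgue. T f x = f x" by blast
  have Ds: "D_scaled s \<Psi> x = D_scaled t \<Psi> x + V x *v \<Psi> x" for \<Psi> x
    using dirac_add_potential[of h "\<lambda>x. of_real t * p x" "\<lambda>x. of_real (s - t) * p x" "\<lambda>x. of_real t * q x" "\<lambda>x. of_real (s - t) * q x" \<Psi> x]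
    by (simp add: D_scaled_def V_def left_diff_distrib)
  have "AE x in lebesgue. D_scaled s (R f) x - z *s R f x = g x"
    using f(2) R(2)[OF f(1)] by eventually_elim (simp add: Ds T_def algebra_simps)
  then show "\<exists>\<Psi>\<in>H1_spinor. AE x in lebesgue. D_scaled s \<Psi> x - z *s \<Psi> x = g x" using R(1)[OF f(1)] by blast
qed

lemma surjective_1: "surjective 1"
proof -
  obtain n :: nat where n: "16 * M\<^sup>2 * inverse_bound < real n" using reals_Archimedean2 by blast
  then have n0: "real n > 0" using inverse_bound_pos by (smt (verit) mult_nonneg_nonneg zero_le_power2)
  have "surjective (real j / real n)" if "j \<le> n" for j
    using that
  proof (induction j)
    case 0 then show ?case using surjective_0 by simp
  next
    case (Suc j)
    show ?case
    proof (rule surjective_step)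
      show "surjective (real j / real n)" using Suc by simp
      have "(real (Suc j) / real n - real j / real n) = 1 / real n" using n0 by (simp add: field_simps)
      then have "(real (Suc j) / real n - real j / real n)\<^sup>2 * M\<^sup>2 * inverse_bound = (M\<^sup>2 * inverse_bound) / (real n)\<^sup>2"
        by (simp add: power_divide)
      also have "\<dots> \<le> 1 / 16"
      proof -
        have "1 \<le> real n" using n0 by simp
        then have "real n \<le> (real n)\<^sup>2" by (simp add: power2_eq_square)
        moreover have "16 * (M\<^sup>2 * inverse_bound) < real n" using n by (simp only: mult.assoc)
        ultimately have "16 * (M\<^sup>2 * inverse_bound) \<le> (real n)\<^sup>2" by (rule less_imp_le[OF order.strict_trans2[rotated]])
        then show ?thesis using n0 by (simp add: field_simps)
      qed
      finally show "(real (Suc j) / real n - real j / real n)\<^sup>2 * M\<^sup>2 * inverse_bound \<le> 1 / 16" .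
    qed (use Suc n0 in auto)
  qed
  from this[of n] show ?thesis using n0 by simp
qed

lemma z_in_resolvent_set: "z \<in> resolvent_set (dirac_domain h p q) (dirac h p q)"
proof -
  have dom: "dirac_domain h p q = H1_spinor"
    by (rule dirac_domain_eq_H1_spinor[OF _ AC_loc_measurable[OF pq(1)] AC_loc_measurable[OF pq(2)] M]) (use h in simp)
  have zL2: "(\<lambda>x. z *s \<Psi> x) \<in> L2" if "\<Psi> \<in> L2" for \<Psi> :: "real \<Rightarrow> complex^2"
    using that unfolding L2_complex2_iff vector_smult_component by (auto intro: L2_scale)
  have DL2: "(\<lambda>x. dirac h p q \<Psi> x - z *s \<Psi> x) \<in> L2" if "\<Psi> \<in> H1_spinor" for \<Psi>
    using that unfolding dom[symmetric] by (intro L2_diff zL2) (auto simp: dirac_domain_def)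
  have est: "L2_sq \<Psi> \<le> inverse_bound * L2_sq f"
    if "\<Psi> \<in> H1_spinor" "f \<in> L2" "AE x in lebesgue. dirac h p q \<Psi> x - z *s \<Psi> x = f x" for \<Psi> f
    using scaled_estimate[of 1 \<Psi> f] that by (simp add: D_scaled_1)
  show ?thesis unfolding resolvent_set_def dom
  proof (intro CollectI conjI ballI impI)
    fix \<Psi> \<Phi> :: "real \<Rightarrow> complex^2"
    assume \<Psi>: "\<Psi> \<in> H1_spinor" and \<Phi>: "\<Phi> \<in> H1_spinor"
      and eq: "AE x in lebesgue. dirac h p q \<Psi> x - z *s \<Psi> x = dirac h p q \<Phi> x - z *s \<Phi> x"
    note diff = H1_spinor_diff[OF \<Psi> \<Phi>]
    have "AE x in lebesgue. dirac h p q (\<lambda>x. \<Psi> x - \<Phi> x) x - z *s (\<Psi> x - \<Phi> x) = 0"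
      using eq diff(2)[of h p q]
    proof eventually_elim
      case (elim x)
      have "dirac h p q (\<lambda>x. \<Psi> x - \<Phi> x) x - z *s (\<Psi> x - \<Phi> x)
          = (dirac h p q \<Psi> x - z *s \<Psi> x) - (dirac h p q \<Phi> x - z *s \<Phi> x)"
        unfolding elim(2) by (simp add: vec_eq_iff algebra_simps)
      then show ?case unfolding elim(1) by simp
    qed
    then have "L2_sq (\<lambda>x. \<Psi> x - \<Phi> x) \<le> 0"
      using est[OF diff(1), of "\<lambda>x. 0"] by (simp add: L2_def)
    moreover have "L2_sq (\<lambda>x. \<Psi> x - \<Phi> x) \<ge> 0" by simp
    ultimately have "L2_sq (\<lambda>x. \<Psi> x - \<Phi> x) = 0" by linarith
    then have "AE x in lebesgue. (norm (\<Psi> x - \<Phi> x))\<^sup>2 = 0"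
      by (subst (asm) integral_nonneg_eq_0_iff_AE) (auto intro!: L2_integrable H1_spinor_L2 diff)
    then show "AE x in lebesgue. \<Psi> x = \<Phi> x" by auto
  next
    fix f :: "real \<Rightarrow> complex^2" assume "f \<in> L2"
    then show "\<exists>\<Psi>\<in>H1_spinor. AE x in lebesgue. dirac h p q \<Psi> x - z *s \<Psi> x = f x"
      using surjective_1 by (simp add: surjective_def D_scaled_1)
  next
    show "\<exists>C. \<forall>\<Psi>\<in>H1_spinor. L2_norm \<Psi> \<le> C * L2_norm (\<lambda>x. dirac h p q \<Psi> x - z *s \<Psi> x)"
    proof (intro exI[of _ "sqrt inverse_bound"] ballI)
      fix \<Psi> :: "real \<Rightarrow> complex^2" assume \<Psi>: "\<Psi> \<in> H1_spinor"
      show "L2_norm \<Psi> \<le> sqrt inverse_bound * L2_norm (\<lambda>x. dirac h p q \<Psi> x - z *s \<Psi> x)"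
        unfolding L2_norm_def real_sqrt_mult[symmetric] by (intro real_sqrt_le_mono est \<Psi> DL2) simp
    qed
  qed
qed

end

lemma continuous_periodic_bounded:
  fixes p :: "real \<Rightarrow> complex"
  assumes cont: "continuous_on UNIV p" and per: "\<forall>x. p (x + 1) = p x"
  shows "\<exists>M. \<forall>x. cmod (p x) \<le> M"
proof -
  have "bounded (p ` {0..1})"
    by (intro compact_imp_bounded compact_continuous_image continuous_on_subset[OF cont]) auto
  then obtain M where M: "\<forall>y\<in>p ` {0..1}. cmod y \<le> M" unfolding bounded_iff by blast
  have shift: "p (x + real n) = p x" for x n
  proof (induction n)
    case (Suc n)
    have "p (x + real (Suc n)) = p ((x + real n) + 1)" by (simp add: algebra_simps)
    then show ?case using Suc per by simp
  qed simp
  have "p x = p (frac x)" for x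
  proof (cases "\<lfloor>x\<rfloor> \<ge> 0")
    case True
    then show ?thesis using shift[of "frac x" "nat \<lfloor>x\<rfloor>"] by (simp add: frac_def)
  next
    case False
    then show ?thesis using shift[of x "nat (- \<lfloor>x\<rfloor>)"] by (simp add: frac_def)
  qed
  moreover have "frac x \<in> {0..1}" for x :: real using frac_lt_1[of x] by (simp add: less_imp_le)
  ultimately have "cmod (p x) \<le> M" for x using M by (metis imageI)
  then show ?thesis by blast
qed

lemma Linf_normE:
  assumes "Linf_norm f < \<infinity>"
  obtains r where "Linf_norm f = ereal r" "AE x in lebesgue. cmod (f x) \<le> r"
proof -
  have AE: "AE x in lebesgue. ereal (cmod (f x)) \<le> Linf_norm f" unfolding Linf_norm_def by (rule esssup_AE)
  then obtain x where "ereal (cmod (f x)) \<le> Linf_norm f" using AE_lebesgue_imp_ex by blast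
  then have "Linf_norm f \<noteq> - \<infinity>" by auto
  then obtain r where r: "Linf_norm f = ereal r" using assms by (cases "Linf_norm f") auto
  have "AE x in lebesgue. cmod (f x) \<le> r" using AE unfolding r by simp
  then show ?thesis using r that by blast
qed

theorem lemma4p4:
  fixes h :: real and p q :: "real \<Rightarrow> complex" and z :: complex
  assumes "h > 0"
    and "\<forall>x. p (x + 1) = p x" and "\<forall>x. q (x + 1) = q x"
    and "p \<in> AC_loc" and "q \<in> AC_loc"
    and "ac_deriv p \<in> Linf" and "ac_deriv q \<in> Linf"
    and "z \<in> dirac_spectrum h p q"
  shows "ereal (\<bar>Re z\<bar> * \<bar>Im z\<bar>)
    \<le> ereal (h / 2) * (Linf_norm (ac_deriv p) + Linf_norm (ac_deriv q))
      + ereal (1 / 4) * Linf_norm (\<lambda>x. cnj (p x) * cnj (q x) - p x * q x)"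
proof -
  note h = assms(1) and pq = assms(4,5)
  obtain M1 M2 where "\<forall>x. cmod (p x) \<le> M1" "\<forall>x. cmod (q x) \<le> M2"
    using continuous_periodic_bounded AC_loc_continuous pq assms(2,3) by metis
  then have M: "cmod (p x) \<le> max M1 M2" "cmod (q x) \<le> max M1 M2" for x by (auto simp: le_max_iff_disj)
  obtain P where P: "Linf_norm (ac_deriv p) = ereal P" "AE x in lebesgue. cmod (ac_deriv p x) \<le> P"
    using assms(6) unfolding Linf_def by (blast elim: Linf_normE)
  obtain Q where Q: "Linf_norm (ac_deriv q) = ereal Q" "AE x in lebesgue. cmod (ac_deriv q x) \<le> Q"
    using assms(7) unfolding Linf_def by (blast elim: Linf_normE)
  have im: "cmod (cnj (p x) * cnj (q x) - p x * q x) = 2 * \<bar>Im (p x * q x)\<bar>" for x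
  proof -
    have "cnj (p x) * cnj (q x) - p x * q x = - (2 * \<i> * of_real (Im (p x * q x)))"
      by (simp add: complex_eq_iff)
    then show ?thesis by (simp add: norm_mult del: times_complex.sel)
  qed
  have "Linf_norm (\<lambda>x. cnj (p x) * cnj (q x) - p x * q x) \<le> ereal (2 * (max M1 M2 * max M1 M2))"
    unfolding Linf_norm_def
  proof (rule esssup_I)
    have "(\<lambda>x. cnj (p x) * cnj (q x) - p x * q x) \<in> AC_loc" by (intro AC_loc_diff AC_loc_mult AC_loc_cnj pq)
    then have m: "(\<lambda>x. cnj (p x) * cnj (q x) - p x * q x) \<in> borel_measurable lebesgue" by (rule AC_loc_measurable)
    show "(\<lambda>x. ereal (cmod (cnj (p x) * cnj (q x) - p x * q x))) \<in> borel_measurable lebesgue"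
      by (rule borel_measurable_ereal[OF measurable_compose[OF m borel_measurable_norm]])
    have "cmod (cnj (p x) * cnj (q x) - p x * q x) \<le> 2 * (max M1 M2 * max M1 M2)" for x
    proof -
      have "\<bar>Im (p x * q x)\<bar> \<le> cmod (p x) * cmod (q x)" by (metis abs_Im_le_cmod norm_mult)
      also have "\<dots> \<le> max M1 M2 * max M1 M2"
        using M order_trans[OF norm_ge_zero M(1)] by (intro mult_mono) auto
      finally show ?thesis unfolding im by simp
    qed
    then show "AE x in lebesgue. ereal (cmod (cnj (p x) * cnj (q x) - p x * q x)) \<le> ereal (2 * (max M1 M2 * max M1 M2))"
      by simp
  qed
  then have "Linf_norm (\<lambda>x. cnj (p x) * cnj (q x) - p x * q x) < \<infinity>" by (rule order_le_less_trans) simp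
  then obtain B where B: "Linf_norm (\<lambda>x. cnj (p x) * cnj (q x) - p x * q x) = ereal B"
      "AE x in lebesgue. cmod (cnj (p x) * cnj (q x) - p x * q x) \<le> B"
    by (rule Linf_normE)
  have nonneg: "P \<ge> 0" "Q \<ge> 0"
    using AE_lebesgue_imp_ex[OF P(2)] AE_lebesgue_imp_ex[OF Q(2)] by (meson norm_ge_zero order_trans)+
  have "\<bar>Re z\<bar> * \<bar>Im z\<bar> \<le> h / 2 * (P + Q) + 1 / 4 * B"
  proof (rule ccontr)
    assume "\<not> \<bar>Re z\<bar> * \<bar>Im z\<bar> \<le> h / 2 * (P + Q) + 1 / 4 * B"
    then have large: "h / 2 * (P + Q) + 1 / 4 * B < \<bar>Re z\<bar> * \<bar>Im z\<bar>" by simp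
    have im2: "\<bar>Im (z\<^sup>2)\<bar> = 2 * (\<bar>Re z\<bar> * \<bar>Im z\<bar>)" by (simp add: power2_eq_square abs_mult)
    have hPQ: "0 \<le> h / 2 * (P + Q)" using h nonneg by simp
    \<comment> \<open>The bound \<open>b\<close> for \<open>\<bar>Im (p q)\<bar>\<close> is \<open>B / 2\<close>, as \<open>cnj p cnj q - p q = - 2 i Im (p q)\<close>.\<close>
    define c where "c = \<bar>Im (z\<^sup>2)\<bar> - (h / 2 * (P + Q) + B / 2)"
    have c: "c > 0" using large hPQ unfolding c_def im2 by linarith
    have "dirac_gap h c P Q (B / 2) (max M1 M2) p q z"
    proof
      show "AE x in lebesgue. \<bar>Im (p x * q x)\<bar> \<le> B / 2"
        using B(2) unfolding im by eventually_elim simp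
      show "ac_deriv p \<in> borel_measurable lebesgue" "ac_deriv q \<in> borel_measurable lebesgue"
        using assms(6,7) by (auto simp: Linf_def)
      show "h / 2 * (P + Q) + B / 2 + c \<le> \<bar>Im (z\<^sup>2)\<bar>" by (simp add: c_def)
    qed (use h c pq P Q M in auto)
    then have "z \<in> resolvent_set (dirac_domain h p q) (dirac h p q)" by (rule dirac_gap.z_in_resolvent_set)
    then show False using assms(8) by (simp add: dirac_spectrum_def op_spectrum_def)
  qed
  then show ?thesis unfolding P(1) Q(1) B(1) by simp
qed

end
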